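(* Let $d\ge 1$, $\beta\in(0,1]$, and let $(\pi,m,\sigma)$ define a Gaussian-mixture path with velocity field $v_t$ as in the context, with $\sigma\in C^1_{\text{a.e.}}([0,1],[0,1])$. Suppose that for $t\in[0,1]$ with $\sigma_t>0$: (i) the law $(m_t)_\#\pi$ has a probability density on $\mathbb R^d$ which is $(\alpha_t,\beta,K_t)$-weakly log-concave, with $\alpha_t,K_t>0$; (ii) there is $L_t>0$ such that for all $x\in\mathbb R^d$ and all unit vectors $h\in\mathbb R^d$, $\operatorname{Var}_{\pi^{t,x}}\big(h^\top m_t'(Z)\big)\le L_t^2\,\frac{\sigma_t^2}{\alpha_t\sigma_t^2+1}$. Then there is a constant $C>0$ depending only on $\beta$ (and not on the dimension $d$) such that for every $x\in\mathbb R^d$, every $t\in[0,1]$ with $\sigma_t>0$ (at which the derivatives exist) and every $\xi\in\{0,1\}$: - if $\sigma_t'\le 0$, then $$\lambda_{\max}\big(\nabla v_t(x)\big)\le \frac{1}{\alpha_t\sigma_t^2+1}\left(C\exp\Big(\frac{CK_t^2}{(\alpha_t+\sigma_t^{-2})^{\beta}}\Big)\Big(L_t-\sigma_t'\sigma_t^{-1}(K_t\sigma_t^\beta)^\xi\Big)+\sigma_t\sigma_t'\alpha_t\right);$$ - if $\sigma_t'\ge 0$ and $\nabla^2u_t\preceq A_t\,\mathrm{Id}$ on $\mathbb R^d$, where $(m_t)_\#\pi=\exp(-u_t+a_t)$ is the decomposition given by the weak log-concavity in (i) ($u_t$ convex, $a_t$ $\beta$-Hölder), then $$\lambda_{\max}\big(\nabla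 v_t(x)\big)\le \frac{1}{\alpha_t\sigma_t^2+1}\left(C\exp\Big(\frac{CK_t^2}{(\alpha_t+\sigma_t^{-2})^{\beta}}\Big)\Big(L_t+\sigma_t'\sigma_t^{-1}(K_t\sigma_t^\beta)^\xi\Big)+\sigma_t\sigma_t'A_t\right).$$
   Context: Weak log-concavity. For $\alpha,K>0$ and $\beta\in(0,1]$, a probability density $p$ on $\mathbb R^d$ is $(\alpha,\beta,K)$-weakly log-concave if $p=\exp(-u+a)$ where (1) $u:\mathbb R^d\to\mathbb R\cup\{+\infty\}$ is convex, $C^2$ on the interior of the support, with $\nabla^2u\succeq\alpha\,\mathrm{Id}$ there; (2) $a$ satisfies $|a(x)-a(y)|\le K\|x-y\|^\beta$ for all $x,y\in\mathbb R^d$. Gaussian-mixture path. Let $\pi$ be a probability measure on $\mathbb R^d\times\mathbb R^d$, $Z\sim\pi$, and $\xi\sim\mathcal N(0,I_d)$ independent of $Z$. Let $m_t:\mathrm{Supp}(\pi)\to\mathbb R^d$ and $\sigma_t\ge0$, $t\in[0,1]$, be differentiable in $t$; primes denote time derivatives, $m_t'(z)=\partial_tm_t(z)$. Set $X_t=m_t(Z)+\sigma_t\xi$. For $\sigma_t>0$ let $\pi^{t,x}=\mathrm{Law}(Z\mid X_t=x)$, i.e. $\pi^{t,x}(dz)\propto\exp\big(-\|x-m_t(z)\|^2/(2\sigma_t^2)\big)\pi(dz)$, and define $$v_t(x)=\int\Big(\frac{\sigma_t'}{\sigma_t}(x-m_t(z))+m_t'(z)\Big)\,\pi^{t,x}(dz).$$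 For a square matrix $A$, $\lambda_{\max}(A)$ denotes the largest eigenvalue of $(A+A^\top)/2$. $\nabla v_t$ is the Jacobian in $x$. $C^1_{\text{a.e.}}([0,1],[0,1])$ denotes absolutely continuous functions $[0,1]\to[0,1]$ that are continuously differentiable outside a closed Lebesgue-null set. *)

theory Defs
  imports "HOL-Probability.Probability" "Jordan_Normal_Form.Char_Poly"
begin

text \<open>
  The constant of the theorem must not depend on the dimension, so the dimension \<open>d\<close> is a
  natural number that is quantified inside the statement. Accordingly \<open>\<real>\<^sup>d\<close> is the carrier
  of the library topology \<^const>\<open>Euclidean_space\<close>: functions \<open>nat \<Rightarrow> real\<close> vanishing at all
  indices \<open>\<ge> d\<close>. On this carrier the topology of the type \<open>nat \<Rightarrow> real\<close> is the usual one.
  Matrices are functions \<open>nat \<Rightarrow> nat \<Rightarrow> real\<close>, of which only the entries with both indices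
  below \<open>d\<close> matter.
\<close>

type_synonym rvec = "nat \<Rightarrow> real"

abbreviation Rsp :: "nat \<Rightarrow> rvec set" where
  "Rsp d \<equiv> topspace (Euclidean_space d)"

definition enorm :: "nat \<Rightarrow> rvec \<Rightarrow> real" where
  "enorm d x = L2_set x {..<d}"

definition edist :: "nat \<Rightarrow> rvec \<Rightarrow> rvec \<Rightarrow> real" where
  "edist d x y = enorm d (\<lambda>i. x i - y i)"

definition Rborel :: "nat \<Rightarrow> rvec measure" where
  "Rborel d = restrict_space borel (Rsp d)"

definition Rlebesgue :: "nat \<Rightarrow> rvec measure" where
  "Rlebesgue d = distr (\<Pi>\<^sub>M i\<in>{..<d}. lborel) (Rborel d) (\<lambda>x i. if i < d then x i else 0)"


section \<open>Derivatives in the space variable\<close>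

text \<open>Frechet derivatives of scalar functions and of vector fields on \<open>\<real>\<^sup>d\<close>.\<close>

definition has_gradient :: "nat \<Rightarrow> (rvec \<Rightarrow> real) \<Rightarrow> rvec \<Rightarrow> rvec \<Rightarrow> bool" where
  "has_gradient d f x g \<longleftrightarrow>
     ((\<lambda>y. (f y - f x - (\<Sum>j<d. g j * (y j - x j))) / edist d y x) \<longlongrightarrow> 0) (at x within Rsp d)"

definition has_jacobian ::
  "nat \<Rightarrow> (rvec \<Rightarrow> rvec) \<Rightarrow> rvec \<Rightarrow> (nat \<Rightarrow> nat \<Rightarrow> real) \<Rightarrow> bool" where
  "has_jacobian d v x J \<longleftrightarrow>
     ((\<lambda>y. enorm d (\<lambda>i. v y i - v x i - (\<Sum>j<d. J i j * (y j - x j))) / edist d y x) \<longlongrightarrow> 0)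
       (at x within Rsp d)"

definition has_hessian ::
  "nat \<Rightarrow> (rvec \<Rightarrow> real) \<Rightarrow> rvec \<Rightarrow> (nat \<Rightarrow> nat \<Rightarrow> real) \<Rightarrow> bool" where
  "has_hessian d f x H \<longleftrightarrow>
     (\<exists>U g. openin (Euclidean_space d) U \<and> x \<in> U \<and> (\<forall>y\<in>U. has_gradient d f y (g y)) \<and>
            has_jacobian d g x H)"

definition C2_on :: "nat \<Rightarrow> rvec set \<Rightarrow> (rvec \<Rightarrow> real) \<Rightarrow> bool" where
  "C2_on d U f \<longleftrightarrow>
     (\<exists>H. (\<forall>x\<in>U. has_hessian d f x (H x)) \<and> (\<forall>i<d. \<forall>j<d. continuous_on U (\<lambda>x. H x i j)))"

definition loewner_le :: "nat \<Rightarrow> (nat \<Rightarrow> nat \<Rightarrow> real) \<Rightarrow> (nat \<Rightarrow> nat \<Rightarrow> real) \<Rightarrow> bool" where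
  "loewner_le d A B \<longleftrightarrow>
     (\<forall>h\<in>Rsp d. (\<Sum>i<d. \<Sum>j<d. h i * A i j * h j) \<le> (\<Sum>i<d. \<Sum>j<d. h i * B i j * h j))"

definition scaled_id :: "real \<Rightarrow> nat \<Rightarrow> nat \<Rightarrow> real" where
  "scaled_id c i j = (if i = j then c else 0)"

definition lambda_max :: "nat \<Rightarrow> (nat \<Rightarrow> nat \<Rightarrow> real) \<Rightarrow> real" where
  "lambda_max d A = Max {k. eigenvalue (Matrix.mat d d (\<lambda>(i, j). (A i j + A j i) / 2)) k}"


section \<open>Weak log-concavity\<close>

definition ereal_convex :: "nat \<Rightarrow> (rvec \<Rightarrow> ereal) \<Rightarrow> bool" where
  "ereal_convex d u \<longleftrightarrow>
     (\<forall>x\<in>Rsp d. u x \<noteq> -\<infinity>) \<and>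
     (\<forall>x\<in>Rsp d. \<forall>y\<in>Rsp d. \<forall>s\<in>{0<..<1}.
        u (\<lambda>i. (1 - s) * x i + s * y i) \<le> ereal (1 - s) * u x + ereal s * u y)"

definition prob_density_on :: "nat \<Rightarrow> (rvec \<Rightarrow> real) \<Rightarrow> bool" where
  "prob_density_on d p \<longleftrightarrow>
     p \<in> borel_measurable (Rborel d) \<and> (\<forall>x\<in>Rsp d. 0 \<le> p x) \<and>
     (\<integral>\<^sup>+x. ennreal (p x) \<partial>Rlebesgue d) = 1"

definition support_interior :: "nat \<Rightarrow> (rvec \<Rightarrow> real) \<Rightarrow> rvec set" where
  "support_interior d p =
     Euclidean_space d interior_of (Euclidean_space d closure_of {x \<in> Rsp d. p x \<noteq> 0})"

text \<open>
  \<open>p = exp (-u + a)\<close> is the decomposition of an \<open>(\<alpha>, \<beta>, K)\<close>-weakly log-concave density,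
  with \<open>exp (-\<infinity>) = 0\<close>.
\<close>

definition weak_log_concave_decomp ::
  "nat \<Rightarrow> real \<Rightarrow> real \<Rightarrow> real \<Rightarrow> (rvec \<Rightarrow> real) \<Rightarrow> (rvec \<Rightarrow> ereal) \<Rightarrow> (rvec \<Rightarrow> real) \<Rightarrow> bool" where
  "weak_log_concave_decomp d \<alpha> \<beta> K p u a \<longleftrightarrow>
     0 < \<alpha> \<and> 0 < K \<and> 0 < \<beta> \<and> \<beta> \<le> 1 \<and>
     (\<forall>x\<in>Rsp d. p x = (if u x = \<infinity> then 0 else exp (- real_of_ereal (u x) + a x))) \<and>
     ereal_convex d u \<and>
     (\<forall>x\<in>support_interior d p. u x \<noteq> \<infinity>) \<and>
     C2_on d (support_interior d p) (\<lambda>x. real_of_ereal (u x)) \<and>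
     (\<forall>x\<in>support_interior d p. \<forall>H. has_hessian d (\<lambda>x. real_of_ereal (u x)) x H \<longrightarrow>
        loewner_le d (scaled_id \<alpha>) H) \<and>
     (\<forall>x\<in>Rsp d. \<forall>y\<in>Rsp d. \<bar>a x - a y\<bar> \<le> K * edist d x y powr \<beta>)"

definition weakly_log_concave ::
  "nat \<Rightarrow> real \<Rightarrow> real \<Rightarrow> real \<Rightarrow> (rvec \<Rightarrow> real) \<Rightarrow> bool" where
  "weakly_log_concave d \<alpha> \<beta> K p \<longleftrightarrow> (\<exists>u a. weak_log_concave_decomp d \<alpha> \<beta> K p u a)"

definition has_density :: "nat \<Rightarrow> rvec measure \<Rightarrow> (rvec \<Rightarrow> real) \<Rightarrow> bool" where
  "has_density d \<mu> p \<longleftrightarrow> prob_density_on d p \<and> \<mu> = density (Rlebesgue d) (\<lambda>x. ennreal (p x))"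

text \<open>The condition \<open>\<nabla>\<^sup>2 u \<preceq> A Id\<close> on all of \<open>\<real>\<^sup>d\<close>; in particular \<open>u\<close> is finite there.\<close>

definition hessian_le_everywhere :: "nat \<Rightarrow> (rvec \<Rightarrow> ereal) \<Rightarrow> real \<Rightarrow> bool" where
  "hessian_le_everywhere d u A \<longleftrightarrow>
     (\<forall>x\<in>Rsp d. u x \<noteq> \<infinity>) \<and>
     (\<forall>x\<in>Rsp d. \<exists>H. has_hessian d (\<lambda>x. real_of_ereal (u x)) x H \<and> loewner_le d H (scaled_id A))"


section \<open>Gaussian-mixture paths\<close>

definition Supp :: "'a :: topological_space measure \<Rightarrow> 'a set" where
  "Supp \<pi> = {z \<in> space \<pi>. \<forall>U. open U \<longrightarrow> z \<in> U \<longrightarrow> 0 < emeasure \<pi> (U \<inter> space \<pi>)}"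

text \<open>
  The maps \<open>m t\<close> are only meaningful on \<open>Supp \<pi>\<close>. Their values elsewhere are ignored by
  always integrating against \<open>\<pi>\<close> restricted to its support, a set of full measure.
\<close>

definition on_supp :: "(rvec \<times> rvec) measure \<Rightarrow> (rvec \<times> rvec) measure" where
  "on_supp \<pi> = restrict_space \<pi> (Supp \<pi>)"

definition gaussian_mixture_path ::
  "nat \<Rightarrow> (rvec \<times> rvec) measure \<Rightarrow> (real \<Rightarrow> rvec \<times> rvec \<Rightarrow> rvec) \<Rightarrow> (real \<Rightarrow> real) \<Rightarrow> bool" where
  "gaussian_mixture_path d \<pi> m \<sigma> \<longleftrightarrow>
     prob_space \<pi> \<and> sets \<pi> = sets (Rborel d \<Otimes>\<^sub>M Rborel d) \<and>
     (\<forall>t\<in>{0..1}. m t \<in> on_supp \<pi> \<rightarrow>\<^sub>M Rborel d) \<and>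
     (\<forall>t\<in>{0..1}. 0 \<le> \<sigma> t)"

definition time_deriv :: "(real \<Rightarrow> real) \<Rightarrow> real \<Rightarrow> real" where
  "time_deriv f t = vector_derivative f (at t within {0..1})"

definition m_differentiable_at ::
  "nat \<Rightarrow> (rvec \<times> rvec) measure \<Rightarrow> (real \<Rightarrow> rvec \<times> rvec \<Rightarrow> rvec) \<Rightarrow> real \<Rightarrow> bool" where
  "m_differentiable_at d \<pi> m t \<longleftrightarrow>
     (\<forall>z\<in>Supp \<pi>. \<forall>i<d. (\<lambda>s. m s z i) differentiable (at t within {0..1}))"

definition m_deriv :: "(real \<Rightarrow> rvec \<times> rvec \<Rightarrow> rvec) \<Rightarrow> real \<Rightarrow> rvec \<times> rvec \<Rightarrow> rvec" where
  "m_deriv m t z i = time_deriv (\<lambda>s. m s z i) t"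

definition pushforward ::
  "nat \<Rightarrow> (rvec \<times> rvec) measure \<Rightarrow> (real \<Rightarrow> rvec \<times> rvec \<Rightarrow> rvec) \<Rightarrow> real \<Rightarrow> rvec measure" where
  "pushforward d \<pi> m t = distr (on_supp \<pi>) (Rborel d) (m t)"

definition gauss_weight ::
  "nat \<Rightarrow> (real \<Rightarrow> rvec \<times> rvec \<Rightarrow> rvec) \<Rightarrow> (real \<Rightarrow> real) \<Rightarrow> real \<Rightarrow> rvec \<Rightarrow> rvec \<times> rvec \<Rightarrow> real" where
  "gauss_weight d m \<sigma> t x z = exp (- ((edist d x (m t z))\<^sup>2) / (2 * (\<sigma> t)\<^sup>2))"

text \<open>The law of \<open>Z\<close> given \<open>X\<^sub>t = x\<close>, for \<open>\<sigma> t > 0\<close>.\<close>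

definition posterior ::
  "nat \<Rightarrow> (rvec \<times> rvec) measure \<Rightarrow> (real \<Rightarrow> rvec \<times> rvec \<Rightarrow> rvec) \<Rightarrow> (real \<Rightarrow> real) \<Rightarrow>
   real \<Rightarrow> rvec \<Rightarrow> (rvec \<times> rvec) measure" where
  "posterior d \<pi> m \<sigma> t x =
     density (on_supp \<pi>)
       (\<lambda>z. ennreal (gauss_weight d m \<sigma> t x z / (\<integral>w. gauss_weight d m \<sigma> t x w \<partial>on_supp \<pi>)))"

definition velocity ::
  "nat \<Rightarrow> (rvec \<times> rvec) measure \<Rightarrow> (real \<Rightarrow> rvec \<times> rvec \<Rightarrow> rvec) \<Rightarrow> (real \<Rightarrow> real) \<Rightarrow>
   real \<Rightarrow> rvec \<Rightarrow> rvec" where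
  "velocity d \<pi> m \<sigma> t x i =
     (\<integral>z. (time_deriv \<sigma> t / \<sigma> t * (x i - m t z i) + m_deriv m t z i) \<partial>posterior d \<pi> m \<sigma> t x)"

text \<open>
  The bound on the variance of \<open>h\<^sup>T m\<^sub>t'(Z)\<close> includes that the variance exists, since the
  library integral of a non-integrable function is \<open>0\<close>.
\<close>

definition variance_bound ::
  "nat \<Rightarrow> (rvec \<times> rvec) measure \<Rightarrow> (real \<Rightarrow> rvec \<times> rvec \<Rightarrow> rvec) \<Rightarrow> (real \<Rightarrow> real) \<Rightarrow>
   real \<Rightarrow> real \<Rightarrow> bool" where
  "variance_bound d \<pi> m \<sigma> t B \<longleftrightarrow>
     (\<forall>x\<in>Rsp d. \<forall>h\<in>Rsp d. enorm d h = 1 \<longrightarrow>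
        integrable (posterior d \<pi> m \<sigma> t x) (\<lambda>z. (\<Sum>i<d. h i * m_deriv m t z i)\<^sup>2) \<and>
        prob_space.variance (posterior d \<pi> m \<sigma> t x) (\<lambda>z. \<Sum>i<d. h i * m_deriv m t z i) \<le> B)"


section \<open>Regularity in time\<close>

definition abs_continuous_01 :: "(real \<Rightarrow> real) \<Rightarrow> bool" where
  "abs_continuous_01 f \<longleftrightarrow>
     (\<forall>\<epsilon>>0. \<exists>\<delta>>0. \<forall>(n::nat) l r.
        (\<forall>k<n. 0 \<le> l k \<and> l k \<le> r k \<and> r k \<le> 1) \<longrightarrow>
        (\<forall>j<n. \<forall>k<n. j \<noteq> k \<longrightarrow> {l j<..<r j} \<inter> {l k<..<r k} = {}) \<longrightarrow>
        (\<Sum>k<n. r k - l k) < \<delta> \<longrightarrow> (\<Sum>k<n. \<bar>f (r k) - f (l k)\<bar>) < \<epsilon>)"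

definition C1_ae_01 :: "(real \<Rightarrow> real) \<Rightarrow> bool" where
  "C1_ae_01 f \<longleftrightarrow>
     f ` {0..1} \<subseteq> {0..1} \<and> abs_continuous_01 f \<and>
     (\<exists>N. closed N \<and> negligible N \<and>
        (\<forall>t\<in>{0..1} - N. f differentiable (at t within {0..1})) \<and>
        continuous_on ({0..1} - N) (time_deriv f))"

end

theory Submission
  imports Defs
begin

text \<open>
  For a unit vector \<open>h\<close>, differentiating the posterior expectations gives
  \<open>h\<^sup>T \<nabla>v\<^sub>t(x) h = (\<sigma>'/\<sigma>) (1 - Var(h\<^sup>T m\<^sub>t) / \<sigma>\<^sup>2) + Cov(h\<^sup>T m\<^sub>t', h\<^sup>T m\<^sub>t) / \<sigma>\<^sup>2\<close>, with variance and covariance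
  under the posterior law. Everything thus reduces to two-sided bounds, uniform in the dimension,
  on \<open>Var(h\<^sup>T m\<^sub>t)\<close> under a density proportional to \<open>exp (- V + a)\<close>, where \<open>V\<close> is strongly convex
  with constant \<open>l = \<alpha> + 1 / \<sigma>\<^sup>2\<close> and \<open>a\<close> is Hoelder.

  The Prekopa-Leindler inequality, applied to \<open>exp (\<phi> - V)\<close>, \<open>exp (- \<phi> - V)\<close> and \<open>exp (c - V)\<close>, bounds
  \<open>E exp \<phi> \<cdot> E exp (- \<phi>)\<close> under the density proportional to \<open>exp (- V)\<close>. For linear \<open>\<phi>\<close> this yields the
  sharp variance bound \<open>1 / l\<close>; for \<open>\<phi> = \<theta> a\<close> it yields concentration of \<open>a\<close> at scale
  \<open>k = K l\<^sup>-\<^sup>\<beta>\<^sup>/\<^sup>2\<close>. Both together show that tilting by \<open>exp a\<close> changes \<open>l Var\<close> by at most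
  \<open>C k exp (C k\<^sup>2)\<close>. If \<open>V\<close> has Hessian at most \<open>A + 1 / \<sigma>\<^sup>2\<close>, comparing the density with its
  translates gives the matching lower bound \<open>1 / (A + 1 / \<sigma>\<^sup>2)\<close> for the untilted variance.
\<close>

subsection \<open>The Brunn-Minkowski inequality on the line\<close>

text \<open>The terms \<sigma> \<sigma>' \<alpha> and \<sigma> \<sigma>' A carry the constant 1, so
  the main part of the variance must be exact, and the factor
  \<open>(K * \<sigma> t powr \<beta>) ^ \<xi>\<close> with \<xi> = 1 forces the error to vanish
  linearly in \<open>k\<close>. Hence the law without \<open>exp a\<close> gets sharp bounds, and
  the tilt is compared through \<open>exp A - 1\<close>, which is small when \<open>A\<close> is.
  The perturbation \<open>a\<close> may be unbounded, so no argument by bounded density ratios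
  applies; its concentration takes the place of boundedness, and \<open>k\<close> is the oscillation
  of \<open>a\<close> on the length scale \<open>l powr (- 1 / 2)\<close>. The sign of \<sigma>'
  decides which side of the variance matters: for \<sigma>' \<le> 0 an upper bound, supplied by
  \<alpha>; for \<sigma>' \<ge> 0 a lower bound, which strong convexity cannot give, and this is
  where \<open>A\<close> enters. Prekopa-Leindler is used at midpoints only, and its constant does
  not see the dimension. The number \<open>10 ^ 9\<close> comes from rough third-moment
  estimates.\<close>

lemma ennreal_strict_mono_power2:
  fixes a b :: ennreal
  assumes "a < b"
  shows "a\<^sup>2 < b\<^sup>2"
proof (cases "b = \<top>")
  case True
  then show ?thesis
    using assms by (simp add: power2_eq_square ennreal_mult_less_top)
next
  case False
  then obtain x y where "a = ennreal x" "0 \<le> x" "b = ennreal y" "0 \<le> y"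
    using assms by (metis ennreal_cases top.not_eq_extremum less_trans)
  then show ?thesis
    using assms by (simp add: ennreal_power ennreal_less_iff power_strict_mono)
qed

text \<open>Passes from the additive inequality, which holds for functions normalized to supremum 1,
  to the multiplicative one, which survives rescaling and iteration over coordinates.\<close>

lemma ennreal_amgm:
  fixes a b c :: ennreal
  assumes "a + b \<le> 2 * c"
  shows "a * b \<le> c\<^sup>2"
proof (cases "c = \<top>")
  case True
  then show ?thesis by (simp add: power2_eq_square ennreal_mult_top)
next
  case False
  then obtain z where z: "c = ennreal z" "0 \<le> z" by (metis ennreal_cases)
  have fin: "a + b < \<top>"
    using assms z by (metis ennreal_less_top ennreal_mult_less_top order_le_less_trans ennreal_numeral)
  then obtain x y where xy: "a = ennreal x" "0 \<le> x" "b = ennreal y" "0 \<le> y"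
    by (metis ennreal_cases ennreal_add_eq_top less_top)
  have "x + y \<le> 2 * z"
  proof -
    have "ennreal (x + y) \<le> ennreal (2 * z)"
      using assms z xy by (simp add: ennreal_mult)
    then show ?thesis using z by (subst (asm) ennreal_le_iff) auto
  qed
  then have "(x + y)\<^sup>2 \<le> (2 * z)\<^sup>2"
    using xy by (intro power_mono) auto
  moreover have "4 * (x * y) \<le> (x + y)\<^sup>2"
    using zero_le_power2[of "x - y"] by (simp add: power2_eq_square algebra_simps)
  ultimately have "x * y \<le> z\<^sup>2"
    by (simp add: power_mult_distrib)
  then show ?thesis
    using z xy by (simp add: ennreal_mult'[symmetric] ennreal_power)
qed

text \<open>The translates \<open>(A \<inter> {..a}) + b\<close> and \<open>a + (B \<inter> {b..})\<close> of the two sets both lie in \<open>2 C\<close> and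
  meet in at most one point.\<close>

lemma brunn_minkowski_at:
  fixes A B C :: "real set"
  assumes [measurable]: "A \<in> sets borel" "B \<in> sets borel" "C \<in> sets borel"
    and C: "\<And>x y. x \<in> A \<Longrightarrow> y \<in> B \<Longrightarrow> (x + y) / 2 \<in> C"
    and "a \<in> A" "b \<in> B"
  shows "emeasure lborel (A \<inter> {..a}) + emeasure lborel (B \<inter> {b..}) \<le> 2 * emeasure lborel C"
proof -
  \<comment> \<open>Halved translates, written as preimages under affine maps: they are Borel,
    whereas the sum set of two Borel sets need not be.\<close>
  define P where "P = (\<lambda>x. 2 * x - b) -` (A \<inter> {..a})"
  define R where "R = (\<lambda>x. 2 * x - a) -` (B \<inter> {b..})"
  have [measurable]: "P \<in> sets borel" "R \<in> sets borel"
    unfolding P_def R_def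
    using measurable_sets[of "\<lambda>x. 2 * x - b" borel borel "A \<inter> {..a}"]
      measurable_sets[of "\<lambda>x. 2 * x - a" borel borel "B \<inter> {b..}"] by simp_all
  have "emeasure lborel S = 2 * emeasure lborel ((\<lambda>x. 2 * x - t) -` S)"
    if [measurable]: "S \<in> sets borel" for S and t :: real
  proof -
    have [measurable]: "(\<lambda>x. 2 * x - t) -` S \<in> sets borel"
      using measurable_sets[of "\<lambda>x. 2 * x - t" borel borel S] that by simp
    have "emeasure lborel S = 2 * (\<integral>\<^sup>+x. indicator S (- t + 2 * x) \<partial>lborel)"
      using nn_integral_real_affine[of "indicator S" 2 "-t"] by simp
    also have "(\<integral>\<^sup>+x. indicator S (- t + 2 * x) \<partial>lborel) = (\<integral>\<^sup>+x. indicator ((\<lambda>x. 2 * x - t) -` S) x \<partial>lborel)"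
      by (intro nn_integral_cong) (auto simp: indicator_def)
    finally show ?thesis by simp
  qed
  then have e: "emeasure lborel (A \<inter> {..a}) = 2 * emeasure lborel P"
      "emeasure lborel (B \<inter> {b..}) = 2 * emeasure lborel R"
    unfolding P_def R_def by (simp_all del: vimage_Int)
  have sub: "P \<union> R \<subseteq> C"
  proof
    fix x assume "x \<in> P \<union> R"
    then show "x \<in> C"
      using C[of "2 * x - b" b] C[of a "2 * x - a"] assms by (auto simp: P_def R_def)
  qed
  have pr: "P \<inter> R \<subseteq> {(a + b) / 2}"
    by (auto simp: P_def R_def)
  have "emeasure lborel P + emeasure lborel R = emeasure lborel (P \<union> R) + emeasure lborel (P \<inter> R)"
    by (rule emeasure_Un_Int) auto
  also have "emeasure lborel (P \<inter> R) = 0"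
    using emeasure_mono[OF pr, of lborel] by simp
  also have "emeasure lborel (P \<union> R) \<le> emeasure lborel C"
    by (rule emeasure_mono[OF sub]) simp
  finally have "emeasure lborel P + emeasure lborel R \<le> emeasure lborel C"
    by simp
  then show ?thesis
    unfolding e distrib_left[symmetric] by (rule mult_left_mono) simp
qed

text \<open>The cuts must be made at points of \<open>A\<close>, as
  \<open>brunn_minkowski_at\<close> demands. If \<open>A\<close> is bounded and its supremum is not
  attained, a point of \<open>A\<close> within \<open>e\<close> of the supremum loses at most
  measure \<open>e\<close>.\<close>

lemma emeasure_cut_SUP:
  fixes A :: "real set"
  assumes [measurable]: "A \<in> sets borel" and "A \<noteq> {}"
  shows "emeasure lborel A = (SUP a\<in>A. emeasure lborel (A \<inter> {..a}))"
proof (rule antisym)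
  show "emeasure lborel A \<le> (SUP a\<in>A. emeasure lborel (A \<inter> {..a}))" (is "_ \<le> ?R")
  proof -
    have *: "emeasure lborel (A \<inter> {..real n}) \<le> ?R" for n
    proof (cases "\<exists>x\<in>A. real n \<le> x")
      case True
      then obtain x where "x \<in> A" "real n \<le> x" by auto
      then have "emeasure lborel (A \<inter> {..real n}) \<le> emeasure lborel (A \<inter> {..x})"
        by (intro emeasure_mono) auto
      also have "\<dots> \<le> ?R"
        using \<open>x \<in> A\<close> by (rule SUP_upper)
      finally show ?thesis .
    next
      case False
      then have bd: "bdd_above A" by (meson bdd_above.I less_imp_le not_le)
      show ?thesis
      proof (rule ennreal_le_epsilon)
        fix e :: real assume "0 < e"
        define s where "s = Sup A"
        have "s - e < Sup A" using \<open>0 < e\<close> by (simp add: s_def)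
        then obtain x where x: "x \<in> A" "s - e < x"
          using less_cSup_iff[OF assms(2) bd] by auto
        have "A \<subseteq> (A \<inter> {..x}) \<union> {s - e..s}"
          using x cSup_upper[OF _ bd] by (force simp: s_def)
        then have "emeasure lborel (A \<inter> {..real n}) \<le> emeasure lborel ((A \<inter> {..x}) \<union> {s - e..s})"
          by (intro emeasure_mono) auto
        also have "\<dots> \<le> emeasure lborel (A \<inter> {..x}) + emeasure lborel {s - e..s}"
          by (intro emeasure_subadditive) auto
        also have "\<dots> \<le> ?R + ennreal e"
          using \<open>0 < e\<close> x by (intro add_mono SUP_upper) auto
        finally show "emeasure lborel (A \<inter> {..real n}) \<le> ?R + ennreal e" .
      qed
    qed
    have "A = (\<Union>n. A \<inter> {..real n})"
      using real_arch_simple by auto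
    then have "emeasure lborel A = emeasure lborel (\<Union>n. A \<inter> {..real n})" by simp
    also have "\<dots> = (SUP n. emeasure lborel (A \<inter> {..real n}))"
      by (intro SUP_emeasure_incseq[symmetric]) (auto simp: incseq_def)
    also have "\<dots> \<le> ?R" by (rule SUP_least) (rule *)
    finally show ?thesis .
  qed
  show "?R \<le> emeasure lborel A"
    by (intro SUP_least emeasure_mono) auto
qed

lemma emeasure_lborel_uminus:
  fixes A :: "real set"
  assumes [measurable]: "A \<in> sets borel"
  shows "emeasure lborel (uminus -` A) = emeasure lborel A"
proof -
  have "emeasure lborel A = emeasure (distr lborel borel uminus) A"
    by (simp add: lborel_distr_uminus)
  then show ?thesis by (simp add: emeasure_distr)
qed

lemma emeasure_cut_SUP':
  fixes A :: "real set"
  assumes [measurable]: "A \<in> sets borel" and "A \<noteq> {}"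
  shows "emeasure lborel A = (SUP a\<in>A. emeasure lborel (A \<inter> {a..}))"
proof -
  have u: "uminus -` (uminus -` A) = A" by auto
  have "emeasure lborel A = emeasure lborel (uminus -` A)"
    by (simp add: emeasure_lborel_uminus)
  also have "\<dots> = (SUP a\<in>uminus -` A. emeasure lborel (uminus -` A \<inter> {..a}))"
  proof (rule emeasure_cut_SUP)
    show "uminus -` A \<in> sets borel" using measurable_sets[of uminus borel borel A] by simp
    show "uminus -` A \<noteq> {}" using assms(2) by (metis all_not_in_conv minus_minus vimage_eq)
  qed
  also have "\<dots> = (SUP a\<in>uminus -` A. emeasure lborel (A \<inter> {-a..}))"
  proof (rule SUP_cong[OF refl])
    fix a :: real
    have "emeasure lborel (uminus -` A \<inter> {..a}) = emeasure lborel (uminus -` (A \<inter> {-a..}))"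
      by (rule arg_cong[where f="emeasure lborel"]) auto
    then show "emeasure lborel (uminus -` A \<inter> {..a}) = emeasure lborel (A \<inter> {-a..})"
      by (simp add: emeasure_lborel_uminus del: vimage_Int)
  qed
  also have "\<dots> = (SUP a\<in>A. emeasure lborel (A \<inter> {a..}))"
  proof -
    have "uminus -` A = uminus ` A" by force
    then show ?thesis by (simp add: image_comp)
  qed
  finally show ?thesis .
qed

lemma brunn_minkowski_real:
  fixes A B C :: "real set"
  assumes A: "A \<in> sets borel" "A \<noteq> {}" and B: "B \<in> sets borel" "B \<noteq> {}" and "C \<in> sets borel"
    and C: "\<And>x y. x \<in> A \<Longrightarrow> y \<in> B \<Longrightarrow> (x + y) / 2 \<in> C"
  shows "emeasure lborel A + emeasure lborel B \<le> 2 * emeasure lborel C"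
proof -
  have "emeasure lborel A + emeasure lborel B =
      (SUP a\<in>A. SUP b\<in>B. emeasure lborel (A \<inter> {..a}) + emeasure lborel (B \<inter> {b..}))"
    unfolding emeasure_cut_SUP[OF A] emeasure_cut_SUP'[OF B]
    using A(2) B(2) by (subst ennreal_SUP_add_left[symmetric], simp, subst ennreal_SUP_add_right) simp_all
  also have "\<dots> \<le> 2 * emeasure lborel C"
    using assms by (intro SUP_least brunn_minkowski_at) auto
  finally show ?thesis .
qed

subsection \<open>The Prekopa-Leindler inequality\<close>

text \<open>Layer-cake formula by Fubini. Levels are confined to the open unit interval because the
  superlevel sets of a function with supremum 1 are nonempty exactly there, and Brunn-Minkowski
  needs nonempty sets.\<close>

lemma nn_integral_layer:
  fixes f :: "'a \<Rightarrow> ennreal"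
  assumes [measurable]: "f \<in> borel_measurable M" and "sigma_finite_measure M" and "\<And>x. f x \<le> 1"
  shows "(\<integral>\<^sup>+x. f x \<partial>M) = (\<integral>\<^sup>+t. emeasure M {x\<in>space M. ennreal t < f x} * indicator {0<..<1} t \<partial>lborel)"
proof -
  interpret sigma_finite_measure M by fact
  interpret P: pair_sigma_finite M lborel by standard
  have *: "f x = (\<integral>\<^sup>+t. indicator {t. 0 < t \<and> t < 1 \<and> ennreal t < f x} t \<partial>lborel)" for x
  proof -
    obtain r where r: "f x = ennreal r" "0 \<le> r" "r \<le> 1"
      using assms(3)[of x] by (cases "f x") (auto simp: top_unique)
    have "{t. 0 < t \<and> t < 1 \<and> ennreal t < f x} = {0<..<r}"
      using r by (auto simp: ennreal_less_iff)
    then show ?thesis using r by simp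
  qed
  have "(\<integral>\<^sup>+x. f x \<partial>M) = (\<integral>\<^sup>+x. (\<integral>\<^sup>+t. indicator {t. 0 < t \<and> t < 1 \<and> ennreal t < f x} t \<partial>lborel) \<partial>M)"
    by (intro nn_integral_cong *)
  also have "\<dots> = (\<integral>\<^sup>+x. (\<integral>\<^sup>+t. indicator {p. 0 < snd p \<and> snd p < 1 \<and> ennreal (snd p) < f (fst p)} (x, t) \<partial>lborel) \<partial>M)"
    by (intro nn_integral_cong) (auto simp: indicator_def)
  also have "\<dots> = (\<integral>\<^sup>+t. (\<integral>\<^sup>+x. indicator {p\<in>space (M \<Otimes>\<^sub>M lborel). 0 < snd p \<and> snd p < 1 \<and> ennreal (snd p) < f (fst p)} (x, t) \<partial>M) \<partial>lborel)"
    by (subst P.Fubini'[symmetric]) (auto simp: indicator_def space_pair_measure intro!: nn_integral_cong)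
  also have "\<dots> = (\<integral>\<^sup>+t. emeasure M {x\<in>space M. ennreal t < f x} * indicator {0<..<1} t \<partial>lborel)"
  proof (intro nn_integral_cong)
    fix t :: real
    have "(\<integral>\<^sup>+x. indicator {p\<in>space (M \<Otimes>\<^sub>M lborel). 0 < snd p \<and> snd p < 1 \<and> ennreal (snd p) < f (fst p)} (x, t) \<partial>M)
      = (\<integral>\<^sup>+x. indicator {x\<in>space M. ennreal t < f x} x * indicator {0<..<1} t \<partial>M)"
      by (intro nn_integral_cong) (auto simp: indicator_def space_pair_measure)
    then show "(\<integral>\<^sup>+x. indicator {p\<in>space (M \<Otimes>\<^sub>M lborel). 0 < snd p \<and> snd p < 1 \<and> ennreal (snd p) < f (fst p)} (x, t) \<partial>M)
      = emeasure M {x\<in>space M. ennreal t < f x} * indicator {0<..<1} t"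
      by (simp add: nn_integral_multc)
  qed
  finally show ?thesis .
qed

text \<open>The midpoint of a point of \<open>{t < f}\<close> and a point of \<open>{t < g}\<close>
  lies in \<open>{t < h}\<close>, so Brunn-Minkowski applies at every level \<open>t < 1\<close>;
  integrating over the levels gives the claim. The truncation \<open>k\<close> of \<open>h\<close>
  at 1 makes the layer formula available for the right-hand side too.\<close>

lemma prekopa_leindler_real_normalized:
  fixes f g h :: "real \<Rightarrow> ennreal"
  assumes [measurable]: "f \<in> borel_measurable borel" "g \<in> borel_measurable borel" "h \<in> borel_measurable borel"
    and f: "\<And>x. f x \<le> 1" "\<And>t. t < 1 \<Longrightarrow> \<exists>x. t < f x"
    and g: "\<And>x. g x \<le> 1" "\<And>t. t < 1 \<Longrightarrow> \<exists>x. t < g x"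
    and h: "\<And>x y. min (f x) (g y) \<le> h ((x + y) / 2)"
  shows "(\<integral>\<^sup>+x. f x \<partial>lborel) + (\<integral>\<^sup>+x. g x \<partial>lborel) \<le> 2 * (\<integral>\<^sup>+x. h x \<partial>lborel)"
proof -
  define k where "k x = min 1 (h x)" for x
  have [measurable]: "k \<in> borel_measurable borel" unfolding k_def by measurable
  have "(\<integral>\<^sup>+x. f x \<partial>lborel) + (\<integral>\<^sup>+x. g x \<partial>lborel) =
     (\<integral>\<^sup>+t. (emeasure lborel {x. ennreal t < f x} + emeasure lborel {x. ennreal t < g x}) * indicator {0<..<1} t \<partial>lborel)"
    using nn_integral_layer[of f lborel] nn_integral_layer[of g lborel] f g
    by (simp add: sigma_finite_lborel nn_integral_add[symmetric] distrib_right)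
  also have "\<dots> \<le> (\<integral>\<^sup>+t. 2 * (emeasure lborel {x. ennreal t < k x} * indicator {0<..<1} t) \<partial>lborel)"
  proof (intro nn_integral_mono)
    fix t :: real
    show "(emeasure lborel {x. ennreal t < f x} + emeasure lborel {x. ennreal t < g x}) * indicator {0<..<1} t
        \<le> 2 * (emeasure lborel {x. ennreal t < k x} * indicator {0<..<1} t)"
    proof (cases "t \<in> {0<..<1}")
      case True
      then have t: "ennreal t < 1" by (simp add: ennreal_less_one_iff)
      have "emeasure lborel {x. ennreal t < f x} + emeasure lborel {x. ennreal t < g x} \<le> 2 * emeasure lborel {x. ennreal t < k x}"
      proof (rule brunn_minkowski_real)
        fix x y assume "x \<in> {x. ennreal t < f x}" "y \<in> {x. ennreal t < g x}"
        then have "ennreal t < min (f x) (g y)" by simp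
          also note h[of x y]
          finally show "(x + y) / 2 \<in> {x. ennreal t < k x}"
            using t by (simp add: k_def)
      qed (use f(2)[OF t] g(2)[OF t] in auto)
      then show ?thesis using True by simp
    qed simp
  qed
  also have "\<dots> = 2 * (\<integral>\<^sup>+x. k x \<partial>lborel)"
    using nn_integral_layer[of k lborel] by (simp add: nn_integral_cmult k_def sigma_finite_lborel)
  also have "\<dots> \<le> 2 * (\<integral>\<^sup>+x. h x \<partial>lborel)"
    by (intro mult_left_mono nn_integral_mono) (auto simp: k_def)
  finally show ?thesis .
qed

text \<open>Dividing \<open>f\<close> and \<open>g\<close> by their suprema \<open>p\<close>,
  \<open>q\<close> and \<open>h\<close> by \<open>sqrt (p * q)\<close> preserves the hypothesis, and
  \<open>(min F G)^2 \<le> F * G\<close> turns it into the one of the normalized case. Boundedness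
  is what makes \<open>p\<close> and \<open>q\<close> finite.\<close>

lemma prekopa_leindler_real_bounded:
  fixes f g h :: "real \<Rightarrow> ennreal"
  assumes [measurable]: "f \<in> borel_measurable borel" "g \<in> borel_measurable borel" "h \<in> borel_measurable borel"
    and bd: "\<And>x. f x \<le> ennreal c" "\<And>x. g x \<le> ennreal c"
    and h: "\<And>x y. f x * g y \<le> (h ((x + y) / 2))\<^sup>2"
  shows "(\<integral>\<^sup>+x. f x \<partial>lborel) * (\<integral>\<^sup>+x. g x \<partial>lborel) \<le> (\<integral>\<^sup>+x. h x \<partial>lborel)\<^sup>2"
proof (cases "(\<forall>x. f x = 0) \<or> (\<forall>x. g x = 0)")
  case True
  then show ?thesis by auto
next
  case False
  define a where "a = (SUP x. f x)"
  define b where "b = (SUP x. g x)"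
  have "a \<le> ennreal c" "b \<le> ennreal c"
    unfolding a_def b_def by (auto intro: SUP_least bd)
  moreover have "a \<noteq> 0" "b \<noteq> 0"
    using False unfolding a_def b_def by (auto simp: SUP_eq_iff)
  ultimately obtain p q where p: "a = ennreal p" "0 < p" and q: "b = ennreal q" "0 < q"
    by (metis ennreal_cases ennreal_0 ennreal_neq_top neq_top_trans less_eq_real_def)
  define s where "s = sqrt (p * q)"
  have s: "0 < s" "s\<^sup>2 = p * q" using p q by (auto simp: s_def)
  have cancel: "y = ennreal r * (y * ennreal (1 / r))" if "0 < r" for y r
  proof -
    have "ennreal r * (y * ennreal (1 / r)) = y * (ennreal r * ennreal (1 / r))"
      by (simp only: mult_ac)
    also have "ennreal r * ennreal (1 / r) = 1"
      using that by (simp add: ennreal_mult'[symmetric] del: ennreal_1)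
    finally show ?thesis by simp
  qed
  define F where "F x = f x * ennreal (1 / p)" for x
  define G where "G x = g x * ennreal (1 / q)" for x
  define H where "H x = h x * ennreal (1 / s)" for x
  have fF: "f x = ennreal p * F x" for x
    unfolding F_def by (rule cancel) (rule p(2))
  have gG: "g x = ennreal q * G x" for x
    unfolding G_def by (rule cancel) (rule q(2))
  have hH: "h x = ennreal s * H x" for x
    unfolding H_def by (rule cancel) (rule s(1))
  have sup: "\<exists>x. t < f' x * ennreal (1 / r)" "f' x * ennreal (1 / r) \<le> 1"
    if "(SUP x. f' x) = ennreal r" "0 < r" "t < 1" for t x r and f' :: "real \<Rightarrow> ennreal"
  proof -
    have "t < (SUP x. f' x) * ennreal (1 / r)"
      using that by (simp add: ennreal_mult[symmetric])
    then show "\<exists>x. t < f' x * ennreal (1 / r)"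
      by (simp only: SUP_mult_right_ennreal less_SUP_iff) auto
    have "f' x * ennreal (1 / r) \<le> (SUP x. f' x) * ennreal (1 / r)"
      by (intro mult_right_mono SUP_upper) auto
    then show "f' x * ennreal (1 / r) \<le> 1"
      using that by (simp add: ennreal_mult[symmetric])
  qed
  have "(\<integral>\<^sup>+x. F x \<partial>lborel) + (\<integral>\<^sup>+x. G x \<partial>lborel) \<le> 2 * (\<integral>\<^sup>+x. H x \<partial>lborel)"
  proof (rule prekopa_leindler_real_normalized)
    fix x y
    have "F x * G y = (f x * g y) * (ennreal (1 / p) * ennreal (1 / q))"
      by (simp add: F_def G_def mult_ac)
    also have "\<dots> \<le> (h ((x + y) / 2))\<^sup>2 * (ennreal (1 / p) * ennreal (1 / q))"
      by (intro mult_right_mono h) auto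
    also have "ennreal (1 / p) * ennreal (1 / q) = (ennreal (1 / s))\<^sup>2"
      using p q s by (simp add: ennreal_mult[symmetric] ennreal_power power_divide)
    finally have *: "F x * G y \<le> (H ((x + y) / 2))\<^sup>2"
      by (simp add: H_def power_mult_distrib)
    have "(min (F x) (G y))\<^sup>2 \<le> F x * G y"
      unfolding power2_eq_square by (intro mult_mono) auto
    also note *
    finally show "min (F x) (G y) \<le> H ((x + y) / 2)"
      using ennreal_strict_mono_power2[of "H ((x + y) / 2)" "min (F x) (G y)"] by (meson not_le)
  next
    show "F x \<le> 1" "G x \<le> 1" for x
      using sup(2)[of f p 0 x] sup(2)[of g q 0 x] p q by (auto simp: F_def G_def a_def b_def)
    show "t < 1 \<Longrightarrow> \<exists>x. t < F x" "t < 1 \<Longrightarrow> \<exists>x. t < G x" for t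
      using sup(1)[of f p t] sup(1)[of g q t] p q by (auto simp: F_def G_def a_def b_def)
  qed (auto simp: F_def G_def H_def)
  then have "(\<integral>\<^sup>+x. F x \<partial>lborel) * (\<integral>\<^sup>+x. G x \<partial>lborel) \<le> (\<integral>\<^sup>+x. H x \<partial>lborel)\<^sup>2"
    by (rule ennreal_amgm)
  then have "(ennreal p * ennreal q) * ((\<integral>\<^sup>+x. F x \<partial>lborel) * (\<integral>\<^sup>+x. G x \<partial>lborel))
      \<le> (ennreal s)\<^sup>2 * (\<integral>\<^sup>+x. H x \<partial>lborel)\<^sup>2"
    using p q s by (simp add: ennreal_mult[symmetric] ennreal_power mult_left_mono)
  moreover have [measurable]: "F \<in> borel_measurable borel" "G \<in> borel_measurable borel" "H \<in> borel_measurable borel"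
    unfolding F_def G_def H_def by measurable
  ultimately show ?thesis
    unfolding fF gG hH by (simp add: nn_integral_cmult power_mult_distrib mult_ac)
qed

lemma nn_integral_truncate_SUP:
  fixes f :: "'a \<Rightarrow> ennreal"
  assumes [measurable]: "f \<in> borel_measurable M"
  shows "(\<integral>\<^sup>+x. f x \<partial>M) = (SUP n. \<integral>\<^sup>+x. min (f x) (of_nat n) \<partial>M)"
proof -
  have "(\<integral>\<^sup>+x. f x \<partial>M) = (\<integral>\<^sup>+x. (SUP n. min (f x) (of_nat n)) \<partial>M)"
  proof (intro nn_integral_cong)
    fix x
    show "f x = (SUP n. min (f x) (of_nat n))"
      using inf_SUP[of "f x" "of_nat :: nat \<Rightarrow> ennreal" UNIV]
      by (simp add: ennreal_SUP_of_nat_eq_top inf_min)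
  qed
  also have "\<dots> = (SUP n. \<integral>\<^sup>+x. min (f x) (of_nat n) \<partial>M)"
    by (intro nn_integral_monotone_convergence_SUP)
      (auto simp: incseq_def le_fun_def min.coboundedI2 intro!: min.mono)
  finally show ?thesis .
qed

text \<open>Truncating \<open>f\<close> and \<open>g\<close> only weakens the left side of the
  pointwise hypothesis, so the bounded case applies to all truncations and monotone convergence
  finishes.\<close>

lemma prekopa_leindler_real:
  fixes f g h :: "real \<Rightarrow> ennreal"
  assumes [measurable]: "f \<in> borel_measurable borel" "g \<in> borel_measurable borel" "h \<in> borel_measurable borel"
    and h: "\<And>x y. f x * g y \<le> (h ((x + y) / 2))\<^sup>2"
  shows "(\<integral>\<^sup>+x. f x \<partial>lborel) * (\<integral>\<^sup>+x. g x \<partial>lborel) \<le> (\<integral>\<^sup>+x. h x \<partial>lborel)\<^sup>2"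
proof -
  have "(\<integral>\<^sup>+x. f x \<partial>lborel) * (\<integral>\<^sup>+x. g x \<partial>lborel) =
    (SUP m. SUP n. (\<integral>\<^sup>+x. min (f x) (of_nat m) \<partial>lborel) * (\<integral>\<^sup>+x. min (g x) (of_nat n) \<partial>lborel))"
  proof -
    have e: "(\<integral>\<^sup>+x. f x \<partial>lborel) = (SUP n. \<integral>\<^sup>+x. min (f x) (of_nat n) \<partial>lborel)"
        "(\<integral>\<^sup>+x. g x \<partial>lborel) = (SUP n. \<integral>\<^sup>+x. min (g x) (of_nat n) \<partial>lborel)"
      by (rule nn_integral_truncate_SUP; simp)+
    show ?thesis
      unfolding e(1) SUP_mult_right_ennreal unfolding e(2) SUP_mult_left_ennreal ..
  qed
  also have "\<dots> \<le> (\<integral>\<^sup>+x. h x \<partial>lborel)\<^sup>2"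
  proof (intro SUP_least)
    fix m n :: nat
    show "(\<integral>\<^sup>+x. min (f x) (of_nat m) \<partial>lborel) * (\<integral>\<^sup>+x. min (g x) (of_nat n) \<partial>lborel)
        \<le> (\<integral>\<^sup>+x. h x \<partial>lborel)\<^sup>2"
    proof (rule prekopa_leindler_real_bounded)
      show "min (f x) (of_nat m) \<le> ennreal (real (max m n))" for x
        by (rule min.coboundedI2) (simp add: ennreal_of_nat_eq_real_of_nat ennreal_leI)
      show "min (g x) (of_nat n) \<le> ennreal (real (max m n))" for x
        by (rule min.coboundedI2) (simp add: ennreal_of_nat_eq_real_of_nat ennreal_leI)
      show "min (f x) (of_nat m) * min (g y) (of_nat n) \<le> (h ((x + y) / 2))\<^sup>2" for x y
        by (rule order.trans[OF mult_mono h]) auto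
    qed measurable
  qed
  finally show ?thesis .
qed

section \<open>Integration over finite products, one coordinate at a time\<close>

lemma measurable_nn_integral_update:
  fixes f :: "('i \<Rightarrow> real) \<Rightarrow> ennreal"
  assumes "finite I" and [measurable]: "f \<in> borel_measurable (Pi\<^sub>M (insert k I) (\<lambda>_. lborel))"
  shows "(\<lambda>y. \<integral>\<^sup>+x. f (x(k := y)) \<partial>Pi\<^sub>M I (\<lambda>_. lborel)) \<in> borel_measurable borel"
proof -
  interpret product_sigma_finite "\<lambda>_::'i. lborel :: real measure"
    by standard
  interpret finite_product_sigma_finite "\<lambda>_::'i. lborel :: real measure" I
    by standard fact
  have "(\<lambda>(y, x). f (x(k := y))) \<in> borel_measurable (lborel \<Otimes>\<^sub>M Pi\<^sub>M I (\<lambda>_. lborel))"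
    by measurable
  then have "(\<lambda>y. \<integral>\<^sup>+x. f (x(k := y)) \<partial>Pi\<^sub>M I (\<lambda>_. lborel)) \<in> borel_measurable lborel"
    by (rule borel_measurable_nn_integral)
  then show ?thesis by simp
qed

text \<open>For fixed values \<open>s\<close> and \<open>t\<close> of the new coordinate, the
  induction hypothesis on the slices is precisely the pointwise hypothesis of the one-dimensional
  inequality for the partial integrals. Points are extensional, so the midpoint has to be restricted
  to \<open>I\<close>.\<close>

lemma prekopa_leindler_PiM:
  fixes f g h :: "('i \<Rightarrow> real) \<Rightarrow> ennreal"
  assumes "finite I"
    and "f \<in> borel_measurable (Pi\<^sub>M I (\<lambda>_. lborel))" "g \<in> borel_measurable (Pi\<^sub>M I (\<lambda>_. lborel))"
      "h \<in> borel_measurable (Pi\<^sub>M I (\<lambda>_. lborel))"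
    and "\<And>x y. x \<in> extensional I \<Longrightarrow> y \<in> extensional I \<Longrightarrow> f x * g y \<le> (h (\<lambda>i\<in>I. (x i + y i) / 2))\<^sup>2"
  shows "(\<integral>\<^sup>+x. f x \<partial>Pi\<^sub>M I (\<lambda>_. lborel)) * (\<integral>\<^sup>+x. g x \<partial>Pi\<^sub>M I (\<lambda>_. lborel))
    \<le> (\<integral>\<^sup>+x. h x \<partial>Pi\<^sub>M I (\<lambda>_. lborel))\<^sup>2"
  using assms
proof (induction I arbitrary: f g h rule: finite_induct)
  case empty
  then show ?case
    by (simp add: nn_integral_count_space_finite PiM_empty restrict_def power2_eq_square)
next
  case (insert k I)
  interpret product_sigma_finite "\<lambda>_::'i. lborel :: real measure"
    by standard
  note [measurable] = insert.prems(1-3)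
  note ins = product_nn_integral_insert_rev[OF insert.hyps(1,2)]
  show ?case
    unfolding ins[OF insert.prems(1)] ins[OF insert.prems(2)] ins[OF insert.prems(3)]
  proof (rule prekopa_leindler_real)
    fix s t :: real
    show "(\<integral>\<^sup>+x. f (x(k := s)) \<partial>Pi\<^sub>M I (\<lambda>_. lborel)) * (\<integral>\<^sup>+x. g (x(k := t)) \<partial>Pi\<^sub>M I (\<lambda>_. lborel))
      \<le> (\<integral>\<^sup>+x. h (x(k := (s + t) / 2)) \<partial>Pi\<^sub>M I (\<lambda>_. lborel))\<^sup>2"
    proof (rule insert.IH)
      fix x y :: "'i \<Rightarrow> real" assume xy: "x \<in> extensional I" "y \<in> extensional I"
      have "(\<lambda>i\<in>insert k I. ((x(k := s)) i + (y(k := t)) i) / 2) = (\<lambda>i\<in>I. (x i + y i) / 2)(k := (s + t) / 2)"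
        using insert.hyps by (auto simp: fun_eq_iff)
      then show "f (x(k := s)) * g (y(k := t)) \<le> (h ((\<lambda>i\<in>I. (x i + y i) / 2)(k := (s + t) / 2)))\<^sup>2"
        using insert.prems(4)[of "x(k := s)" "y(k := t)"] xy
        by (simp only:) (simp add: extensional_def del: fun_upd_apply, simp add: fun_upd_def)
    qed measurable
  qed (auto intro!: measurable_nn_integral_update insert.hyps insert.prems)
qed

text \<open>Used with \<open>c < 1\<close> to contract a convex set towards an interior point, and
  with \<open>c = 1\<close> for translation invariance.\<close>

lemma nn_integral_PiM_affine:
  fixes f :: "('i \<Rightarrow> real) \<Rightarrow> ennreal"
  assumes "finite I" "f \<in> borel_measurable (Pi\<^sub>M I (\<lambda>_. lborel))" "0 < c"
  shows "(\<integral>\<^sup>+x. f x \<partial>Pi\<^sub>M I (\<lambda>_. lborel)) =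
     ennreal (c ^ card I) * (\<integral>\<^sup>+x. f (\<lambda>i\<in>I. t i + c * x i) \<partial>Pi\<^sub>M I (\<lambda>_. lborel))"
  using assms(1,2)
proof (induction I arbitrary: f rule: finite_induct)
  case empty
  then show ?case
    by (simp add: nn_integral_count_space_finite PiM_empty restrict_def)
next
  case (insert k I)
  interpret product_sigma_finite "\<lambda>_::'i. lborel :: real measure"
    by standard
  note [measurable] = insert.prems
  note ins = product_nn_integral_insert_rev[OF insert.hyps(1,2)]
  have [measurable]: "(\<lambda>x. \<lambda>i\<in>insert k I. t i + c * x i) \<in> Pi\<^sub>M (insert k I) (\<lambda>_. lborel) \<rightarrow>\<^sub>M Pi\<^sub>M (insert k I) (\<lambda>_. lborel :: real measure)"
    by measurable
  have "(\<integral>\<^sup>+x. f x \<partial>Pi\<^sub>M (insert k I) (\<lambda>_. lborel)) = (\<integral>\<^sup>+ y. (\<integral>\<^sup>+ x. f (x(k := y)) \<partial>Pi\<^sub>M I (\<lambda>_. lborel)) \<partial>lborel)"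
    by (rule ins) measurable
  also have "\<dots> = c * (\<integral>\<^sup>+ y. (\<integral>\<^sup>+ x. f (x(k := t k + c * y)) \<partial>Pi\<^sub>M I (\<lambda>_. lborel)) \<partial>lborel)"
    using \<open>0 < c\<close> insert.hyps insert.prems
    by (subst nn_integral_real_affine[where t="t k" and c=c]) (auto intro!: measurable_nn_integral_update)
  also have "\<dots> = c * (\<integral>\<^sup>+ y. ennreal (c ^ card I) * (\<integral>\<^sup>+ x. f ((\<lambda>i\<in>I. t i + c * x i)(k := t k + c * y)) \<partial>Pi\<^sub>M I (\<lambda>_. lborel)) \<partial>lborel)"
    by (subst insert.IH) auto
  also have "\<dots> = c * (ennreal (c ^ card I) * (\<integral>\<^sup>+ y. (\<integral>\<^sup>+ x. f (\<lambda>i\<in>insert k I. t i + c * (x(k := y)) i) \<partial>Pi\<^sub>M I (\<lambda>_. lborel)) \<partial>lborel))"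
  proof -
    have e: "(\<lambda>i\<in>I. t i + c * x i)(k := t k + c * y) = (\<lambda>i\<in>insert k I. t i + c * (x(k := y)) i)" for x y
      using insert.hyps by (auto simp: fun_eq_iff)
    have "(\<lambda>y. \<integral>\<^sup>+x. f (\<lambda>i\<in>insert k I. t i + c * (x(k := y)) i) \<partial>Pi\<^sub>M I (\<lambda>_. lborel)) \<in> borel_measurable borel"
      by (rule measurable_nn_integral_update[OF insert.hyps(1), where f="\<lambda>x. f (\<lambda>i\<in>insert k I. t i + c * x i)"]) measurable
    then show ?thesis unfolding e by (subst nn_integral_cmult) auto
  qed
  also have "\<dots> = ennreal (c ^ card (insert k I)) * (\<integral>\<^sup>+x. f (\<lambda>i\<in>insert k I. t i + c * x i) \<partial>Pi\<^sub>M (insert k I) (\<lambda>_. lborel))"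
  proof -
    have "(\<lambda>x. f (\<lambda>i\<in>insert k I. t i + c * x i)) \<in> borel_measurable (Pi\<^sub>M (insert k I) (\<lambda>_. lborel))"
      by measurable
    from ins[OF this] show ?thesis
      using insert.hyps \<open>0 < c\<close> by (simp only:) (simp add: ennreal_mult mult.assoc)
  qed
  finally show ?case .
qed


subsection \<open>Lebesgue measure and neighbourhoods in the coordinate space\<close>

lemma in_Rsp: "x \<in> Rsp d \<longleftrightarrow> (\<forall>i\<ge>d. x i = 0)"
  by (simp add: topspace_Euclidean_space)

lemma Rsp_eqI: "x \<in> Rsp d \<Longrightarrow> y \<in> Rsp d \<Longrightarrow> (\<And>i. i < d \<Longrightarrow> x i = y i) \<Longrightarrow> x = y"
  by (auto simp: in_Rsp fun_eq_iff) (metis not_le)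

lemma space_Rborel [simp]: "space (Rborel d) = Rsp d"
  by (simp add: Rborel_def space_restrict_space)

lemma sets_RborelI: "A \<in> sets borel \<Longrightarrow> A \<inter> Rsp d \<in> sets (Rborel d)"
  by (auto simp: Rborel_def sets_restrict_space)

lemma openin_Rsp: "openin (Euclidean_space d) U \<longleftrightarrow> (\<exists>V. open V \<and> U = V \<inter> Rsp d)"
  by (simp add: Euclidean_space_def openin_subtopology euclidean_product_topology)

lemma openin_Rborel: "openin (Euclidean_space d) U \<Longrightarrow> U \<in> sets (Rborel d)"
  unfolding openin_Rsp by (auto intro: sets_RborelI borel_open)

lemma continuous_on_coord: "continuous_on A (\<lambda>x::nat \<Rightarrow> real. x i)"
  by (rule continuous_on_subset[OF continuous_on_product_coordinates]) simp

lemma measurable_coord_borel [measurable]: "(\<lambda>x::nat \<Rightarrow> real. x i) \<in> borel_measurable borel"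
  by (intro borel_measurable_continuous_onI continuous_on_coord)

lemma measurable_coord [measurable]: "(\<lambda>x. x i) \<in> borel_measurable (Rborel d)"
  unfolding Rborel_def by (rule measurable_restrict_space1) simp

text \<open>The Borel sets of \<open>nat \<Rightarrow> real\<close> are the product sigma-algebra,
  so measurability is checked per coordinate, and coordinates from \<open>d\<close> on
  vanish.\<close>

lemma measurable_to_Rborel:
  assumes "\<And>i. i < d \<Longrightarrow> (\<lambda>x. f x i) \<in> borel_measurable M" "\<And>x. x \<in> space M \<Longrightarrow> f x \<in> Rsp d"
  shows "f \<in> M \<rightarrow>\<^sub>M Rborel d"
  unfolding Rborel_def
proof (rule measurable_restrict_space2)
  show "f \<in> space M \<rightarrow> Rsp d" using assms by auto
  have "(\<lambda>x. f x i) \<in> borel_measurable M" for i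
  proof (cases "i < d")
    case False
    then show ?thesis
      using assms(2) by (subst measurable_cong[of _ _ "\<lambda>_. 0"]) (auto simp: in_Rsp)
  qed (rule assms)
  then have "f \<in> M \<rightarrow>\<^sub>M Pi\<^sub>M UNIV (\<lambda>_. borel)"
    by (intro measurable_PiM_single') auto
  then show "f \<in> borel_measurable M"
    by (simp cong: measurable_cong_sets add: sets_PiM_equal_borel)
qed

text \<open>Bridges two encodings of a vector: points of the product space are
  \<open>undefined\<close> outside the index set, points of \<open>Rsp d\<close> are 0
  there.\<close>

definition zext :: "nat \<Rightarrow> rvec \<Rightarrow> rvec" where
  "zext d x = (\<lambda>i. if i < d then x i else 0)"

lemma zext_Rsp: "zext d x \<in> Rsp d"
  by (simp add: zext_def in_Rsp)

lemma measurable_zext [measurable]: "zext d \<in> Pi\<^sub>M {..<d} (\<lambda>_. lborel) \<rightarrow>\<^sub>M Rborel d"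
proof (rule measurable_to_Rborel)
  fix i assume "i < d"
  then have "(\<lambda>x. x i) \<in> borel_measurable (Pi\<^sub>M {..<d} (\<lambda>_. lborel :: real measure))"
    by (intro measurable_component_singleton[THEN measurable_compose, where g="\<lambda>x. x"]) auto
  then show "(\<lambda>x. zext d x i) \<in> borel_measurable (Pi\<^sub>M {..<d} (\<lambda>_. lborel))"
    using \<open>i < d\<close> by (simp add: zext_def)
qed (rule zext_Rsp)

lemma Rlebesgue_eq: "Rlebesgue d = distr (Pi\<^sub>M {..<d} (\<lambda>_. lborel)) (Rborel d) (zext d)"
  by (simp add: Rlebesgue_def zext_def[abs_def])

lemma sets_Rlebesgue [simp, measurable_cong]: "sets (Rlebesgue d) = sets (Rborel d)"
  by (simp add: Rlebesgue_eq)

lemma space_Rlebesgue [simp]: "space (Rlebesgue d) = Rsp d"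
  by (simp add: Rlebesgue_eq)

lemma nn_integral_Rlebesgue:
  assumes "f \<in> borel_measurable (Rborel d)"
  shows "(\<integral>\<^sup>+x. f x \<partial>Rlebesgue d) = (\<integral>\<^sup>+x. f (zext d x) \<partial>Pi\<^sub>M {..<d} (\<lambda>_. lborel))"
  unfolding Rlebesgue_eq by (rule nn_integral_distr) (use assms in auto)

lemma prekopa_leindler:
  assumes [measurable]: "f \<in> borel_measurable (Rborel d)" "g \<in> borel_measurable (Rborel d)"
      "h \<in> borel_measurable (Rborel d)"
    and h: "\<And>x y. x \<in> Rsp d \<Longrightarrow> y \<in> Rsp d \<Longrightarrow> f x * g y \<le> (h (\<lambda>i. (x i + y i) / 2))\<^sup>2"
  shows "(\<integral>\<^sup>+x. f x \<partial>Rlebesgue d) * (\<integral>\<^sup>+x. g x \<partial>Rlebesgue d) \<le> (\<integral>\<^sup>+x. h x \<partial>Rlebesgue d)\<^sup>2"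
proof -
  have "f (zext d x) * g (zext d y) \<le> (h (zext d (\<lambda>i\<in>{..<d}. (x i + y i) / 2)))\<^sup>2" for x y
  proof -
    have "zext d (\<lambda>i\<in>{..<d}. (x i + y i) / 2) = (\<lambda>i. (zext d x i + zext d y i) / 2)"
      by (auto simp: zext_def)
    then show ?thesis using h[OF zext_Rsp zext_Rsp, of x y] by simp
  qed
  then show ?thesis
    by (simp only: nn_integral_Rlebesgue assms) (intro prekopa_leindler_PiM; measurable)
qed

lemma nn_integral_Rlebesgue_affine:
  assumes [measurable]: "f \<in> borel_measurable (Rborel d)" and "t \<in> Rsp d" "0 < c"
  shows "(\<integral>\<^sup>+x. f x \<partial>Rlebesgue d) = ennreal (c ^ d) * (\<integral>\<^sup>+x. f (\<lambda>i. t i + c * x i) \<partial>Rlebesgue d)"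
proof -
  have "(\<lambda>x i. t i + c * x i) \<in> Rborel d \<rightarrow>\<^sub>M Rborel d"
    using assms(2) by (intro measurable_to_Rborel) (auto simp: in_Rsp)
  then have m: "(\<lambda>x. f (\<lambda>i. t i + c * x i)) \<in> borel_measurable (Rborel d)"
    by (rule measurable_compose) fact
  have e: "(\<lambda>i. t i + c * zext d x i) = zext d (\<lambda>i\<in>{..<d}. t i + c * x i)" for x
    using assms(2) by (auto simp: zext_def in_Rsp)
  show ?thesis
    unfolding nn_integral_Rlebesgue[OF assms(1)] nn_integral_Rlebesgue[OF m] e
    using nn_integral_PiM_affine[of "{..<d}" "\<lambda>x. f (zext d x)" c t] assms by simp
qed

section \<open>Boxes as a basis of neighbourhoods\<close>

text \<open>The open ball of the maximum norm. It is preferred to Euclidean balls because it is a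
  product of intervals, which suits both induction on the dimension and the product measure.\<close>

definition rbox :: "nat \<Rightarrow> rvec \<Rightarrow> real \<Rightarrow> rvec set" where
  "rbox d x r = {y \<in> Rsp d. \<forall>i<d. \<bar>y i - x i\<bar> < r}"

lemma openin_rbox: "openin (Euclidean_space d) (rbox d x r)"
proof -
  have "rbox d x r = (\<Inter>i\<in>{..<d}. (\<lambda>y. y i) -` {x i - r<..<x i + r}) \<inter> Rsp d"
    by (auto simp: rbox_def abs_less_iff)
  moreover have "open (\<Inter>i\<in>{..<d}. (\<lambda>y::nat\<Rightarrow>real. y i) -` {x i - r<..<x i + r})"
    by (intro open_INT ballI open_vimage) (auto intro: continuous_on_coord)
  ultimately show ?thesis unfolding openin_Rsp by blast
qed

lemma openin_contains_rbox:
  assumes "openin (Euclidean_space d) U" "x \<in> U"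
  obtains r where "0 < r" "rbox d x r \<subseteq> U"
proof -
  obtain V where V: "open V" "U = V \<inter> Rsp d" using assms openin_Rsp by auto
  then have "openin (product_topology (\<lambda>_::nat. euclidean :: real topology) UNIV) V" "x \<in> V"
    using assms by (simp_all add: euclidean_product_topology)
  then obtain X where X: "x \<in> Pi\<^sub>E UNIV X" "\<And>i. openin euclidean (X i)" "finite {i. X i \<noteq> topspace (euclidean :: real topology)}"
      "Pi\<^sub>E UNIV X \<subseteq> V"
    by (auto simp: openin_product_topology_alt)
  have "\<exists>e>0. \<forall>y. \<bar>y - x i\<bar> < e \<longrightarrow> y \<in> X i" for i
  proof -
    have "open (X i)" "x i \<in> X i" using X(1) X(2)[of i] by (auto simp: PiE_def Pi_def)
    then show ?thesis unfolding open_dist dist_real_def by blast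
  qed
  then obtain e where e: "\<And>i. 0 < e i" "\<And>i y. \<bar>y - x i\<bar> < e i \<Longrightarrow> y \<in> X i" by metis
  \<comment> \<open>Finitely many radii suffice because all coordinates from \<open>d\<close> on
    agree with those of \<open>x\<close>. The inserted 1 keeps the set nonempty when
    \<open>d = 0\<close>.\<close>
  define r where "r = Min (insert 1 (e ` {..<d}))"
  show thesis
  proof
    show "0 < r" using e by (simp add: r_def)
    show "rbox d x r \<subseteq> U"
    proof
      fix y assume y: "y \<in> rbox d x r"
      have "x \<in> Rsp d" using assms V by auto
      have "y i \<in> X i" for i
      proof (cases "i < d")
        case True
        then have "r \<le> e i" by (auto simp: r_def)
        then show ?thesis using y True by (intro e(2)) (auto simp: rbox_def intro: less_le_trans)
      next
        case False
        then have "y i = x i" using y \<open>x \<in> Rsp d\<close> by (auto simp: rbox_def in_Rsp)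
        then show ?thesis using e(1)[of i] e(2)[of "y i" i] by auto
      qed
      then show "y \<in> U" using X(4) y by (auto simp: V rbox_def)
    qed
  qed
qed

lemma openin_Rsp_iff_rbox:
  "openin (Euclidean_space d) U \<longleftrightarrow> U \<subseteq> Rsp d \<and> (\<forall>x\<in>U. \<exists>r>0. rbox d x r \<subseteq> U)"
proof safe
  assume *: "U \<subseteq> Rsp d" "\<forall>x\<in>U. \<exists>r>0. rbox d x r \<subseteq> U"
  have "\<exists>W. openin (Euclidean_space d) W \<and> x \<in> W \<and> W \<subseteq> U" if xU: "x \<in> U" for x
  proof -
    obtain r where "0 < r" "rbox d x r \<subseteq> U" using *(2) xU by blast
    then show ?thesis using openin_rbox[of d x r] * xU by (intro exI[of _ "rbox d x r"]) (auto simp: rbox_def)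
  qed
  then show "openin (Euclidean_space d) U" by (subst openin_subopen) blast
next
  fix x assume "openin (Euclidean_space d) U" "x \<in> U"
  then show "\<exists>r>0. rbox d x r \<subseteq> U"
    by (rule openin_contains_rbox) blast
next
  fix x assume "openin (Euclidean_space d) U" "x \<in> U"
  then show "x \<in> Rsp d" by (auto dest: openin_subset)
qed

lemma emeasure_rbox_finite: "emeasure (Rlebesgue d) (rbox d c r) < \<infinity>"
proof -
  interpret product_sigma_finite "\<lambda>_::nat. lborel :: real measure" by standard
  have m: "rbox d c r \<in> sets (Rborel d)" by (rule openin_Rborel[OF openin_rbox])
  then have "emeasure (Rlebesgue d) (rbox d c r) =
      emeasure (Pi\<^sub>M {..<d} (\<lambda>_. lborel)) (zext d -` rbox d c r \<inter> space (Pi\<^sub>M {..<d} (\<lambda>_. lborel :: real measure)))"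
    unfolding Rlebesgue_eq by (intro emeasure_distr) auto
  also have "zext d -` rbox d c r \<inter> space (Pi\<^sub>M {..<d} (\<lambda>_. lborel)) = Pi\<^sub>E {..<d} (\<lambda>i. {c i - r<..<c i + r})"
    by (auto simp: rbox_def space_PiM PiE_def zext_Rsp Pi_def) (auto simp: zext_def abs_less_iff)
  also have "emeasure (Pi\<^sub>M {..<d} (\<lambda>_. lborel)) \<dots> = (\<Prod>i<d. emeasure lborel {c i - r<..<c i + r})"
    by (rule emeasure_PiM) auto
  also have "\<dots> < \<infinity>"
  proof -
    have "emeasure lborel {c i - r<..<c i + r} \<noteq> \<infinity>" for i
      by (cases "0 \<le> r") auto
    then show ?thesis by (auto simp: less_top[symmetric] ennreal_prod_eq_top)
  qed
  finally show ?thesis .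
qed

subsection \<open>Convex sets\<close>

text \<open>By induction on the dimension: two slices of positive measure at different heights contain
  boxes, and the convex hull of two such boxes contains a box of full dimension.\<close>

lemma convex_PiM_contains_box:
  fixes D :: "('i \<Rightarrow> real) set"
  assumes "finite I" "D \<in> sets (Pi\<^sub>M I (\<lambda>_. lborel))" "emeasure (Pi\<^sub>M I (\<lambda>_. lborel)) D \<noteq> 0"
    and "\<And>x y s. x \<in> D \<Longrightarrow> y \<in> D \<Longrightarrow> 0 < s \<Longrightarrow> s < 1 \<Longrightarrow> (\<lambda>i\<in>I. (1 - s) * x i + s * y i) \<in> D"
  shows "\<exists>c r. 0 < r \<and> (\<forall>x\<in>extensional I. (\<forall>i\<in>I. \<bar>x i - c i\<bar> < r) \<longrightarrow> x \<in> D)"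
  using assms
proof (induction I arbitrary: D rule: finite_induct)
  case empty
  have "D \<noteq> {}" using empty.prems by auto
  moreover have "D \<subseteq> {\<lambda>_. undefined}" using sets.sets_into_space[OF empty.prems(1)] by (simp add: space_PiM)
  ultimately have "D = {\<lambda>_. undefined}" by auto
  then show ?case by (auto intro!: exI[of _ "1::real"])
next
  case (insert k I)
  interpret product_sigma_finite "\<lambda>_::'i. lborel :: real measure" by standard
  note [measurable] = insert.prems(1)
  define S where "S s = {x \<in> extensional I. x(k := s) \<in> D}" for s
  have S_meas: "S s \<in> sets (Pi\<^sub>M I (\<lambda>_. lborel))" for s
  proof -
    have "S s = {x \<in> space (Pi\<^sub>M I (\<lambda>_. lborel :: real measure)). x(k := s) \<in> D}"
      by (auto simp: S_def space_PiM PiE_def)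
    also have "\<dots> \<in> sets (Pi\<^sub>M I (\<lambda>_. lborel))" by measurable
    finally show ?thesis .
  qed
  have ind: "indicator D (x(k := s)) = (indicator (S s) x :: ennreal)" if "x \<in> space (Pi\<^sub>M I (\<lambda>_. lborel :: real measure))" for x s
    using that by (auto simp: S_def space_PiM PiE_def indicator_def)
  have "emeasure (Pi\<^sub>M (insert k I) (\<lambda>_. lborel)) D = (\<integral>\<^sup>+x. indicator D x \<partial>Pi\<^sub>M (insert k I) (\<lambda>_. lborel))"
    by simp
  also have "\<dots> = (\<integral>\<^sup>+s. (\<integral>\<^sup>+x. indicator D (x(k := s)) \<partial>Pi\<^sub>M I (\<lambda>_. lborel)) \<partial>lborel)"
    using insert.hyps by (intro product_nn_integral_insert_rev) auto
  also have "\<dots> = (\<integral>\<^sup>+s. emeasure (Pi\<^sub>M I (\<lambda>_. lborel)) (S s) \<partial>lborel)"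
    using S_meas by (intro nn_integral_cong) (simp add: ind cong: nn_integral_cong)
  finally have nz: "(\<integral>\<^sup>+s. emeasure (Pi\<^sub>M I (\<lambda>_. lborel)) (S s) \<partial>lborel) \<noteq> 0"
    using insert.prems(2) by simp
  \<comment> \<open>If at most one height had a slice of positive measure, Fubini would make
    \<open>D\<close> a null set, since a single height is null.\<close>
  have "\<exists>s1 s2. s1 < s2 \<and> emeasure (Pi\<^sub>M I (\<lambda>_. lborel)) (S s1) \<noteq> 0 \<and> emeasure (Pi\<^sub>M I (\<lambda>_. lborel)) (S s2) \<noteq> 0"
  proof (rule ccontr)
    assume n: "\<not> ?thesis"
    then have "\<exists>s0. \<forall>s. s \<noteq> s0 \<longrightarrow> emeasure (Pi\<^sub>M I (\<lambda>_. lborel)) (S s) = 0"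
      by (metis linorder_neqE_linordered_idom)
    then obtain s0 where s0: "\<And>s. s \<noteq> s0 \<Longrightarrow> emeasure (Pi\<^sub>M I (\<lambda>_. lborel)) (S s) = 0" by auto
    have "(\<integral>\<^sup>+s. emeasure (Pi\<^sub>M I (\<lambda>_. lborel)) (S s) \<partial>lborel) = (\<integral>\<^sup>+(s::real). 0 \<partial>lborel)"
    proof (rule nn_integral_cong_AE)
      have "AE s in lborel. s \<noteq> s0" by (rule AE_lborel_singleton)
      then show "AE s in lborel. emeasure (Pi\<^sub>M I (\<lambda>_. lborel)) (S s) = 0"
        by eventually_elim (rule s0)
    qed
    then show False using nz by simp
  qed
  then obtain s1 s2 where s: "s1 < s2" "emeasure (Pi\<^sub>M I (\<lambda>_. lborel)) (S s1) \<noteq> 0" "emeasure (Pi\<^sub>M I (\<lambda>_. lborel)) (S s2) \<noteq> 0"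
    by auto
  have Sconv: "(\<lambda>i\<in>I. (1 - r) * x i + r * y i) \<in> S s" if "x \<in> S s" "y \<in> S s" "0 < r" "r < 1" for x y r s
  proof -
    have "(\<lambda>i\<in>insert k I. (1 - r) * (x(k := s)) i + r * (y(k := s)) i) \<in> D"
      using that unfolding S_def mem_Collect_eq by (intro insert.prems(3)[of "x(k := s)" "y(k := s)"]) blast+
    also have "(\<lambda>i\<in>insert k I. (1 - r) * (x(k := s)) i + r * (y(k := s)) i) = (\<lambda>i\<in>I. (1 - r) * x i + r * y i)(k := s)"
      using insert.hyps by (auto simp: fun_eq_iff algebra_simps)
    finally show ?thesis unfolding S_def mem_Collect_eq by blast
  qed
  obtain c1 r1 where 1: "0 < r1" "\<And>x. x \<in> extensional I \<Longrightarrow> (\<And>i. i \<in> I \<Longrightarrow> \<bar>x i - c1 i\<bar> < r1) \<Longrightarrow> x \<in> S s1"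
  proof -
    have "\<exists>c r. 0 < r \<and> (\<forall>x\<in>extensional I. (\<forall>i\<in>I. \<bar>x i - c i\<bar> < r) \<longrightarrow> x \<in> S s1)"
      by (rule insert.IH[OF S_meas s(2)]) (rule Sconv)
    then show thesis using that by blast
  qed
  obtain c2 r2 where 2: "0 < r2" "\<And>x. x \<in> extensional I \<Longrightarrow> (\<And>i. i \<in> I \<Longrightarrow> \<bar>x i - c2 i\<bar> < r2) \<Longrightarrow> x \<in> S s2"
  proof -
    have "\<exists>c r. 0 < r \<and> (\<forall>x\<in>extensional I. (\<forall>i\<in>I. \<bar>x i - c i\<bar> < r) \<longrightarrow> x \<in> S s2)"
      by (rule insert.IH[OF S_meas s(3)]) (rule Sconv)
    then show thesis using that by blast
  qed
  define r where "r = min r1 r2"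
  define B where "B = (\<Sum>i\<in>I. \<bar>c2 i - c1 i\<bar>)"
  have B: "\<bar>c2 i - c1 i\<bar> \<le> B" if "i \<in> I" for i
    unfolding B_def using that insert.hyps by (intro member_le_sum) auto
  have "0 \<le> B" unfolding B_def by (intro sum_nonneg) auto
  define \<delta> where "\<delta> = s2 - s1"
  have "0 < \<delta>" using s by (simp add: \<delta>_def)
  \<comment> \<open>The bound \<open>\<delta> / 2\<close> keeps the interpolation parameter
    \<open>l\<close> strictly between 0 and 1. The other bound makes room for the deviation \<rho>
    of \<open>x\<close> from the middle of the centre line and for the drift of that line, at most
    \<open>\<rho> * B / \<delta>\<close>.\<close>
  define \<rho> where "\<rho> = min (\<delta> / 2) (r / (1 + B / \<delta>))"
  have "0 < r" using 1 2 by (simp add: r_def)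
  have pos: "0 < 1 + B / \<delta>" using \<open>0 \<le> B\<close> \<open>0 < \<delta>\<close> by (simp add: add_pos_nonneg)
  have "0 < \<rho>" using \<open>0 < \<delta>\<close> \<open>0 < r\<close> pos by (simp add: \<rho>_def)
  have \<rho>: "\<rho> \<le> \<delta> / 2" "\<rho> * (1 + B / \<delta>) \<le> r"
  proof -
    show "\<rho> \<le> \<delta> / 2" unfolding \<rho>_def by (rule min.cobounded1)
    have "\<rho> \<le> r / (1 + B / \<delta>)" by (simp add: \<rho>_def)
    then show "\<rho> * (1 + B / \<delta>) \<le> r" by (subst (asm) pos_le_divide_eq[OF pos])
  qed
  define c where "c = (\<lambda>i. (c1 i + c2 i) / 2)(k := (s1 + s2) / 2)"
  show ?case
  proof (intro exI conjI ballI impI)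
    show "0 < \<rho>" by fact
    fix x assume x: "x \<in> extensional (insert k I)" and near: "\<forall>i\<in>insert k I. \<bar>x i - c i\<bar> < \<rho>"
    define l where "l = (x k - s1) / \<delta>"
    have xk: "\<bar>x k - (s1 + s2) / 2\<bar> < \<rho>" using near by (auto simp: c_def)
    have l: "l - 1 / 2 = (x k - (s1 + s2) / 2) / \<delta>"
      using \<open>0 < \<delta>\<close> by (simp add: l_def \<delta>_def field_simps)
    then have l2: "\<bar>l - 1 / 2\<bar> * \<delta> < \<rho>"
      using xk \<open>0 < \<delta>\<close> by (simp add: abs_divide)
    then have l3: "0 < l" "l < 1"
    proof -
      have "\<bar>l - 1 / 2\<bar> * \<delta> < (1 / 2) * \<delta>" using l2 \<rho>(1) by simp
      then have "\<bar>l - 1 / 2\<bar> < 1 / 2" using \<open>0 < \<delta>\<close> by (simp only: mult_less_cancel_right_pos)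
      then show "0 < l" "l < 1" unfolding abs_less_iff by linarith+
    qed
    \<comment> \<open>The same offset is added to both slice centres, so that \<open>x\<close> is
      the convex combination of \<open>c1 + e\<close> and \<open>c2 + e\<close> with parameter
      \<open>l\<close>.\<close>
    define e where "e i = x i - ((1 - l) * c1 i + l * c2 i)" for i
    have e: "\<bar>e i\<bar> < r" if "i \<in> I" for i
    proof -
      have "i \<noteq> k" using that insert.hyps by auto
      then have ne: "\<bar>x i - (c1 i + c2 i) / 2\<bar> < \<rho>" using near that by (auto simp: c_def)
      have "e i = (x i - (c1 i + c2 i) / 2) - (l - 1 / 2) * (c2 i - c1 i)"
        by (simp add: e_def field_simps)
      then have "\<bar>e i\<bar> \<le> \<bar>x i - (c1 i + c2 i) / 2\<bar> + \<bar>l - 1 / 2\<bar> * \<bar>c2 i - c1 i\<bar>"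
        by (metis abs_mult abs_triangle_ineq4)
      also have "\<dots> < \<rho> + (\<rho> / \<delta>) * B"
      proof (intro add_less_le_mono ne mult_mono B that)
        show "\<bar>l - 1 / 2\<bar> \<le> \<rho> / \<delta>" using l2 \<open>0 < \<delta>\<close> by (simp add: pos_le_divide_eq)
      qed (use \<open>0 < \<rho>\<close> \<open>0 < \<delta>\<close> in auto)
      also have "\<dots> = \<rho> * (1 + B / \<delta>)" by (simp add: field_simps)
      finally show ?thesis using \<rho>(2) by simp
    qed
    have "(\<lambda>i\<in>I. c1 i + e i) \<in> S s1" "(\<lambda>i\<in>I. c2 i + e i) \<in> S s2"
      using e by (auto intro!: 1(2) 2(2) simp: r_def)
    then have "(\<lambda>j\<in>insert k I. (1 - l) * ((\<lambda>i\<in>I. c1 i + e i)(k := s1)) j + l * ((\<lambda>i\<in>I. c2 i + e i)(k := s2)) j) \<in> D"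
      using l3 unfolding S_def mem_Collect_eq
      by (intro insert.prems(3)[of "(\<lambda>i\<in>I. c1 i + e i)(k := s1)" "(\<lambda>i\<in>I. c2 i + e i)(k := s2)"]) blast+
    also have "(\<lambda>j\<in>insert k I. (1 - l) * ((\<lambda>i\<in>I. c1 i + e i)(k := s1)) j + l * ((\<lambda>i\<in>I. c2 i + e i)(k := s2)) j) = x"
    proof
      fix j
      have "(1 - l) * s1 + l * s2 = s1 + l * \<delta>" by (simp add: \<delta>_def algebra_simps)
      also have "\<dots> = x k" using \<open>0 < \<delta>\<close> by (simp add: l_def)
      finally show "(\<lambda>j\<in>insert k I. (1 - l) * ((\<lambda>i\<in>I. c1 i + e i)(k := s1)) j + l * ((\<lambda>i\<in>I. c2 i + e i)(k := s2)) j) j = x j"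
        using x by (cases "j = k"; cases "j \<in> I") (auto simp: e_def algebra_simps extensional_def)
    qed
    finally show "x \<in> D" .
  qed
qed

section \<open>Convex subsets of the coordinate space and their interiors\<close>

definition rconvex :: "nat \<Rightarrow> rvec set \<Rightarrow> bool" where
  "rconvex d D \<longleftrightarrow> D \<subseteq> Rsp d \<and>
     (\<forall>x\<in>D. \<forall>y\<in>D. \<forall>s. 0 < s \<longrightarrow> s < 1 \<longrightarrow> (\<lambda>i. (1 - s) * x i + s * y i) \<in> D)"

text \<open>For \<open>D \<subseteq> Rsp d\<close> this is the interior of \<open>D\<close> relative
  to \<open>Rsp d\<close>, written with boxes so that homotheties act on it explicitly.\<close>

definition rcore :: "nat \<Rightarrow> rvec set \<Rightarrow> rvec set" where
  "rcore d D = {x \<in> D. \<exists>r>0. rbox d x r \<subseteq> D}"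

lemma rconvexD: "rconvex d D \<Longrightarrow> x \<in> D \<Longrightarrow> y \<in> D \<Longrightarrow> 0 < s \<Longrightarrow> s < 1 \<Longrightarrow> (\<lambda>i. (1 - s) * x i + s * y i) \<in> D"
  by (simp add: rconvex_def)

lemma rconvex_contains_rbox:
  assumes D: "rconvex d D" "D \<in> sets (Rborel d)" "emeasure (Rlebesgue d) D \<noteq> 0"
  obtains c r where "c \<in> Rsp d" "0 < r" "rbox d c r \<subseteq> D"
proof -
  define E where "E = zext d -` D \<inter> space (Pi\<^sub>M {..<d} (\<lambda>_. lborel :: real measure))"
  have "\<exists>c r. 0 < r \<and> (\<forall>x\<in>extensional {..<d}. (\<forall>i\<in>{..<d}. \<bar>x i - c i\<bar> < r) \<longrightarrow> x \<in> E)"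
  proof (rule convex_PiM_contains_box)
    show "E \<in> sets (Pi\<^sub>M {..<d} (\<lambda>_. lborel))"
      unfolding E_def using D(2) by measurable
    show "emeasure (Pi\<^sub>M {..<d} (\<lambda>_. lborel)) E \<noteq> 0"
      using D(3) unfolding Rlebesgue_eq E_def by (subst (asm) emeasure_distr) (use D in auto)
    fix x y and s :: real assume "x \<in> E" "y \<in> E" "0 < s" "s < 1"
    then have "(\<lambda>i. (1 - s) * zext d x i + s * zext d y i) \<in> D"
      using D(1) by (intro rconvexD) (auto simp: E_def)
    also have "(\<lambda>i. (1 - s) * zext d x i + s * zext d y i) = zext d (\<lambda>i\<in>{..<d}. (1 - s) * x i + s * y i)"
      by (auto simp: zext_def)
    finally show "(\<lambda>i\<in>{..<d}. (1 - s) * x i + s * y i) \<in> E"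
      by (simp add: E_def space_PiM)
  qed simp
  then obtain c r where c: "0 < r" "\<And>x. x \<in> extensional {..<d} \<Longrightarrow> (\<forall>i<d. \<bar>x i - c i\<bar> < r) \<Longrightarrow> x \<in> E"
    unfolding Ball_def lessThan_iff by blast
  show thesis
  proof
    show "zext d c \<in> Rsp d" by (rule zext_Rsp)
    show "rbox d (zext d c) r \<subseteq> D"
    proof
      fix x assume x: "x \<in> rbox d (zext d c) r"
      then have "restrict x {..<d} \<in> E"
        by (intro c(2)) (auto simp: rbox_def zext_def)
      then have "zext d (restrict x {..<d}) \<in> D" by (simp add: E_def)
      also have "zext d (restrict x {..<d}) = x"
        using x by (auto simp: zext_def rbox_def in_Rsp)
      finally show "x \<in> D" .
    qed
  qed fact
qed

lemma rcore_subset: "rcore d D \<subseteq> D"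
  by (auto simp: rcore_def)

lemma openin_rcore:
  assumes "D \<subseteq> Rsp d"
  shows "openin (Euclidean_space d) (rcore d D)"
  unfolding openin_Rsp_iff_rbox
proof (intro conjI ballI)
  show "rcore d D \<subseteq> Rsp d" using assms by (auto simp: rcore_def)
  fix x assume "x \<in> rcore d D"
  then obtain r where r: "0 < r" "rbox d x r \<subseteq> D" by (auto simp: rcore_def)
  have "y \<in> rcore d D" if yr: "y \<in> rbox d x r" for y
  proof -
    obtain q where "0 < q" "rbox d y q \<subseteq> rbox d x r"
      by (rule openin_contains_rbox[OF openin_rbox yr])
    then show ?thesis using r yr by (auto simp: rcore_def)
  qed
  then show "\<exists>r>0. rbox d x r \<subseteq> rcore d D" using r by auto
qed

text \<open>The homothety with centre \<open>y\<close> and ratio \<open>s\<close> carries a box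
  around \<open>c\<close> inside \<open>D\<close> to a box around the given point, and by convexity
  its image stays in \<open>D\<close>. Note that \<open>y\<close> itself may lie on the
  boundary.\<close>

lemma rcore_segment:
  assumes D: "rconvex d D" and y: "y \<in> D" and c: "c \<in> rcore d D" and s: "0 < s" "s < 1"
  shows "(\<lambda>i. (1 - s) * y i + s * c i) \<in> rcore d D"
proof -
  obtain r where r: "0 < r" "rbox d c r \<subseteq> D" using c by (auto simp: rcore_def)
  have R: "y \<in> Rsp d" "c \<in> Rsp d" using D y c by (auto simp: rconvex_def rcore_def)
  have "rbox d (\<lambda>i. (1 - s) * y i + s * c i) (s * r) \<subseteq> D"
  proof
    fix z assume z: "z \<in> rbox d (\<lambda>i. (1 - s) * y i + s * c i) (s * r)"
    define w where "w i = (z i - (1 - s) * y i) / s" for i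
    have "w \<in> rbox d c r"
      unfolding rbox_def
    proof (intro CollectI conjI allI impI)
      show "w \<in> Rsp d" using z R by (auto simp: w_def rbox_def in_Rsp)
      fix i assume "i < d"
      then have "\<bar>z i - ((1 - s) * y i + s * c i)\<bar> < s * r" using z by (auto simp: rbox_def)
      moreover have "z i - ((1 - s) * y i + s * c i) = s * (w i - c i)"
        using s by (simp add: w_def field_simps)
      ultimately show "\<bar>w i - c i\<bar> < r" using s by (simp add: abs_mult)
    qed
    then have "w \<in> D" using r by auto
    then have "(\<lambda>i. (1 - s) * y i + s * w i) \<in> D" using s y D by (intro rconvexD)
    also have "(\<lambda>i. (1 - s) * y i + s * w i) = z" using s by (simp add: w_def)
    finally show "z \<in> D" .
  qed
  moreover have "(\<lambda>i. (1 - s) * y i + s * c i) \<in> D"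
    using D y c s rcore_subset by (intro rconvexD) auto
  ultimately show ?thesis using s r by (auto simp: rcore_def intro!: exI[of _ "s * r"])
qed

lemma rconvex_rcore: "rconvex d D \<Longrightarrow> rconvex d (rcore d D)"
  unfolding rconvex_def[of d "rcore d D"]
proof (intro conjI ballI allI impI)
  assume D: "rconvex d D"
  then show "rcore d D \<subseteq> Rsp d" using rcore_subset[of d D] by (auto simp: rconvex_def)
  show "(\<lambda>i. (1 - s) * x i + s * y i) \<in> rcore d D"
    if "x \<in> rcore d D" "y \<in> rcore d D" "0 < s" "s < 1" for x y s
    using that by (intro rcore_segment D) (auto simp: rcore_def)
qed

text \<open>Contracting \<^term>\<open>D\<close> by a factor \<open>1 - s\<close> towards an interior point moves it into the core, so
  \<open>(1 - s)\<^sup>d |D| \<le> |core D|\<close> on bounded pieces; then \<open>s\<close> tends to \<open>0\<close>.\<close>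

lemma emeasure_rcore:
  assumes D: "rconvex d D" "D \<in> sets (Rborel d)" "emeasure (Rlebesgue d) D \<noteq> 0"
  shows "emeasure (Rlebesgue d) (D - rcore d D) = 0"
proof -
  obtain c r where c: "c \<in> Rsp d" "0 < r" "rbox d c r \<subseteq> D"
    using rconvex_contains_rbox[OF D] .
  then have cc: "c \<in> rcore d D" by (auto simp: rcore_def rbox_def)
  have sub: "D \<subseteq> Rsp d" using D by (simp add: rconvex_def)
  define C where "C = rcore d D"
  have CD: "C \<subseteq> D" unfolding C_def by (rule rcore_subset)
  have [measurable]: "C \<in> sets (Rborel d)" "D \<in> sets (Rborel d)"
    unfolding C_def using openin_Rborel[OF openin_rcore[OF sub]] D by auto
  have bm: "rbox d c R \<in> sets (Rborel d)" for R by (rule openin_Rborel[OF openin_rbox])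
  \<comment> \<open>Intersecting with a box makes all measures finite, so that they can be
    subtracted; a box centred at \<open>c\<close> is mapped into itself by the contraction towards
    \<open>c\<close>.\<close>
  have null: "emeasure (Rlebesgue d) ((D - C) \<inter> rbox d c R) = 0" for R :: real
  proof -
    define DR where "DR = D \<inter> rbox d c R"
    define CR where "CR = C \<inter> rbox d c R"
    have [measurable]: "DR \<in> sets (Rborel d)" "CR \<in> sets (Rborel d)" using bm by (auto simp: DR_def CR_def)
    have fin: "emeasure (Rlebesgue d) DR \<noteq> \<infinity>" "emeasure (Rlebesgue d) CR \<noteq> \<infinity>"
    proof -
      have "emeasure (Rlebesgue d) A < \<infinity>" if "A \<subseteq> rbox d c R" for A
        using emeasure_mono[OF that, of "Rlebesgue d"] emeasure_rbox_finite[of d c R] bm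
        by (auto intro: le_less_trans)
      from this[of DR] this[of CR] show "emeasure (Rlebesgue d) DR \<noteq> \<infinity>" "emeasure (Rlebesgue d) CR \<noteq> \<infinity>"
        by (auto simp: DR_def CR_def)
    qed
    have scal: "ennreal ((1 - s) ^ d) * emeasure (Rlebesgue d) DR \<le> emeasure (Rlebesgue d) CR" if s: "0 < s" "s < 1" for s :: real
    proof -
      have "(\<integral>\<^sup>+x. indicator DR x \<partial>Rlebesgue d) \<le> (\<integral>\<^sup>+x. indicator CR (\<lambda>i. s * c i + (1 - s) * x i) \<partial>Rlebesgue d)"
      proof (intro nn_integral_mono)
        fix x
        show "(indicator DR x :: ennreal) \<le> indicator CR (\<lambda>i. s * c i + (1 - s) * x i)"
        proof (cases "x \<in> DR")
          case True
          then have x: "x \<in> D" "x \<in> rbox d c R" by (auto simp: DR_def)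
          have "(\<lambda>i. s * c i + (1 - s) * x i) \<in> C"
            using rcore_segment[OF D(1) x(1) cc s] by (simp add: C_def add.commute)
          moreover have "(\<lambda>i. s * c i + (1 - s) * x i) \<in> rbox d c R"
            unfolding rbox_def
          proof (intro CollectI conjI allI impI)
            show "(\<lambda>i. s * c i + (1 - s) * x i) \<in> Rsp d" using c(1) x(2) by (simp add: in_Rsp rbox_def)
            fix i assume "i < d"
            then have "\<bar>x i - c i\<bar> < R" using x by (auto simp: rbox_def)
            have e: "s * c i + (1 - s) * x i - c i = (1 - s) * (x i - c i)" by (simp add: algebra_simps)
            have "\<bar>s * c i + (1 - s) * x i - c i\<bar> = (1 - s) * \<bar>x i - c i\<bar>" unfolding e using s by (simp add: abs_mult)
            also have "\<dots> \<le> 1 * \<bar>x i - c i\<bar>" using s by (intro mult_right_mono) auto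
            also have "\<dots> < R" using \<open>\<bar>x i - c i\<bar> < R\<close> by simp
            finally show "\<bar>s * c i + (1 - s) * x i - c i\<bar> < R" .
          qed
          ultimately have "(\<lambda>i. s * c i + (1 - s) * x i) \<in> CR" by (simp add: CR_def)
          then show ?thesis using True by simp
        qed simp
      qed
      then have "ennreal ((1 - s) ^ d) * emeasure (Rlebesgue d) DR \<le>
          ennreal ((1 - s) ^ d) * (\<integral>\<^sup>+x. indicator CR (\<lambda>i. s * c i + (1 - s) * x i) \<partial>Rlebesgue d)"
        by (intro mult_left_mono) auto
      also have "\<dots> = (\<integral>\<^sup>+x. indicator CR x \<partial>Rlebesgue d)"
        using s c by (intro nn_integral_Rlebesgue_affine[symmetric]) (auto simp: in_Rsp)
      finally show ?thesis by simp
    qed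
    have le: "(1 - s) ^ d * measure (Rlebesgue d) DR \<le> measure (Rlebesgue d) CR" if "0 < s" "s < 1" for s :: real
    proof -
      have "ennreal ((1 - s) ^ d) * ennreal (measure (Rlebesgue d) DR) \<le> ennreal (measure (Rlebesgue d) CR)"
        using scal[OF that] fin
          emeasure_eq_ennreal_measure[of "Rlebesgue d" DR] emeasure_eq_ennreal_measure[of "Rlebesgue d" CR] by simp
      then have "ennreal ((1 - s) ^ d * measure (Rlebesgue d) DR) \<le> ennreal (measure (Rlebesgue d) CR)"
        using that by (subst ennreal_mult) auto
      then show ?thesis by (subst (asm) ennreal_le_iff) auto
    qed
    have "isCont (\<lambda>s. (1 - s) ^ d * measure (Rlebesgue d) DR) 0"
      by simp
    then have "((\<lambda>s. (1 - s) ^ d * measure (Rlebesgue d) DR) \<longlongrightarrow> (1 - 0) ^ d * measure (Rlebesgue d) DR) (at_right 0)"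
      unfolding isCont_def by (rule tendsto_within_subset) simp
    then have "(1 - 0) ^ d * measure (Rlebesgue d) DR \<le> measure (Rlebesgue d) CR"
    proof (rule tendsto_upperbound)
      show "\<forall>\<^sub>F s in at_right 0. (1 - s) ^ d * measure (Rlebesgue d) DR \<le> measure (Rlebesgue d) CR"
        using le by (intro eventually_at_rightI[of 0 1]) auto
    qed simp
    then have "emeasure (Rlebesgue d) DR \<le> emeasure (Rlebesgue d) CR"
      using fin emeasure_eq_ennreal_measure[of "Rlebesgue d" DR] emeasure_eq_ennreal_measure[of "Rlebesgue d" CR]
      by (simp add: ennreal_leI)
    moreover have "emeasure (Rlebesgue d) (DR - CR) = emeasure (Rlebesgue d) DR - emeasure (Rlebesgue d) CR"
      using CD \<open>DR \<in> _\<close> \<open>CR \<in> _\<close> by (intro emeasure_Diff fin(2)) (simp_all, auto simp: DR_def CR_def)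
    moreover have "(D - C) \<inter> rbox d c R = DR - CR" by (auto simp: DR_def CR_def)
    ultimately show ?thesis using fin by (simp add: diff_eq_0_ennreal less_top)
  qed
  have "D - C = (\<Union>n::nat. (D - C) \<inter> rbox d c (real n))"
  proof safe
    fix x assume x: "x \<in> D" "x \<notin> C"
    obtain n :: nat where n: "(\<Sum>i<d. \<bar>x i - c i\<bar>) < real n" using reals_Archimedean2 by auto
    have "\<bar>x i - c i\<bar> < real n" if "i < d" for i
      using member_le_sum[of i "{..<d}" "\<lambda>i. \<bar>x i - c i\<bar>"] that n by auto
    then show "x \<in> (\<Union>n::nat. (D - C) \<inter> rbox d c (real n))" using x sub by (auto simp: rbox_def)
  qed
  also have "emeasure (Rlebesgue d) \<dots> = 0"
    using bm null by (intro emeasure_UN_eq_0) auto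
  finally show ?thesis by (simp add: C_def)
qed


subsection \<open>Calculus along lines\<close>

lemma enorm_nonneg [simp]: "0 \<le> enorm d x"
  by (simp add: enorm_def)

lemma edist_nonneg [simp]: "0 \<le> edist d x y"
  by (simp add: edist_def)

lemma enorm_power2: "(enorm d x)\<^sup>2 = (\<Sum>i<d. (x i)\<^sup>2)"
  by (simp add: enorm_def L2_set_def sum_nonneg)

lemma edist_power2: "(edist d x y)\<^sup>2 = (\<Sum>i<d. (x i - y i)\<^sup>2)"
  by (simp add: edist_def enorm_power2)

lemma enorm_scale: "enorm d (\<lambda>i. c * x i) = \<bar>c\<bar> * enorm d x"
proof -
  have "enorm d (\<lambda>i. c * x i) = sqrt (c\<^sup>2 * (\<Sum>i<d. (x i)\<^sup>2))"
    by (simp add: enorm_def L2_set_def power_mult_distrib sum_distrib_left)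
  then show ?thesis by (simp add: real_sqrt_mult enorm_def L2_set_def)
qed

lemma inner_le_enorm: "\<bar>\<Sum>i<d. x i * y i\<bar> \<le> enorm d x * enorm d y"
proof -
  have "\<bar>\<Sum>i<d. x i * y i\<bar> \<le> (\<Sum>i<d. \<bar>x i\<bar> * \<bar>y i\<bar>)"
    using sum_abs[of "\<lambda>i. x i * y i" "{..<d}"] by (simp add: abs_mult)
  also have "\<dots> \<le> enorm d x * enorm d y"
    unfolding enorm_def by (rule L2_set_mult_ineq)
  finally show ?thesis .
qed

lemma enorm_eq_0: "enorm d x = 0 \<longleftrightarrow> (\<forall>i<d. x i = 0)"
  by (auto simp: enorm_def L2_set_eq_0_iff)

text \<open>A nonzero direction is required because the target filter is punctured: the line must
  leave its base point as soon as \<open>s \<noteq> s0\<close>.\<close>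

lemma filterlim_line:
  assumes "x \<in> Rsp d" "v \<in> Rsp d" "enorm d v \<noteq> 0"
  shows "filterlim (\<lambda>s i. x i + s * v i) (at (\<lambda>i. x i + s0 * v i) within Rsp d) (at s0)"
  unfolding filterlim_at
proof
  obtain j where j: "j < d" "v j \<noteq> 0" using assms(3) by (auto simp: enorm_eq_0)
  show "\<forall>\<^sub>F s in at s0. (\<lambda>i. x i + s * v i) \<in> Rsp d \<and> (\<lambda>i. x i + s * v i) \<noteq> (\<lambda>i. x i + s0 * v i)"
    using eventually_neq_at_within[of s0 s0 UNIV]
  proof eventually_elim
    case (elim s)
    then have "x j + s * v j \<noteq> x j + s0 * v j" using j by simp
    then show ?case using assms(1,2) by (auto simp: in_Rsp dest: fun_cong[of _ _ j])
  qed
  have "continuous_on UNIV (\<lambda>s i. x i + s * v i)"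
    by (rule continuous_on_coordinatewise_then_product) (intro continuous_intros)
  then show "((\<lambda>s i. x i + s * v i) \<longlongrightarrow> (\<lambda>i. x i + s0 * v i)) (at s0)"
    by (simp add: continuous_on_def)
qed

lemma edist_line: "edist d (\<lambda>i. x i + s * v i) (\<lambda>i. x i + s0 * v i) = \<bar>s - s0\<bar> * enorm d v"
proof -
  have "(\<lambda>i. (x i + s * v i) - (x i + s0 * v i)) = (\<lambda>i. (s - s0) * v i)" by (simp add: algebra_simps)
  then show ?thesis by (simp add: edist_def enorm_scale)
qed

lemma has_gradient_line:
  assumes "x \<in> Rsp d" "v \<in> Rsp d" "enorm d v \<noteq> 0" "has_gradient d f (\<lambda>i. x i + s0 * v i) g"
  shows "((\<lambda>s. f (\<lambda>i. x i + s * v i)) has_real_derivative (\<Sum>j<d. g j * v j)) (at s0)"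
proof -
  define \<gamma> where "\<gamma> s = (\<lambda>i. x i + s * v i)" for s
  have "((\<lambda>s. (f (\<gamma> s) - f (\<gamma> s0) - (\<Sum>j<d. g j * (\<gamma> s j - \<gamma> s0 j))) / edist d (\<gamma> s) (\<gamma> s0)) \<longlongrightarrow> 0) (at s0)"
    using filterlim_compose[OF assms(4)[unfolded has_gradient_def] filterlim_line[OF assms(1-3)]]
    by (simp add: \<gamma>_def)
  then have "((\<lambda>s. enorm d v * ((f (\<gamma> s) - f (\<gamma> s0) - (\<Sum>j<d. g j * (\<gamma> s j - \<gamma> s0 j))) / edist d (\<gamma> s) (\<gamma> s0))) \<longlongrightarrow> enorm d v * 0) (at s0)"
    by (rule tendsto_mult_left)
  moreover have "enorm d v * ((f (\<gamma> s) - f (\<gamma> s0) - (\<Sum>j<d. g j * (\<gamma> s j - \<gamma> s0 j))) / edist d (\<gamma> s) (\<gamma> s0))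
      = (f (\<gamma> s) - f (\<gamma> s0) - (\<Sum>j<d. g j * v j) * (s - s0)) / \<bar>s - s0\<bar>" for s
  proof -
    have e: "(\<Sum>j<d. g j * (\<gamma> s j - \<gamma> s0 j)) = (\<Sum>j<d. g j * v j) * (s - s0)"
      unfolding sum_distrib_right by (intro sum.cong) (auto simp: \<gamma>_def algebra_simps)
    show ?thesis
      unfolding e unfolding \<gamma>_def edist_line using assms(3) by simp
  qed
  ultimately have "((\<lambda>s. (f (\<gamma> s) - f (\<gamma> s0) - (\<Sum>j<d. g j * v j) * (s - s0)) / \<bar>s - s0\<bar>) \<longlongrightarrow> 0) (at s0)"
    by simp
  from tendsto_norm_zero[OF this] show ?thesis
    unfolding has_field_derivative_def has_derivative_iff_norm
    by (simp add: \<gamma>_def bounded_linear_mult_right abs_divide)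
qed

text \<open>The remainder of the scalar derivative is the inner product of the vector remainder with
  \<open>v\<close>; Cauchy-Schwarz bounds it, and \<open>edist_line\<close> converts distance into
  time.\<close>

lemma has_jacobian_line:
  assumes "x \<in> Rsp d" "v \<in> Rsp d" "enorm d v \<noteq> 0" "has_jacobian d G (\<lambda>i. x i + s0 * v i) H"
  shows "((\<lambda>s. \<Sum>i<d. G (\<lambda>i. x i + s * v i) i * v i) has_real_derivative (\<Sum>i<d. \<Sum>j<d. v i * H i j * v j)) (at s0)"
proof -
  define \<gamma> where "\<gamma> s = (\<lambda>i. x i + s * v i)" for s
  define E where "E s = (\<lambda>i. G (\<gamma> s) i - G (\<gamma> s0) i - (\<Sum>j<d. H i j * (\<gamma> s j - \<gamma> s0 j)))" for s
  have "((\<lambda>s. enorm d (E s) / edist d (\<gamma> s) (\<gamma> s0)) \<longlongrightarrow> 0) (at s0)"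
    using filterlim_compose[OF assms(4)[unfolded has_jacobian_def] filterlim_line[OF assms(1-3)]]
    by (simp add: \<gamma>_def E_def)
  then have "((\<lambda>s. (enorm d v)\<^sup>2 * (enorm d (E s) / edist d (\<gamma> s) (\<gamma> s0))) \<longlongrightarrow> (enorm d v)\<^sup>2 * 0) (at s0)"
    by (rule tendsto_mult_left)
  then have lim: "((\<lambda>s. (enorm d v)\<^sup>2 * (enorm d (E s) / edist d (\<gamma> s) (\<gamma> s0))) \<longlongrightarrow> 0) (at s0)"
    by simp
  define R where "R s = (\<Sum>i<d. G (\<gamma> s) i * v i) - (\<Sum>i<d. G (\<gamma> s0) i * v i) - (\<Sum>i<d. \<Sum>j<d. v i * H i j * v j) * (s - s0)" for s
  have "((\<lambda>s. R s / \<bar>s - s0\<bar>) \<longlongrightarrow> 0) (at s0)"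
  proof (rule Lim_null_comparison[OF _ lim], intro always_eventually allI)
    fix s
    have "R s = (\<Sum>i<d. E s i * v i)"
    proof -
      have "(\<Sum>j<d. H i j * (\<gamma> s j - \<gamma> s0 j)) * v i = (\<Sum>j<d. v i * H i j * v j) * (s - s0)" for i
        unfolding sum_distrib_right by (intro sum.cong) (auto simp: \<gamma>_def algebra_simps)
      then have "(\<Sum>i<d. (\<Sum>j<d. H i j * (\<gamma> s j - \<gamma> s0 j)) * v i) = (\<Sum>i<d. \<Sum>j<d. v i * H i j * v j) * (s - s0)"
        by (simp add: sum_distrib_right)
      then show ?thesis by (simp add: R_def E_def left_diff_distrib sum_subtractf)
    qed
    then have "\<bar>R s\<bar> \<le> enorm d (E s) * enorm d v" by (simp add: inner_le_enorm)
    then have "\<bar>R s\<bar> / \<bar>s - s0\<bar> \<le> enorm d (E s) * enorm d v / \<bar>s - s0\<bar>"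
      by (rule divide_right_mono) simp
    also have "\<dots> = (enorm d v)\<^sup>2 * (enorm d (E s) / edist d (\<gamma> s) (\<gamma> s0))"
      unfolding \<gamma>_def edist_line using assms(3) by (simp add: power2_eq_square)
    finally show "norm (R s / \<bar>s - s0\<bar>) \<le> (enorm d v)\<^sup>2 * (enorm d (E s) / edist d (\<gamma> s) (\<gamma> s0))"
      by (simp add: abs_divide)
  qed
  then have "((\<lambda>s. norm (R s / \<bar>s - s0\<bar>)) \<longlongrightarrow> 0) (at s0)" by (rule tendsto_norm_zero)
  then show ?thesis
    unfolding has_field_derivative_def has_derivative_iff_norm
    by (simp add: R_def \<gamma>_def bounded_linear_mult_right abs_divide)
qed

text \<open>The gradient exists on a whole neighbourhood, hence \<open>deriv \<phi>\<close> equals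
  the directional derivative near \<open>s0\<close> and can be differentiated again. Stating the
  result with \<open>deriv\<close> gives one function for all points, whereas the gradient field in
  \<open>has_hessian\<close> is a separate existential witness at each point.\<close>

lemma has_hessian_line:
  assumes "x \<in> Rsp d" "v \<in> Rsp d" "enorm d v \<noteq> 0" "has_hessian d f (\<lambda>i. x i + s0 * v i) H"
  defines "\<phi> \<equiv> (\<lambda>s. f (\<lambda>i. x i + s * v i))"
  shows "(\<phi> has_real_derivative deriv \<phi> s0) (at s0)"
    and "(deriv \<phi> has_real_derivative (\<Sum>i<d. \<Sum>j<d. v i * H i j * v j)) (at s0)"
proof -
  obtain U G where U: "openin (Euclidean_space d) U" "(\<lambda>i. x i + s0 * v i) \<in> U"
    "\<And>y. y \<in> U \<Longrightarrow> has_gradient d f y (G y)" "has_jacobian d G (\<lambda>i. x i + s0 * v i) H"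
    using assms(4) by (auto simp: has_hessian_def)
  obtain V where V: "open V" "U = V \<inter> Rsp d" using U(1) openin_Rsp by auto
  have "continuous_on UNIV (\<lambda>s i. x i + s * v i)"
    by (rule continuous_on_coordinatewise_then_product) (intro continuous_intros)
  then have "open ((\<lambda>s i. x i + s * v i) -` V)"
    using V(1) by (rule open_vimage[rotated])
  moreover have "s0 \<in> (\<lambda>s i. x i + s * v i) -` V" using U(2) V by auto
  ultimately have ev: "\<forall>\<^sub>F s in nhds s0. (\<lambda>i. x i + s * v i) \<in> U"
    unfolding eventually_nhds
  proof (intro exI conjI ballI)
    fix s assume "s \<in> (\<lambda>s i. x i + s * v i) -` V"
    then show "(\<lambda>i. x i + s * v i) \<in> U" using V assms(1,2) by (simp add: in_Rsp)
  qed
  have d: "(\<phi> has_real_derivative (\<Sum>j<d. G (\<lambda>i. x i + s * v i) j * v j)) (at s)" if "(\<lambda>i. x i + s * v i) \<in> U" for s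
    unfolding \<phi>_def using that U(3) assms by (intro has_gradient_line) auto
  show "(\<phi> has_real_derivative deriv \<phi> s0) (at s0)"
    using d[OF U(2)] by (metis DERIV_imp_deriv)
  have "\<forall>\<^sub>F s in nhds s0. deriv \<phi> s = (\<Sum>j<d. G (\<lambda>i. x i + s * v i) j * v j)"
    using ev by eventually_elim (rule DERIV_imp_deriv[OF d])
  then show "(deriv \<phi> has_real_derivative (\<Sum>i<d. \<Sum>j<d. v i * H i j * v j)) (at s0)"
    using has_jacobian_line[OF assms(1-3) U(4)] by (subst DERIV_cong_ev[OF refl _ refl])
qed

lemma loewner_scaled_id:
  "(\<Sum>i<d. \<Sum>j<d. h i * scaled_id c i j * h j) = c * (enorm d h)\<^sup>2"
proof -
  have "(\<Sum>j<d. h i * scaled_id c i j * h j) = c * (h i)\<^sup>2" if "i < d" for i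
  proof -
    have "(\<Sum>j<d. h i * scaled_id c i j * h j) = (\<Sum>j<d. if j = i then c * (h i)\<^sup>2 else 0)"
      by (intro sum.cong) (auto simp: scaled_id_def power2_eq_square)
    then show ?thesis using that by simp
  qed
  then show ?thesis by (simp add: enorm_power2 sum_distrib_left)
qed

text \<open>Along the segment, \<open>\<phi> s - n / 2 * s^2\<close> with
  \<open>n = c * |y - x|^2\<close> is convex; comparing its values at 0, 1/2 and 1 leaves
  \<open>n / 4 - n / 8 = n / 8\<close>. Midpoint form is what Prekopa-Leindler consumes.\<close>

lemma hessian_lower_midpoint:
  assumes S: "rconvex d S" "\<And>y. y \<in> S \<Longrightarrow> \<exists>H. has_hessian d f y H \<and> loewner_le d (scaled_id c) H"
    and xy: "x \<in> S" "y \<in> S"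
  shows "f (\<lambda>i. (x i + y i) / 2) \<le> (f x + f y) / 2 - c / 8 * (edist d x y)\<^sup>2"
proof (cases "x = y")
  case True
  then show ?thesis by (simp add: edist_power2)
next
  case False
  have R: "x \<in> Rsp d" "y \<in> Rsp d" using S xy by (auto simp: rconvex_def)
  define v where "v i = y i - x i" for i
  have v: "v \<in> Rsp d" using R by (simp add: v_def in_Rsp)
  have nz: "enorm d v \<noteq> 0" using False Rsp_eqI[OF R] by (auto simp: enorm_eq_0 v_def)
  have ed: "edist d x y = enorm d v"
    by (simp add: edist_def v_def enorm_def L2_set_def power2_commute)
  have mem: "(\<lambda>i. x i + s * v i) \<in> S" if "s \<in> {0..1}" for s
  proof -
    have "(\<lambda>i. x i + s * v i) = (\<lambda>i. (1 - s) * x i + s * y i)" by (simp add: v_def algebra_simps)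
    moreover have "(\<lambda>i. (1 - s) * x i + s * y i) \<in> S"
      using rconvexD[OF S(1) xy, of s] that xy by (cases "s = 0 \<or> s = 1") auto
    ultimately show ?thesis by simp
  qed
  define \<phi> where "\<phi> = (\<lambda>s. f (\<lambda>i. x i + s * v i))"
  have "\<exists>q. (deriv \<phi> has_real_derivative q) (at s) \<and> c * (enorm d v)\<^sup>2 \<le> q \<and> (\<phi> has_real_derivative deriv \<phi> s) (at s)"
    if s01: "s \<in> {0..1}" for s
  proof -
    obtain H where "has_hessian d f (\<lambda>i. x i + s * v i) H" "loewner_le d (scaled_id c) H"
      using S(2)[OF mem[OF s01]] by blast
    then show ?thesis
      using has_hessian_line[OF R(1) v nz] v unfolding \<phi>_def loewner_le_def loewner_scaled_id by blast
  qed
  then obtain q where q: "\<And>s. s \<in> {0..1} \<Longrightarrow> (deriv \<phi> has_real_derivative q s) (at s)"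
      "\<And>s. s \<in> {0..1} \<Longrightarrow> c * (enorm d v)\<^sup>2 \<le> q s" "\<And>s. s \<in> {0..1} \<Longrightarrow> (\<phi> has_real_derivative deriv \<phi> s) (at s)"
    by metis
  let ?n = "c * (enorm d v)\<^sup>2"
  have "convex_on {0..1} (\<lambda>s. \<phi> s - ?n / 2 * s\<^sup>2)"
  proof (rule f''_ge0_imp_convex[where f' = "\<lambda>s. deriv \<phi> s - ?n * s" and f'' = "\<lambda>s. q s - ?n"])
    fix s :: real assume s: "s \<in> {0..1}"
    show "((\<lambda>s. \<phi> s - ?n / 2 * s\<^sup>2) has_real_derivative deriv \<phi> s - ?n * s) (at s)"
      by (auto intro!: derivative_eq_intros q(3) s)
    show "((\<lambda>s. deriv \<phi> s - ?n * s) has_real_derivative q s - ?n) (at s)"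
      by (auto intro!: derivative_eq_intros q(1) s)
    show "0 \<le> q s - ?n" using q(2)[OF s] by simp
  qed simp
  from convex_onD[OF this, of "1/2" 0 1]
  have "\<phi> (1/2) \<le> (\<phi> 0 + \<phi> 1) / 2 - ?n / 8" by (simp add: power2_eq_square field_simps)
  moreover have "\<phi> 0 = f x" "\<phi> 1 = f y" by (simp_all add: \<phi>_def v_def)
  moreover have "\<phi> (1/2) = f (\<lambda>i. (x i + y i) / 2)"
    unfolding \<phi>_def by (rule arg_cong[where f=f]) (auto simp: v_def field_simps)
  ultimately show ?thesis unfolding ed by simp
qed

text \<open>The mirror image: \<open>c / 2 * s^2 - \<phi> s\<close> is convex on the line. The
  symmetric second difference is what compares a density with its two translates by opposite
  vectors.\<close>

lemma hessian_upper_midpoint: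
  assumes S: "\<And>y. y \<in> Rsp d \<Longrightarrow> \<exists>H. has_hessian d f y H \<and> loewner_le d H (scaled_id c)"
    and R: "x \<in> Rsp d" and v: "v \<in> Rsp d" "enorm d v = 1"
  shows "f (\<lambda>i. x i + s * v i) + f (\<lambda>i. x i - s * v i) - 2 * f x \<le> c * s\<^sup>2"
proof -
  have mem: "(\<lambda>i. x i + s * v i) \<in> Rsp d" for s using R v by (simp add: in_Rsp)
  define \<phi> where "\<phi> = (\<lambda>s. f (\<lambda>i. x i + s * v i))"
  have "\<exists>q. (deriv \<phi> has_real_derivative q) (at s) \<and> q \<le> c \<and> (\<phi> has_real_derivative deriv \<phi> s) (at s)" for s
  proof -
    obtain H where H: "has_hessian d f (\<lambda>i. x i + s * v i) H" "loewner_le d H (scaled_id c)"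
      using S[OF mem] by blast
    have "(\<Sum>i<d. \<Sum>j<d. v i * H i j * v j) \<le> c * (enorm d v)\<^sup>2"
      using H(2) v(1) unfolding loewner_le_def loewner_scaled_id by blast
    then have "(\<Sum>i<d. \<Sum>j<d. v i * H i j * v j) \<le> c" using v(2) by simp
    then show ?thesis
      using has_hessian_line[OF R v(1) _ H(1)] v(2) unfolding \<phi>_def by auto
  qed
  then obtain q where q: "\<And>s. (deriv \<phi> has_real_derivative q s) (at s)"
      "\<And>s. q s \<le> c" "\<And>s. (\<phi> has_real_derivative deriv \<phi> s) (at s)"
    by metis
  have "convex_on UNIV (\<lambda>s. c / 2 * s\<^sup>2 - \<phi> s)"
  proof (rule f''_ge0_imp_convex[where f' = "\<lambda>s. c * s - deriv \<phi> s" and f'' = "\<lambda>s. c - q s"])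
    fix s :: real
    show "((\<lambda>s. c / 2 * s\<^sup>2 - \<phi> s) has_real_derivative c * s - deriv \<phi> s) (at s)"
      by (auto intro!: derivative_eq_intros q(3))
    show "((\<lambda>s. c * s - deriv \<phi> s) has_real_derivative c - q s) (at s)"
      by (auto intro!: derivative_eq_intros q(1))
    show "0 \<le> c - q s" using q(2) by simp
  qed simp
  from convex_onD[OF this, of "1/2" "-s" s]
  have "\<phi> s + \<phi> (-s) - 2 * \<phi> 0 \<le> c * s\<^sup>2" by (simp add: field_simps)
  then show ?thesis by (simp add: \<phi>_def)
qed

subsection \<open>The core of a weakly log-concave density\<close>

text \<open>An identity, not just an inequality: it lets the Gaussian factor add exactly
  \<open>1 / s^2\<close> to the convexity constant \<alpha>.\<close>

lemma parallelogram_mid: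
  "(edist d z (\<lambda>i. (x i + y i) / 2))\<^sup>2 = ((edist d z x)\<^sup>2 + (edist d z y)\<^sup>2) / 2 - (edist d x y)\<^sup>2 / 4"
proof -
  have "(z i - (x i + y i) / 2)\<^sup>2 = ((z i - x i)\<^sup>2 + (z i - y i)\<^sup>2) / 2 - (x i - y i)\<^sup>2 / 4" for i
    by (simp add: power2_eq_square field_simps)
  then show ?thesis
    by (simp add: edist_power2 sum_subtractf sum.distrib flip: sum_divide_distrib)
qed

text \<open>A convex function may jump at the boundary of its domain, so strong convexity is only available
  on the core of the set where \<^term>\<open>p\<close> is positive; the rest of that set is a null set.\<close>

lemma decomp_core:
  assumes p: "prob_density_on d p" and w: "weak_log_concave_decomp d \<alpha> \<beta> K p u a"
  defines "S \<equiv> rcore d {x \<in> Rsp d. p x \<noteq> 0}"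
  shows "S \<subseteq> Rsp d" "S \<in> sets (Rborel d)" "rconvex d S"
    "emeasure (Rlebesgue d) ({x \<in> Rsp d. p x \<noteq> 0} - S) = 0"
    "\<And>x. x \<in> S \<Longrightarrow> p x = exp (- real_of_ereal (u x) + a x)"
    "\<And>x y. x \<in> S \<Longrightarrow> y \<in> S \<Longrightarrow> real_of_ereal (u (\<lambda>i. (x i + y i) / 2)) \<le>
        (real_of_ereal (u x) + real_of_ereal (u y)) / 2 - \<alpha> / 8 * (edist d x y)\<^sup>2"
proof -
  define D where "D = {x \<in> Rsp d. p x \<noteq> 0}"
  have pm: "p \<in> borel_measurable (Rborel d)" and pi: "(\<integral>\<^sup>+x. ennreal (p x) \<partial>Rlebesgue d) = 1"
    using p by (auto simp: prob_density_on_def)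
  have pu: "p x = (if u x = \<infinity> then 0 else exp (- real_of_ereal (u x) + a x))" if "x \<in> Rsp d" for x
    using w that by (auto simp: weak_log_concave_decomp_def)
  have cvx: "ereal_convex d u" using w by (auto simp: weak_log_concave_decomp_def)
  have D_iff: "x \<in> D \<longleftrightarrow> x \<in> Rsp d \<and> u x \<noteq> \<infinity>" for x
    using pu by (auto simp: D_def)
  have DR: "D \<subseteq> Rsp d" by (auto simp: D_def)
  have Dc: "rconvex d D"
    unfolding rconvex_def
  proof (intro conjI ballI allI impI DR)
    fix x y and s :: real assume xy: "x \<in> D" "y \<in> D" and s: "0 < s" "s < 1"
    have "u x \<noteq> -\<infinity>" "u y \<noteq> -\<infinity>" using cvx xy DR by (auto simp: ereal_convex_def)
    then obtain b c where "u x = ereal b" "u y = ereal c"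
      using xy by (cases "u x"; cases "u y") (auto simp: D_iff)
    moreover have "u (\<lambda>i. (1 - s) * x i + s * y i) \<le> ereal (1 - s) * u x + ereal s * u y"
    proof -
      have "s \<in> {0<..<1}" using s by simp
      then show ?thesis
        using cvx subsetD[OF DR xy(1)] subsetD[OF DR xy(2)] unfolding ereal_convex_def by blast
    qed
    ultimately have "u (\<lambda>i. (1 - s) * x i + s * y i) \<noteq> \<infinity>" by auto
    moreover have "(\<lambda>i. (1 - s) * x i + s * y i) \<in> Rsp d" using subsetD[OF DR xy(1)] subsetD[OF DR xy(2)] by (simp add: in_Rsp)
    ultimately show "(\<lambda>i. (1 - s) * x i + s * y i) \<in> D" by (simp add: D_iff)
  qed
  have "D = p -` (- {0}) \<inter> space (Rborel d)" by (auto simp: D_def)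
  also have "\<dots> \<in> sets (Rborel d)" using pm by (rule measurable_sets) simp
  finally have Dm: "D \<in> sets (Rborel d)" .
  have Dnz: "emeasure (Rlebesgue d) D \<noteq> 0"
  proof
    assume "emeasure (Rlebesgue d) D = 0"
    then have "AE x in Rlebesgue d. x \<notin> D"
      using Dm by (intro AE_not_in) (auto simp: null_sets_def)
    then have "(\<integral>\<^sup>+x. ennreal (p x) \<partial>Rlebesgue d) = (\<integral>\<^sup>+x. 0 \<partial>Rlebesgue d)"
      by (intro nn_integral_cong_AE) (auto simp: D_def)
    then show False using pi by simp
  qed
  have S: "S = rcore d D" by (simp add: S_def D_def)
  have SD: "S \<subseteq> D" unfolding S by (rule rcore_subset)
  then show "S \<subseteq> Rsp d" using DR by auto
  have So: "openin (Euclidean_space d) S" unfolding S by (rule openin_rcore[OF DR])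
  then show "S \<in> sets (Rborel d)" by (rule openin_Rborel)
  show Sc: "rconvex d S" unfolding S by (rule rconvex_rcore[OF Dc])
  show "emeasure (Rlebesgue d) ({x \<in> Rsp d. p x \<noteq> 0} - S) = 0"
    using emeasure_rcore[OF Dc Dm Dnz] unfolding S D_def .
  show "p x = exp (- real_of_ereal (u x) + a x)" if "x \<in> S" for x
    using pu[of x] D_iff[of x] SD that by auto
  have "S \<subseteq> Euclidean_space d closure_of D"
    using SD closure_of_subset[OF DR] by auto
  \<comment> \<open>The core is open and contained in the closure of the positivity set, hence in
    the interior of that closure, which is where the Hessian bound is given.\<close>
  then have Si: "S \<subseteq> support_interior d p"
    using So unfolding support_interior_def D_def by (intro interior_of_maximal)
  obtain H where H: "\<And>x. x \<in> support_interior d p \<Longrightarrow> has_hessian d (\<lambda>x. real_of_ereal (u x)) x (H x)"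
    using w unfolding weak_log_concave_decomp_def C2_on_def by blast
  have ex: "\<exists>H. has_hessian d (\<lambda>x. real_of_ereal (u x)) y H \<and> loewner_le d (scaled_id \<alpha>) H" if "y \<in> S" for y
    using H[of y] Si that w unfolding weak_log_concave_decomp_def by blast
  show "real_of_ereal (u (\<lambda>i. (x i + y i) / 2)) \<le>
        (real_of_ereal (u x) + real_of_ereal (u y)) / 2 - \<alpha> / 8 * (edist d x y)\<^sup>2" if "x \<in> S" "y \<in> S" for x y
    by (rule hessian_lower_midpoint[OF Sc ex that])
qed


subsection \<open>Exponential moments and variance of the tilted measure\<close>

lemma continuous_on_edist: "continuous_on A (\<lambda>y. edist d x y)"
  unfolding edist_def enorm_def L2_set_def
  by (intro continuous_intros continuous_on_coord continuous_on_sum)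

lemma edist_commute: "edist d x y = edist d y x"
  by (simp add: edist_def enorm_def L2_set_def power2_commute)

lemma measurable_edist [measurable]: "(\<lambda>y. edist d x y) \<in> borel_measurable (Rborel d)"
  unfolding Rborel_def by (intro borel_measurable_continuous_on_restrict continuous_on_edist)

lemma Rlebesgue_translate:
  assumes "t \<in> Rsp d"
  shows "distr (Rlebesgue d) (Rborel d) (\<lambda>y i. y i + t i) = Rlebesgue d"
proof (rule measure_eqI)
  have m: "(\<lambda>y i. y i + t i) \<in> Rborel d \<rightarrow>\<^sub>M Rborel d"
    using assms by (intro measurable_to_Rborel) (auto simp: in_Rsp)
  fix A assume A: "A \<in> sets (distr (Rlebesgue d) (Rborel d) (\<lambda>y i. y i + t i))"
  then have [measurable]: "A \<in> sets (Rborel d)" by simp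
  have "emeasure (distr (Rlebesgue d) (Rborel d) (\<lambda>y i. y i + t i)) A =
      (\<integral>\<^sup>+y. indicator A y \<partial>distr (Rlebesgue d) (Rborel d) (\<lambda>y i. y i + t i))"
    using A by simp
  also have "\<dots> = (\<integral>\<^sup>+y. indicator A (\<lambda>i. y i + t i) \<partial>Rlebesgue d)"
    using m by (intro nn_integral_distr) auto
  also have "\<dots> = (\<integral>\<^sup>+y. indicator A y \<partial>Rlebesgue d)"
    using assms by (subst (2) nn_integral_Rlebesgue_affine[where t=t and c=1]) (auto simp: add.commute)
  finally show "emeasure (distr (Rlebesgue d) (Rborel d) (\<lambda>y i. y i + t i)) A = emeasure (Rlebesgue d) A"
    by simp
qed simp

lemma Rlebesgue_translate_integral:
  fixes f :: "rvec \<Rightarrow> real"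
  assumes t: "t \<in> Rsp d" and f: "integrable (Rlebesgue d) f"
  shows "integrable (Rlebesgue d) (\<lambda>y. f (\<lambda>i. y i + t i))"
    and "(\<integral>y. f (\<lambda>i. y i + t i) \<partial>Rlebesgue d) = (\<integral>y. f y \<partial>Rlebesgue d)"
proof -
  have m: "(\<lambda>y i. y i + t i) \<in> Rlebesgue d \<rightarrow>\<^sub>M Rborel d"
    using t by (simp cong: measurable_cong_sets) (intro measurable_to_Rborel, auto simp: in_Rsp)
  have fm: "f \<in> borel_measurable (Rborel d)"
    using borel_measurable_integrable[OF f] by simp
  show "integrable (Rlebesgue d) (\<lambda>y. f (\<lambda>i. y i + t i))"
    using integrable_distr_eq[OF m fm] f unfolding Rlebesgue_translate[OF t] by simp
  show "(\<integral>y. f (\<lambda>i. y i + t i) \<partial>Rlebesgue d) = (\<integral>y. f y \<partial>Rlebesgue d)"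
    using integral_distr[OF m fm] unfolding Rlebesgue_translate[OF t] by simp
qed

lemma measurable_hoelder:
  assumes "0 < \<beta>" "\<And>x y. x \<in> Rsp d \<Longrightarrow> y \<in> Rsp d \<Longrightarrow> \<bar>a x - a y\<bar> \<le> K * edist d x y powr \<beta>"
  shows "a \<in> borel_measurable (Rborel d)"
  unfolding Rborel_def
proof (rule borel_measurable_continuous_on_restrict)
  show "continuous_on (Rsp d) a"
    unfolding continuous_on_def
  proof
    fix x assume x: "x \<in> Rsp d"
    have "((\<lambda>y. edist d x y) \<longlongrightarrow> edist d x x) (at x within Rsp d)"
      using continuous_on_edist x unfolding continuous_on_def by blast
    then have "((\<lambda>y. edist d x y) \<longlongrightarrow> 0) (at x within Rsp d)"
      using enorm_eq_0[of d "\<lambda>i. 0"] by (simp add: edist_def)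
    then have "((\<lambda>y. edist d x y powr \<beta>) \<longlongrightarrow> 0) (at x within Rsp d)"
      by (rule tendsto_zero_powrI[where b=\<beta>]) (use assms(1) in simp_all)
    from tendsto_mult_left[OF this, of K]
    have lim: "((\<lambda>y. K * edist d x y powr \<beta>) \<longlongrightarrow> 0) (at x within Rsp d)"
      by simp
    have "\<forall>\<^sub>F y in at x within Rsp d. norm (a y - a x) \<le> K * edist d x y powr \<beta>"
      unfolding eventually_at_filter
      by (intro always_eventually allI impI) (use assms(2)[OF x] in \<open>simp add: abs_minus_commute\<close>)
    from Lim_null_comparison[OF this lim]
    show "(a \<longlongrightarrow> a x) (at x within Rsp d)" by (rule LIM_zero_cancel)
  qed
qed

text \<open>Up to normalization, \<open>p W\<close> is the density of the posterior law of \<open>m\<^sub>t(Z)\<close> with the Hoelder perturbation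
  \<open>exp a\<close> removed; its potential \<open>V\<close> is strongly convex with constant \<open>lam\<close>.\<close>

locale tilted_wlc =
  fixes d :: nat and p :: "rvec \<Rightarrow> real" and u :: "rvec \<Rightarrow> ereal" and a :: "rvec \<Rightarrow> real"
    and \<alpha> \<beta> K s :: real and x :: rvec
  assumes dens: "prob_density_on d p" and decomp: "weak_log_concave_decomp d \<alpha> \<beta> K p u a"
    and x: "x \<in> Rsp d" and s: "0 < s"
begin

definition S :: "rvec set" where "S = rcore d {x \<in> Rsp d. p x \<noteq> 0}"

definition V :: "rvec \<Rightarrow> real" where
  "V y = real_of_ereal (u y) + (edist d x y)\<^sup>2 / (2 * s\<^sup>2)"

definition W :: "rvec \<Rightarrow> real" where
  "W y = exp (- a y - (edist d x y)\<^sup>2 / (2 * s\<^sup>2))"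

definition lam :: real where "lam = \<alpha> + 1 / s\<^sup>2"

lemma params: "0 < \<alpha>" "0 < K" "0 < \<beta>" "\<beta> \<le> 1"
  using decomp by (auto simp: weak_log_concave_decomp_def)

lemma lam_pos: "0 < lam"
  using params s by (simp add: lam_def add_pos_pos)

lemma hoelder: "y \<in> Rsp d \<Longrightarrow> z \<in> Rsp d \<Longrightarrow> \<bar>a y - a z\<bar> \<le> K * edist d y z powr \<beta>"
  using decomp by (simp add: weak_log_concave_decomp_def)

lemma measurable_a [measurable]: "a \<in> borel_measurable (Rborel d)"
  by (rule measurable_hoelder[OF params(3) hoelder])

lemma measurable_p [measurable]: "p \<in> borel_measurable (Rborel d)"
  using dens by (simp add: prob_density_on_def)

lemma p_nonneg: "y \<in> Rsp d \<Longrightarrow> 0 \<le> p y"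
  using dens by (simp add: prob_density_on_def)

lemma measurable_W [measurable]: "W \<in> borel_measurable (Rborel d)"
  unfolding W_def by measurable

lemmas core = decomp_core[OF dens decomp, folded S_def]

lemma measurable_S [measurable]: "S \<in> sets (Rborel d)"
  by (rule core(2))

lemma p_W: "y \<in> S \<Longrightarrow> p y * W y = exp (- V y)"
  by (simp add: core(5) W_def V_def exp_add[symmetric])

lemma V_mid:
  assumes "y \<in> S" "z \<in> S"
  shows "V (\<lambda>i. (y i + z i) / 2) \<le> (V y + V z) / 2 - lam / 8 * (edist d y z)\<^sup>2"
proof -
  have "((b + c) / 2 - e / 4) / (2 * s\<^sup>2) = (b / (2 * s\<^sup>2) + c / (2 * s\<^sup>2)) / 2 - (1 / s\<^sup>2) / 8 * e" for b c e
    using s by (simp add: field_simps)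
  then show ?thesis
    using core(6)[OF assms] unfolding V_def parallelogram_mid lam_def by (simp add: distrib_right add_divide_distrib)
qed

lemma p_S: "AE y in Rlebesgue d. y \<in> S \<or> p y = 0"
proof -
  have "{y \<in> space (Rborel d). p y \<noteq> 0} \<in> sets (Rborel d)"
    by measurable
  then have "{y \<in> Rsp d. p y \<noteq> 0} - S \<in> null_sets (Rlebesgue d)"
    using core(4) by (simp add: null_sets_def)
  then have "AE y in Rlebesgue d. y \<notin> {y \<in> Rsp d. p y \<noteq> 0} - S"
    by (rule AE_not_in)
  then show ?thesis
    using AE_space[of "Rlebesgue d"] by eventually_elim auto
qed

lemma exp_moment:
  assumes [measurable]: "\<phi> \<in> borel_measurable (Rborel d)"
    and c: "\<And>y z. y \<in> S \<Longrightarrow> z \<in> S \<Longrightarrow> (\<phi> y - \<phi> z) / 2 - lam / 8 * (edist d y z)\<^sup>2 \<le> c"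
  shows "(\<integral>\<^sup>+y. ennreal (p y) * ennreal (exp (\<phi> y) * W y) \<partial>Rlebesgue d) *
      (\<integral>\<^sup>+y. ennreal (p y) * ennreal (exp (- \<phi> y) * W y) \<partial>Rlebesgue d)
    \<le> (ennreal (exp c) * (\<integral>\<^sup>+y. ennreal (p y) * ennreal (W y) \<partial>Rlebesgue d))\<^sup>2"
proof -
  \<comment> \<open>Cutting off outside \<open>S\<close> confines the pointwise inequality to the
    set where strong convexity holds; by \<open>p_S\<close> the integrals do not change.\<close>
  define F where "F \<psi> y = ennreal (exp (\<psi> y) * p y * W y) * indicator S y" for \<psi> :: "rvec \<Rightarrow> real" and y
  have e: "(\<integral>\<^sup>+y. ennreal (p y) * ennreal (exp (\<psi> y) * W y) \<partial>Rlebesgue d) = (\<integral>\<^sup>+y. F \<psi> y \<partial>Rlebesgue d)" for \<psi>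
  proof (rule nn_integral_cong_AE)
    have "AE y in Rlebesgue d. y \<in> Rsp d" using AE_space[of "Rlebesgue d"] by simp
    then show "AE y in Rlebesgue d. ennreal (p y) * ennreal (exp (\<psi> y) * W y) = F \<psi> y"
      using p_S
    proof eventually_elim
      case (elim y)
      then show ?case
        using p_nonneg[of y] by (cases "y \<in> S") (auto simp: F_def W_def ennreal_mult[symmetric] mult_ac)
    qed
  qed
  have m: "F \<psi> \<in> borel_measurable (Rborel d)" if [measurable]: "\<psi> \<in> borel_measurable (Rborel d)" for \<psi>
    unfolding F_def by measurable
  have "(\<integral>\<^sup>+y. F \<phi> y \<partial>Rlebesgue d) * (\<integral>\<^sup>+y. F (\<lambda>y. - \<phi> y) y \<partial>Rlebesgue d) \<le> (\<integral>\<^sup>+y. F (\<lambda>_. c) y \<partial>Rlebesgue d)\<^sup>2"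
  proof (rule prekopa_leindler)
    fix y z assume yz: "y \<in> Rsp d" "z \<in> Rsp d"
    show "F \<phi> y * F (\<lambda>y. - \<phi> y) z \<le> (F (\<lambda>_. c) (\<lambda>i. (y i + z i) / 2))\<^sup>2"
    proof (cases "y \<in> S \<and> z \<in> S")
      case True
      then have mid: "(\<lambda>i. (y i + z i) / 2) \<in> S"
        using rconvexD[OF core(3), of y z "1/2"] by (simp add: field_simps)
      have F: "F \<psi> w = ennreal (exp (\<psi> w - V w))" if "w \<in> S" for \<psi> w
        using p_W[OF that] that by (simp add: F_def mult.assoc exp_add[symmetric])
      have "\<phi> y - V y + (- \<phi> z - V z) \<le> 2 * (c - V (\<lambda>i. (y i + z i) / 2))"
        using c[of y z] V_mid[of y z] True by argo
      then have "exp (\<phi> y - V y) * exp (- \<phi> z - V z) \<le> (exp (c - V (\<lambda>i. (y i + z i) / 2)))\<^sup>2"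
        by (simp add: exp_add[symmetric] exp_double[symmetric])
      then show ?thesis
        using True mid by (simp add: F ennreal_mult[symmetric] ennreal_power)
    next
      case False
      then have "F \<phi> y * F (\<lambda>y. - \<phi> y) z = 0" by (auto simp: F_def)
      then show ?thesis by (simp only: zero_le)
    qed
  qed (auto intro: m)
  also have "(\<integral>\<^sup>+y. F (\<lambda>_. c) y \<partial>Rlebesgue d) = ennreal (exp c) * (\<integral>\<^sup>+y. F (\<lambda>_. 0) y \<partial>Rlebesgue d)"
  proof -
    have "F (\<lambda>_. c) y = ennreal (exp c) * F (\<lambda>_. 0) y" for y
      by (simp add: F_def ennreal_mult' mult.assoc)
    moreover have "F (\<lambda>_. 0) \<in> borel_measurable (Rlebesgue d)"
      using m[of "\<lambda>_. 0"] by (simp cong: measurable_cong_sets)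
    ultimately show ?thesis by (simp add: nn_integral_cmult)
  qed
  finally show ?thesis
    using e[of "\<lambda>_. 0"] by (simp add: e)
qed

text \<open>A Cramer-Rao bound without derivatives: the densities \<open>exp (- V)\<close> shifted by \<open>\<plusminus> e h\<close> have Hellinger
  affinity at least \<open>exp (- L e\<^sup>2 / 2)\<close>, while the means of \<open>h \<bullet> y\<close> under them differ by \<open>2 e\<close>, which
  forces the variance of \<open>h \<bullet> y\<close> to be at least \<open>1 / L - e\<^sup>2\<close>.\<close>

lemma variance_lower:
  assumes A: "hessian_le_everywhere d u A" and h: "h \<in> Rsp d" "enorm d h = 1"
    and intW: "integrable (Rlebesgue d) (\<lambda>y. p y * W y)"
    and intT: "integrable (Rlebesgue d) (\<lambda>y. ((\<Sum>i<d. h i * y i) - m) * (p y * W y))"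
    and intT2: "integrable (Rlebesgue d) (\<lambda>y. ((\<Sum>i<d. h i * y i) - m)\<^sup>2 * (p y * W y))"
    and mean: "(\<integral>y. ((\<Sum>i<d. h i * y i) - m) * (p y * W y) \<partial>Rlebesgue d) = 0"
    and pos: "0 < (\<integral>y. p y * W y \<partial>Rlebesgue d)"
  shows "0 < A + 1 / s\<^sup>2"
    and "(\<integral>y. p y * W y \<partial>Rlebesgue d) \<le>
      (A + 1 / s\<^sup>2) * (\<integral>y. ((\<Sum>i<d. h i * y i) - m)\<^sup>2 * (p y * W y) \<partial>Rlebesgue d)"
proof -
  define E where "E y = p y * W y" for y
  define T where "T y = (\<Sum>i<d. h i * y i) - m" for y
  define N where "N = (\<integral>y. E y \<partial>Rlebesgue d)"
  define Q where "Q = (\<integral>y. (T y)\<^sup>2 * E y \<partial>Rlebesgue d)"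
  define L where "L = A + 1 / s\<^sup>2"
  have i0: "integrable (Rlebesgue d) E" and i1: "integrable (Rlebesgue d) (\<lambda>y. T y * E y)"
    and i2: "integrable (Rlebesgue d) (\<lambda>y. (T y)\<^sup>2 * E y)"
    using intW intT intT2 by (simp_all add: E_def[abs_def] T_def)
  have mean0: "(\<integral>y. T y * E y \<partial>Rlebesgue d) = 0" using mean by (simp add: E_def T_def)
  have fin: "u y \<noteq> \<infinity>" if "y \<in> Rsp d" for y
    using A that by (simp add: hessian_le_everywhere_def)
  \<comment> \<open>The Hessian bound on the whole space makes \<open>u\<close> finite, so this
    holds at every point and the translates below can be compared everywhere.\<close>
  have EV: "E y = exp (- V y)" if "y \<in> Rsp d" for y
    using decomp fin[OF that] that
    by (simp add: weak_log_concave_decomp_def E_def W_def V_def exp_add[symmetric])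
  have h2: "(\<Sum>i<d. h i * h i) = 1"
    using enorm_power2[of d h] h(2) by (simp add: power2_eq_square)
  have Th: "T (\<lambda>i. y i + r * h i) = T y + r" for y r
  proof -
    have "(\<Sum>i<d. h i * (y i + r * h i)) = (\<Sum>i<d. h i * y i) + r * (\<Sum>i<d. h i * h i)"
      by (simp add: sum_distrib_left sum.distrib distrib_left mult.left_commute)
    then show ?thesis by (simp add: T_def h2)
  qed
  have V2: "V (\<lambda>i. y i + r * h i) + V (\<lambda>i. y i - r * h i) - 2 * V y \<le> L * r\<^sup>2" if y: "y \<in> Rsp d" for y r
  proof -
    have 1: "real_of_ereal (u (\<lambda>i. y i + r * h i)) + real_of_ereal (u (\<lambda>i. y i - r * h i)) - 2 * real_of_ereal (u y) \<le> A * r\<^sup>2"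
      by (rule hessian_upper_midpoint[OF _ y h]) (use A in \<open>auto simp: hessian_le_everywhere_def\<close>)
    have "(x i - (y i + r * h i))\<^sup>2 + (x i - (y i - r * h i))\<^sup>2 - 2 * (x i - y i)\<^sup>2 = 2 * r\<^sup>2 * (h i * h i)" for i
      by (simp add: power2_eq_square algebra_simps)
    then have "(\<Sum>i<d. (x i - (y i + r * h i))\<^sup>2 + (x i - (y i - r * h i))\<^sup>2 - 2 * (x i - y i)\<^sup>2) = 2 * r\<^sup>2 * (\<Sum>i<d. h i * h i)"
      by (simp only: sum_distrib_left)
    then have "(edist d x (\<lambda>i. y i + r * h i))\<^sup>2 + (edist d x (\<lambda>i. y i - r * h i))\<^sup>2 - 2 * (edist d x y)\<^sup>2 = 2 * r\<^sup>2"
      by (simp add: edist_power2 sum.distrib sum_subtractf sum_distrib_left h2)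
    then have "((edist d x (\<lambda>i. y i + r * h i))\<^sup>2 + (edist d x (\<lambda>i. y i - r * h i))\<^sup>2 - 2 * (edist d x y)\<^sup>2) / (2 * s\<^sup>2) = r\<^sup>2 / s\<^sup>2"
      by simp
    then show ?thesis using 1 unfolding V_def L_def
      by (simp add: add_divide_distrib diff_divide_distrib distrib_right)
  qed
  have shift: "integrable (Rlebesgue d) (\<lambda>y. (T y)^n * E (\<lambda>i. y i + - r * h i))"
      "(\<integral>y. (T y)^n * E (\<lambda>i. y i + - r * h i) \<partial>Rlebesgue d) = (\<integral>y. (T y + r)^n * E y \<partial>Rlebesgue d)"
    if i: "integrable (Rlebesgue d) (\<lambda>y. (T y + r)^n * E y)" for n and r :: real
  proof -
    have R: "(\<lambda>i. - r * h i) \<in> Rsp d" using h by (simp add: in_Rsp)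
    have e: "(T (\<lambda>i. y i + - r * h i) + r)^n = (T y)^n" for y
      by (simp only: Th) simp
    show "integrable (Rlebesgue d) (\<lambda>y. (T y)^n * E (\<lambda>i. y i + - r * h i))"
      using Rlebesgue_translate_integral(1)[OF R i] by (simp only: e)
    show "(\<integral>y. (T y)^n * E (\<lambda>i. y i + - r * h i) \<partial>Rlebesgue d) = (\<integral>y. (T y + r)^n * E y \<partial>Rlebesgue d)"
      using Rlebesgue_translate_integral(2)[OF R i] by (simp only: e)
  qed
  have sq: "(T y + r)\<^sup>2 * E y = (T y)\<^sup>2 * E y + (2 * r * (T y * E y) + r\<^sup>2 * E y)" for y r
    by (simp add: power2_eq_square algebra_simps)
  have j0: "integrable (Rlebesgue d) (\<lambda>y. (T y + r)^0 * E y)" and j1: "integrable (Rlebesgue d) (\<lambda>y. (T y + r)^1 * E y)"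
    and j2: "integrable (Rlebesgue d) (\<lambda>y. (T y + r)^2 * E y)" for r
    using i0 i1 i2 by (simp_all add: sq distrib_right)
  have k0: "(\<integral>y. (T y + r)^0 * E y \<partial>Rlebesgue d) = N" for r by (simp add: N_def)
  have k1: "(\<integral>y. (T y + r)^1 * E y \<partial>Rlebesgue d) = r * N" for r
    using i0 i1 mean0 by (simp add: distrib_right N_def)
  have k2: "(\<integral>y. (T y + r)^2 * E y \<partial>Rlebesgue d) = Q + r\<^sup>2 * N" for r
    unfolding sq using i0 i1 i2 mean0 by (simp add: N_def Q_def)
  \<comment> \<open>\<open>e\<close> is the shift and \<open>k\<close> a free weight. Keeping
    \<open>k\<close> free avoids dividing by \<open>L\<close>, whose sign is not known yet; after
    \<open>e\<close> tends to 0, the choice \<open>k = 1 / L\<close> gives the claim.\<close>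
  have main: "2 * N \<le> k * L * N + (Q + e\<^sup>2 * N) / k" if "0 < e" "0 < k" for e k
  proof -
    define P1 where "P1 y = E (\<lambda>i. y i + - e * h i)" for y
    define P2 where "P2 y = E (\<lambda>i. y i + - (- e) * h i)" for y
    \<comment> \<open>The means differ by \<open>2 * e\<close> while one minus the affinity is of
      order \<open>e^2\<close>; a weight of order \<open>1 / e\<close> leaves exactly one factor
      \<open>e\<close> in every term, which then cancels.\<close>
    define c where "c = 2 * k / e"
    have c: "0 < c" using that by (simp add: c_def)
    define q where "q = exp (- (L * e\<^sup>2) / 2)"
    note sh1 = shift[of e, folded P1_def] and sh2 = shift[of "-e", folded P2_def]
    have ints: "integrable (Rlebesgue d) P1" "integrable (Rlebesgue d) P2"
       "integrable (Rlebesgue d) (\<lambda>y. T y * P1 y)" "integrable (Rlebesgue d) (\<lambda>y. T y * P2 y)"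
       "integrable (Rlebesgue d) (\<lambda>y. (T y)\<^sup>2 * P1 y)" "integrable (Rlebesgue d) (\<lambda>y. (T y)\<^sup>2 * P2 y)"
      using sh1(1)[OF j0] sh1(1)[OF j1] sh1(1)[OF j2] sh2(1)[OF j0] sh2(1)[OF j1] sh2(1)[OF j2] by simp_all
    have vals: "(\<integral>y. P1 y \<partial>Rlebesgue d) = N" "(\<integral>y. P2 y \<partial>Rlebesgue d) = N"
       "(\<integral>y. T y * P1 y \<partial>Rlebesgue d) = e * N" "(\<integral>y. T y * P2 y \<partial>Rlebesgue d) = - e * N"
       "(\<integral>y. (T y)\<^sup>2 * P1 y \<partial>Rlebesgue d) = Q + e\<^sup>2 * N" "(\<integral>y. (T y)\<^sup>2 * P2 y \<partial>Rlebesgue d) = Q + e\<^sup>2 * N"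
      using sh1(2)[OF j0] sh1(2)[OF j1] sh1(2)[OF j2] sh2(2)[OF j0] sh2(2)[OF j1] sh2(2)[OF j2]
        k0[of e] k0[of "-e"] k1[of e] k1[of "-e"] k2[of e] k2[of "-e"] by simp_all
    \<comment> \<open>With \<open>a1\<close>, \<open>a2\<close> the square roots of the two
      translated densities, \<open>a1^2 - a2^2 = (a1 - a2) * (a1 + a2)\<close>. The weighted
      arithmetic-geometric inequality separates a Hellinger distance from second moments, and
      \<open>a1 * a2 \<ge> q * E y\<close> bounds the distance.\<close>
    have pw: "T y * P1 y - T y * P2 y \<le> c / 2 * (P1 y + P2 y - 2 * q * E y) + 1 / c * ((T y)\<^sup>2 * P1 y + (T y)\<^sup>2 * P2 y)"
      if y: "y \<in> Rsp d" for y
    proof -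
      have R: "(\<lambda>i. y i + - e * h i) \<in> Rsp d" "(\<lambda>i. y i + - (- e) * h i) \<in> Rsp d"
        using y h by (simp_all add: in_Rsp)
      define a1 where "a1 = exp (- V (\<lambda>i. y i + - e * h i) / 2)"
      define a2 where "a2 = exp (- V (\<lambda>i. y i + - (- e) * h i) / 2)"
      have P: "P1 y = a1\<^sup>2" "P2 y = a2\<^sup>2"
        unfolding P1_def P2_def EV[OF R(1)] EV[OF R(2)] a1_def a2_def
        by (simp_all flip: exp_double)
      have "q * E y = exp (- V y - L * e\<^sup>2 / 2)"
        unfolding EV[OF y] q_def by (simp add: exp_add[symmetric])
      also have "\<dots> \<le> a1 * a2"
        unfolding a1_def a2_def exp_add[symmetric] using V2[OF y, of e] by simp
      finally have 1: "q * E y \<le> a1 * a2" .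
      have "T y * (a1\<^sup>2 - a2\<^sup>2) = (a1 - a2) * (T y * (a1 + a2))" by (simp add: power2_eq_square algebra_simps)
      also have "\<dots> \<le> c / 2 * (a1 - a2)\<^sup>2 + 1 / (2 * c) * (T y * (a1 + a2))\<^sup>2"
      proof -
        have "0 \<le> (c * X - Y)\<^sup>2 / (2 * c)" for X Y using c by simp
        moreover have "(c * X - Y)\<^sup>2 / (2 * c) = c / 2 * X\<^sup>2 + 1 / (2 * c) * Y\<^sup>2 - X * Y" for X Y
          using c by (simp add: power2_diff power_mult_distrib field_simps power2_eq_square)
        ultimately show ?thesis by (metis diff_ge_0_iff_ge)
      qed
      also have "\<dots> \<le> c / 2 * (a1\<^sup>2 + a2\<^sup>2 - 2 * (q * E y)) + 1 / (2 * c) * (2 * ((T y)\<^sup>2 * a1\<^sup>2 + (T y)\<^sup>2 * a2\<^sup>2))"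
      proof (intro add_mono mult_left_mono)
        show "(a1 - a2)\<^sup>2 \<le> a1\<^sup>2 + a2\<^sup>2 - 2 * (q * E y)" using 1 by (simp add: power2_diff)
        have "(a1 + a2)\<^sup>2 \<le> 2 * (a1\<^sup>2 + a2\<^sup>2)"
          using zero_le_power2[of "a1 - a2"] by (simp add: power2_sum power2_diff)
        then have "(T y)\<^sup>2 * (a1 + a2)\<^sup>2 \<le> (T y)\<^sup>2 * (2 * (a1\<^sup>2 + a2\<^sup>2))" by (rule mult_left_mono) simp
        then show "(T y * (a1 + a2))\<^sup>2 \<le> 2 * ((T y)\<^sup>2 * a1\<^sup>2 + (T y)\<^sup>2 * a2\<^sup>2)"
          unfolding power_mult_distrib by (simp add: distrib_left mult.left_commute)
      qed (use c in auto)
      finally show ?thesis using c by (simp add: P algebra_simps)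
    qed
    have "2 * e * N = (\<integral>y. T y * P1 y - T y * P2 y \<partial>Rlebesgue d)"
      using ints vals by simp
    also have "\<dots> \<le>
        (\<integral>y. c / 2 * (P1 y + P2 y - 2 * q * E y) + 1 / c * ((T y)\<^sup>2 * P1 y + (T y)\<^sup>2 * P2 y) \<partial>Rlebesgue d)"
      using ints i0 by (intro integral_mono pw) auto
    also have "\<dots> = c / 2 * (N + N - 2 * q * N) + 1 / c * ((Q + e\<^sup>2 * N) + (Q + e\<^sup>2 * N))"
      using ints i0 vals by (simp add: N_def[symmetric])
    also have "\<dots> = c * N * (1 - q) + 2 / c * (Q + e\<^sup>2 * N)"
    proof -
      have "c / 2 * (N + N - 2 * q * N) = c * N * (1 - q)" by (simp add: algebra_simps)
      moreover have "1 / c * (X + X) = 2 / c * X" for X by simp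
      ultimately show ?thesis by presburger
    qed
    also have "\<dots> \<le> c * N * (L * e\<^sup>2 / 2) + 2 / c * (Q + e\<^sup>2 * N)"
      using exp_ge_add_one_self[of "- (L * e\<^sup>2) / 2"] c pos
      by (intro add_right_mono mult_left_mono) (auto simp: q_def N_def E_def)
    also have "\<dots> = e * (k * L * N + (Q + e\<^sup>2 * N) / k)"
    proof -
      have "c * e\<^sup>2 / 2 = e * k" and "2 / c = e / k"
        using that by (simp_all add: c_def power2_eq_square)
      have "c * N * (L * e\<^sup>2 / 2) = (c * e\<^sup>2 / 2) * (L * N)" by (simp add: mult_ac)
      also have "\<dots> = e * (k * L * N)" unfolding \<open>c * e\<^sup>2 / 2 = e * k\<close> by (simp add: mult_ac)
      finally have "c * N * (L * e\<^sup>2 / 2) = e * (k * L * N)" .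
      moreover have "2 / c * (Q + e\<^sup>2 * N) = e * ((Q + e\<^sup>2 * N) / k)"
        unfolding \<open>2 / c = e / k\<close> by simp
      ultimately show ?thesis unfolding distrib_left[of e] by simp
    qed
    finally have "e * (2 * N) \<le> e * (k * L * N + (Q + e\<^sup>2 * N) / k)" by simp
    then show ?thesis using that by simp
  qed
  have lim: "2 * N \<le> k * L * N + Q / k" if k: "0 < k" for k
  proof (rule tendsto_lowerbound)
    have "isCont (\<lambda>e. k * L * N + (Q + e\<^sup>2 * N) / k) 0" using k by simp
    then have "((\<lambda>e. k * L * N + (Q + e\<^sup>2 * N) / k) \<longlongrightarrow> k * L * N + (Q + 0\<^sup>2 * N) / k) (at_right 0)"
      unfolding isCont_def by (rule tendsto_within_subset) simp
    then show "((\<lambda>e. k * L * N + (Q + e\<^sup>2 * N) / k) \<longlongrightarrow> k * L * N + Q / k) (at_right 0)"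
      by simp
    show "\<forall>\<^sub>F e in at_right 0. 2 * N \<le> k * L * N + (Q + e\<^sup>2 * N) / k"
    proof (rule eventually_at_rightI)
      fix e :: real assume "e \<in> {0<..<1}"
      then show "2 * N \<le> k * L * N + (Q + e\<^sup>2 * N) / k" using k by (intro main) auto
    qed simp
  qed simp
  have N: "0 < N" using pos by (simp add: N_def E_def)
  have Q: "0 \<le> Q"
  proof -
    have "AE y in Rlebesgue d. 0 \<le> (T y)\<^sup>2 * E y"
      using AE_space[of "Rlebesgue d"] by eventually_elim (simp add: EV)
    then show ?thesis unfolding Q_def by (rule integral_nonneg_AE)
  qed
  have "0 < L"
  proof (rule ccontr)
    assume "\<not> 0 < L"
    then have *: "2 * N \<le> Q / k" if "0 < k" for k
    proof -
      have "0 \<le> k * N" using that N by simp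
      then have "k * N * L \<le> 0" using \<open>\<not> 0 < L\<close> by (intro mult_nonneg_nonpos) auto
      moreover have "k * L * N = k * N * L" by simp
      ultimately show ?thesis using lim[OF that] by linarith
    qed
    \<comment> \<open>This particular \<open>k\<close> makes \<open>Q / k\<close> at most
      \<open>N\<close>, against \<open>2 * N \<le> Q / k\<close>.\<close>
    have "0 < (Q + N) / N" using Q N by (intro divide_pos_pos add_nonneg_pos)
    then have "2 * N \<le> Q / ((Q + N) / N)" by (rule *)
    also have "\<dots> \<le> N"
    proof -
      have "Q * N \<le> N * (Q + N)" using N by (simp add: distrib_left)
      then show ?thesis using Q N by (simp add: pos_divide_le_eq add_nonneg_pos)
    qed
    finally show False using N by simp
  qed
  then show "0 < A + 1 / s\<^sup>2" by (simp add: L_def)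
  have "N \<le> L * Q"
  proof -
    have "0 < 1 / L" using \<open>0 < L\<close> by simp
    moreover have "1 / L * L * N = N" "Q / (1 / L) = L * Q" using \<open>0 < L\<close> by simp_all
    ultimately show ?thesis using lim[of "1 / L"] by linarith
  qed
  then show "(\<integral>y. p y * W y \<partial>Rlebesgue d) \<le>
      (A + 1 / s\<^sup>2) * (\<integral>y. ((\<Sum>i<d. h i * y i) - m)\<^sup>2 * (p y * W y) \<partial>Rlebesgue d)"
    by (simp add: N_def L_def Q_def E_def T_def)
qed

end


subsection \<open>Perturbation of a variance by an exponential tilt\<close>

lemma power_le_fact_exp:
  fixes x :: real
  assumes "0 \<le> x"
  shows "x ^ n \<le> fact n * exp x"
proof -
  have s: "(\<lambda>k. x ^ k /\<^sub>R fact k) sums exp x" by (rule exp_converges)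
  have "(\<Sum>k\<in>{n}. x ^ k /\<^sub>R fact k) \<le> (\<Sum>k. x ^ k /\<^sub>R fact k)"
    using assms by (intro sum_le_suminf sums_summable[OF s]) auto
  then have "x ^ n / fact n \<le> exp x"
    using sums_unique[OF s] by (simp add: divide_inverse mult.commute)
  then show ?thesis by (simp add: pos_divide_le_eq mult.commute)
qed

lemma abs_power_le_exp:
  fixes x :: real
  shows "\<bar>x\<bar> ^ n \<le> fact n * (exp x + exp (- x))"
proof -
  have "\<bar>x\<bar> ^ n \<le> fact n * exp \<bar>x\<bar>" by (rule power_le_fact_exp) simp
  also have "\<dots> \<le> fact n * (exp x + exp (- x))"
    by (intro mult_left_mono) (auto simp: abs_if)
  finally show ?thesis .
qed

text \<open>Writes \<open>exp x + exp (- x) - 2\<close> as the square of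
  \<open>exp (x / 2) - exp (- x / 2)\<close> and uses \<open>sinh y \<ge> y\<close> for
  \<open>y \<ge> 0\<close>. The latter follows from the quadratic Taylor bound because
  \<open>(1 - y + y^2 / 2) * (1 + y + y^2 / 2) = 1 + y^4 / 4\<close>.\<close>

lemma exp_plus_exp_minus_ge:
  fixes x :: real
  shows "2 + x\<^sup>2 \<le> exp x + exp (- x)"
proof -
  have *: "2 * y \<le> exp y - exp (- y)" if "0 \<le> y" for y :: real
  proof -
    have 1: "1 + y + y\<^sup>2 / 2 \<le> exp y" using that by (rule exp_lower_Taylor_quadratic)
    have p: "0 < 1 + y + y\<^sup>2 / 2" using that by (simp add: add_pos_nonneg)
    have "1 \<le> (1 - y + y\<^sup>2 / 2) * (1 + y + y\<^sup>2 / 2)"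
      using zero_le_power2[of "y * y"] by (simp add: power2_eq_square algebra_simps)
    then have "1 / (1 + y + y\<^sup>2 / 2) \<le> 1 - y + y\<^sup>2 / 2" using p by (simp add: pos_divide_le_eq)
    moreover have "exp (- y) \<le> 1 / (1 + y + y\<^sup>2 / 2)"
      using 1 p by (simp add: exp_minus inverse_eq_divide frac_le)
    ultimately show ?thesis using 1 by linarith
  qed
  have "\<bar>x\<bar>\<^sup>2 \<le> (exp (\<bar>x\<bar> / 2) - exp (- (\<bar>x\<bar> / 2)))\<^sup>2"
    using *[of "\<bar>x\<bar> / 2"] by (intro power_mono) auto
  also have "\<dots> = exp \<bar>x\<bar> + exp (- \<bar>x\<bar>) - 2"
    by (simp add: power2_diff exp_double[symmetric] exp_add[symmetric])
  also have "\<dots> = exp x + exp (- x) - 2" by (simp add: abs_if)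
  finally show ?thesis by simp
qed

text \<open>A pointwise stand-in for Hoelder's inequality with exponents 3, 3, 3: a product of three
  factors becomes integrable as soon as their third moments are finite.\<close>

lemma prod3_le_cubes:
  fixes x y z :: real
  assumes "0 \<le> x" "0 \<le> y" "0 \<le> z"
  shows "x * y * z \<le> x ^ 3 + y ^ 3 + z ^ 3"
proof -
  define m where "m = max x (max y z)"
  have "x * y * z \<le> m * m * m"
    using assms by (intro mult_mono) (auto simp: m_def)
  also have "\<dots> = m ^ 3" by (simp add: power3_eq_cube)
  also have "\<dots> \<le> x ^ 3 + y ^ 3 + z ^ 3"
    using assms by (auto simp: m_def max_def)
  finally show ?thesis .
qed

lemma cube_sum_le:
  fixes x y :: real
  assumes "0 \<le> x" "0 \<le> y"
  shows "(x + y) ^ 3 \<le> 4 * (x ^ 3 + y ^ 3)"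
proof -
  have "4 * (x ^ 3 + y ^ 3) - (x + y) ^ 3 = 3 * (x + y) * (x - y)\<^sup>2"
    by (simp add: power2_eq_square power3_eq_cube algebra_simps)
  moreover have "0 \<le> 3 * (x + y) * (x - y)\<^sup>2" using assms by simp
  ultimately show ?thesis by linarith
qed

context prob_space
begin

lemma expectation_exp_ge_1:
  fixes X :: "'a \<Rightarrow> real"
  assumes "integrable M X" "integrable M (\<lambda>z. exp (X z))" "expectation X = 0"
  shows "1 \<le> expectation (\<lambda>z. exp (X z))"
proof -
  have "expectation (\<lambda>z. 1 + X z) \<le> expectation (\<lambda>z. exp (X z))"
    using assms by (intro integral_mono) (auto intro: exp_ge_add_one_self)
  then show ?thesis using assms by (simp add: prob_space)
qed

lemma integrable_power_of_exp:
  fixes X :: "'a \<Rightarrow> real"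
  assumes [measurable]: "random_variable borel X"
    and e: "integrable M (\<lambda>z. exp (X z))" "integrable M (\<lambda>z. exp (- X z))"
  shows "integrable M (\<lambda>z. X z ^ n)" "integrable M (\<lambda>z. \<bar>X z\<bar> ^ n)"
    "expectation (\<lambda>z. \<bar>X z\<bar> ^ n) \<le> fact n * (expectation (\<lambda>z. exp (X z)) + expectation (\<lambda>z. exp (- X z)))"
proof -
  have i: "integrable M (\<lambda>z. fact n * (exp (X z) + exp (- X z)))" using e by simp
  show "integrable M (\<lambda>z. X z ^ n)"
    by (rule Bochner_Integration.integrable_bound[OF i])
      (auto simp: power_abs intro!: AE_I2 order.trans[OF abs_power_le_exp])
  show a: "integrable M (\<lambda>z. \<bar>X z\<bar> ^ n)"
    by (rule Bochner_Integration.integrable_bound[OF i])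
      (auto intro!: AE_I2 order.trans[OF abs_power_le_exp])
  have "expectation (\<lambda>z. \<bar>X z\<bar> ^ n) \<le> expectation (\<lambda>z. fact n * (exp (X z) + exp (- X z)))"
    by (intro integral_mono a i abs_power_le_exp)
  then show "expectation (\<lambda>z. \<bar>X z\<bar> ^ n) \<le> fact n * (expectation (\<lambda>z. exp (X z)) + expectation (\<lambda>z. exp (- X z)))"
    using e by simp
qed

text \<open>Both exponential moments \<open>a\<close>, \<open>b\<close> are at least \<open>1\<close> by Jensen, so \<open>(a - 1) (b - 1) \<ge> 0\<close> turns the
  bound on their product into a bound on their sum.\<close>

lemma second_moment_le_of_subgaussian:
  fixes X :: "'a \<Rightarrow> real" and c :: real
  assumes [measurable]: "random_variable borel X"
    and e: "\<And>t. integrable M (\<lambda>z. exp (t * X z))"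
    and mean: "expectation X = 0" and c: "0 < c"
    and b: "\<And>t. expectation (\<lambda>z. exp (t * X z)) * expectation (\<lambda>z. exp (- t * X z)) \<le> exp (c * t\<^sup>2)"
  shows "expectation (\<lambda>z. (X z)\<^sup>2) \<le> c"
proof -
  have e1: "integrable M (\<lambda>z. exp (X z))" "integrable M (\<lambda>z. exp (- X z))"
    using e[of 1] e[of "-1"] by simp_all
  have i1: "integrable M X" and i2: "integrable M (\<lambda>z. (X z)\<^sup>2)"
    using integrable_power_of_exp(1)[OF assms(1) e1, of 1] integrable_power_of_exp(1)[OF assms(1) e1, of 2] by simp_all
  have ge1: "1 \<le> expectation (\<lambda>z. exp (t * X z))" for t
    using i1 e mean by (intro expectation_exp_ge_1) auto
  \<comment> \<open>The condition on \<open>t\<close> makes \<open>c * t^2 \<le> 1\<close>, where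
    \<open>exp y \<le> 1 + y + y^2\<close> is available; the excess \<open>c^2 * t^2\<close>
    disappears in the limit, leaving the sharp constant.\<close>
  have step: "expectation (\<lambda>z. (X z)\<^sup>2) \<le> c + c\<^sup>2 * t\<^sup>2" if t: "0 < t" "t < 1 / sqrt c" for t
  proof -
    let ?a = "expectation (\<lambda>z. exp (t * X z))" and ?b = "expectation (\<lambda>z. exp (- t * X z))"
    have "0 \<le> (?a - 1) * (?b - 1)" using ge1[of t] ge1[of "-t"] by simp
    then have "?a + ?b \<le> 1 + ?a * ?b" by (simp add: algebra_simps)
    also have "\<dots> \<le> 1 + exp (c * t\<^sup>2)" using b[of t] by simp
    finally have 1: "?a + ?b \<le> 1 + exp (c * t\<^sup>2)" .
    have "expectation (\<lambda>z. 2 + t\<^sup>2 * (X z)\<^sup>2) \<le> expectation (\<lambda>z. exp (t * X z) + exp (- t * X z))"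
      using i2 e[of t] e[of "-t"] exp_plus_exp_minus_ge[of "t * X z" for z]
      by (intro integral_mono) (auto simp: power_mult_distrib)
    then have "2 + t\<^sup>2 * expectation (\<lambda>z. (X z)\<^sup>2) \<le> ?a + ?b"
      using i2 e[of t] e[of "-t"] by (simp add: prob_space)
    then have 2: "1 + t\<^sup>2 * expectation (\<lambda>z. (X z)\<^sup>2) \<le> exp (c * t\<^sup>2)" using 1 by simp
    have "t\<^sup>2 \<le> (1 / sqrt c)\<^sup>2" using t by (intro power_mono) auto
    then have "c * t\<^sup>2 \<le> 1" using c by (simp add: power_divide field_simps)
    then have "exp (c * t\<^sup>2) \<le> 1 + c * t\<^sup>2 + (c * t\<^sup>2)\<^sup>2" using c by (intro exp_bound) auto
    then have "t\<^sup>2 * expectation (\<lambda>z. (X z)\<^sup>2) \<le> t\<^sup>2 * (c + c\<^sup>2 * t\<^sup>2)"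
      using 2 by (simp add: power2_eq_square algebra_simps)
    then show ?thesis using t by simp
  qed
  show ?thesis
  proof (rule tendsto_lowerbound)
    have "isCont (\<lambda>t. c + c\<^sup>2 * t\<^sup>2) 0" by simp
    then have "((\<lambda>t. c + c\<^sup>2 * t\<^sup>2) \<longlongrightarrow> c + c\<^sup>2 * 0\<^sup>2) (at_right 0)"
      unfolding isCont_def by (rule tendsto_within_subset) simp
    then show "((\<lambda>t. c + c\<^sup>2 * t\<^sup>2) \<longlongrightarrow> c) (at_right 0)" by simp
    show "\<forall>\<^sub>F t in at_right 0. expectation (\<lambda>z. (X z)\<^sup>2) \<le> c + c\<^sup>2 * t\<^sup>2"
      by (rule eventually_at_rightI[of 0 "1 / sqrt c"]) (use step c in auto)
  qed simp
qed

text \<open>As \<open>F - m\<close> has mean 0, the change of mean is the expectation of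
  \<open>(F - m) * (exp A - 1)\<close> divided by that of \<open>exp A\<close>, and Jensen keeps the
  denominator above 1. The estimate \<open>|exp A - 1| \<le> |A| * (exp A + 1)\<close> extracts the
  factor \<open>k\<close>, because \<open>A / k\<close> has bounded moments.\<close>

lemma tilt_expectation_close:
  fixes A F :: "'a \<Rightarrow> real" and b m k :: real
  assumes [measurable]: "random_variable borel A" "random_variable borel F"
    and F3: "integrable M (\<lambda>z. \<bar>F z - m\<bar> ^ 3)" "expectation (\<lambda>z. \<bar>F z - m\<bar> ^ 3) \<le> b"
    and F1: "integrable M F" "expectation F = m"
    and eA: "\<And>t. integrable M (\<lambda>z. exp (t * A z))" and A0: "expectation A = 0" and k: "0 < k"
    and bA: "\<And>t. expectation (\<lambda>z. exp (t * A z)) \<le> exp (\<bar>t\<bar> * k + t\<^sup>2 * k\<^sup>2)"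
  shows "integrable M (\<lambda>z. F z * exp (A z))"
    and "\<bar>expectation (\<lambda>z. F z * exp (A z)) / expectation (\<lambda>z. exp (A z)) - m\<bar>
      \<le> k * (b + 12 * exp 2 + 8 * exp (3 + 12 * k\<^sup>2))"
proof -
  have e1: "integrable M (\<lambda>z. exp (A z))" "integrable M (\<lambda>z. exp (- A z))"
    using eA[of 1] eA[of "-1"] by simp_all
  have iA: "integrable M A" using integrable_power_of_exp(1)[OF assms(1) e1, of 1] by simp
  have Z: "1 \<le> expectation (\<lambda>z. exp (A z))" by (rule expectation_exp_ge_1[OF iA e1(1) A0])
  \<comment> \<open>The three cubes yield the three summands of the bound: \<open>b\<close>;
    \<open>6 * 2 * exp 2\<close>, from the exponential moments at \<open>t = 1 / k\<close> and
    \<open>t = - 1 / k\<close>; and the moment at \<open>t = 3\<close>, simplified by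
    \<open>3 * k \<le> 3 + 3 * k^2\<close>.\<close>
  define R where "R z = \<bar>F z - m\<bar> ^ 3 + \<bar>A z / k\<bar> ^ 3 + (exp (A z) + 1) ^ 3" for z
  have ek: "integrable M (\<lambda>z. exp (A z / k))" "integrable M (\<lambda>z. exp (- (A z / k)))"
    using eA[of "1/k"] eA[of "-1/k"] by simp_all
  have i3: "integrable M (\<lambda>z. (exp (A z) + 1) ^ 3)" and
    b3: "expectation (\<lambda>z. (exp (A z) + 1) ^ 3) \<le> 4 * (exp (3 * k + 9 * k\<^sup>2) + 1)"
  proof -
    have i: "integrable M (\<lambda>z. 4 * (exp (3 * A z) + 1))" using eA[of 3] by simp
    have le: "(exp (A z) + 1) ^ 3 \<le> 4 * (exp (3 * A z) + 1)" for z
      using cube_sum_le[of "exp (A z)" 1] exp_of_nat_mult[of 3 "A z"] by simp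
    show "integrable M (\<lambda>z. (exp (A z) + 1) ^ 3)"
      by (rule Bochner_Integration.integrable_bound[OF i])
        (use le in \<open>auto simp: abs_of_nonneg add_nonneg_nonneg intro!: AE_I2\<close>)
    then have "expectation (\<lambda>z. (exp (A z) + 1) ^ 3) \<le> expectation (\<lambda>z. 4 * (exp (3 * A z) + 1))"
      using i by (intro integral_mono le) auto
    also have "\<dots> \<le> 4 * (exp (3 * k + 9 * k\<^sup>2) + 1)"
      using eA[of 3] bA[of 3] by (simp add: prob_space)
    finally show "expectation (\<lambda>z. (exp (A z) + 1) ^ 3) \<le> 4 * (exp (3 * k + 9 * k\<^sup>2) + 1)" .
  qed
  have i2: "integrable M (\<lambda>z. \<bar>A z / k\<bar> ^ 3)" and b2: "expectation (\<lambda>z. \<bar>A z / k\<bar> ^ 3) \<le> 12 * exp 2"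
  proof -
    show "integrable M (\<lambda>z. \<bar>A z / k\<bar> ^ 3)" by (rule integrable_power_of_exp(2)[OF _ ek]) simp
    have "expectation (\<lambda>z. \<bar>A z / k\<bar> ^ 3) \<le> fact 3 * (expectation (\<lambda>z. exp (A z / k)) + expectation (\<lambda>z. exp (- (A z / k))))"
      by (rule integrable_power_of_exp(3)[OF _ ek]) simp
    also have "\<dots> \<le> 6 * (exp 2 + exp 2)"
      using bA[of "1/k"] bA[of "-1/k"] k by (intro mult_mono add_mono) (auto simp: power_divide fact_numeral)
    finally show "expectation (\<lambda>z. \<bar>A z / k\<bar> ^ 3) \<le> 12 * exp 2" by simp
  qed
  have iR: "integrable M R" unfolding R_def using F3(1) i2 i3 by simp
  have bR: "expectation R \<le> b + 12 * exp 2 + 8 * exp (3 + 12 * k\<^sup>2)"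
  proof -
    have "2 * k \<le> k\<^sup>2 + 1" using zero_le_power2[of "k - 1"] unfolding power2_diff by simp
    then have "3 * k \<le> 3 + 3 * k\<^sup>2" using zero_le_power2[of k] by linarith
    then have "exp (3 * k + 9 * k\<^sup>2) + 1 \<le> 2 * exp (3 + 12 * k\<^sup>2)"
    proof -
      have "1 \<le> exp (3 + 12 * k\<^sup>2)" by simp
      moreover have "exp (3 * k + 9 * k\<^sup>2) \<le> exp (3 + 12 * k\<^sup>2)"
        using \<open>3 * k \<le> 3 + 3 * k\<^sup>2\<close> by simp
      ultimately show ?thesis by linarith
    qed
    then show ?thesis
      unfolding R_def using F3 i2 i3 b2 b3 by simp
  qed
  have pw: "\<bar>(F z - m) * (exp (A z) - 1)\<bar> \<le> k * R z" for z
  proof -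
    have "\<bar>exp y - 1\<bar> \<le> \<bar>y\<bar> * (exp y + 1)" for y :: real
    proof (cases "0 \<le> y")
      case True
      have "1 - exp (- y) \<le> y" using exp_ge_add_one_self[of "-y"] by simp
      then have "exp y * (1 - exp (- y)) \<le> exp y * y" by (intro mult_left_mono) auto
      then have "exp y - 1 \<le> y * exp y" by (simp add: right_diff_distrib exp_add[symmetric] mult.commute)
      then show ?thesis using True by (simp add: distrib_left)
    next
      case False
      then have "\<bar>exp y - 1\<bar> \<le> - y"
        using exp_ge_add_one_self[of y] exp_le_cancel_iff[of y 0] by (simp only: exp_zero) linarith
      also have "\<dots> \<le> \<bar>y\<bar> * (exp y + 1)" using False mult_nonneg_nonneg[of "-y" "exp y"] by (simp add: distrib_left)
      finally show ?thesis .
    qed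
    from mult_left_mono[OF this, of "\<bar>F z - m\<bar>" "A z"]
    have "\<bar>(F z - m) * (exp (A z) - 1)\<bar> \<le> k * (\<bar>F z - m\<bar> * \<bar>A z / k\<bar> * (exp (A z) + 1))"
      using k by (simp add: abs_mult abs_divide mult.assoc)
    also have "\<dots> \<le> k * R z"
      unfolding R_def using k by (intro mult_left_mono prod3_le_cubes) (auto simp: add_nonneg_nonneg)
    finally show ?thesis .
  qed
  have iD: "integrable M (\<lambda>z. (F z - m) * (exp (A z) - 1))"
    by (rule Bochner_Integration.integrable_bound[of M "\<lambda>z. k * R z"]) (use iR pw in \<open>auto intro!: AE_I2 order.trans[OF pw]\<close>)
  have eq: "F z * exp (A z) = (F z - m) * (exp (A z) - 1) + (F z - m) + m * exp (A z)" for z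
    by (simp add: algebra_simps)
  show iFe: "integrable M (\<lambda>z. F z * exp (A z))"
    unfolding eq using iD F1 e1 by simp
  have "expectation (\<lambda>z. F z * exp (A z)) = expectation (\<lambda>z. (F z - m) * (exp (A z) - 1)) + m * expectation (\<lambda>z. exp (A z))"
    unfolding eq using iD F1 e1 by (simp add: prob_space)
  then have "expectation (\<lambda>z. F z * exp (A z)) / expectation (\<lambda>z. exp (A z)) - m =
      expectation (\<lambda>z. (F z - m) * (exp (A z) - 1)) / expectation (\<lambda>z. exp (A z))"
    using Z by (simp add: field_simps)
  also have "\<bar>\<dots>\<bar> \<le> \<bar>expectation (\<lambda>z. (F z - m) * (exp (A z) - 1))\<bar>"
    using Z mult_left_mono[of 1] by (simp add: abs_divide divide_le_eq) force
  also have "\<dots> \<le> expectation (\<lambda>z. \<bar>(F z - m) * (exp (A z) - 1)\<bar>)" by (rule integral_abs_bound)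
  also have "\<dots> \<le> expectation (\<lambda>z. k * R z)"
    using iD iR by (intro integral_mono pw) auto
  also have "\<dots> \<le> k * (b + 12 * exp 2 + 8 * exp (3 + 12 * k\<^sup>2))"
    using bR k by simp
  finally show "\<bar>expectation (\<lambda>z. F z * exp (A z)) / expectation (\<lambda>z. exp (A z)) - m\<bar>
      \<le> k * (b + 12 * exp 2 + 8 * exp (3 + 12 * k\<^sup>2))" .
qed

text \<open>After centring, every exponential moment is at least 1 by Jensen, so the bounds on
  products become bounds on the single factors. The comparison of means is then applied to the
  standardized variable and to its square.\<close>

lemma tilt_variance_close:
  fixes A T :: "'a \<Rightarrow> real" and k l :: real
  assumes [measurable]: "random_variable borel A" "random_variable borel T"
    and eA: "\<And>t. integrable M (\<lambda>z. exp (t * A z))" and eT: "\<And>t. integrable M (\<lambda>z. exp (t * T z))"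
    and k: "0 < k" and l: "0 < l"
    and bA: "\<And>t. expectation (\<lambda>z. exp (t * A z)) * expectation (\<lambda>z. exp (- t * A z)) \<le> exp (\<bar>t\<bar> * k + t\<^sup>2 * k\<^sup>2)"
    and bT: "\<And>t. expectation (\<lambda>z. exp (t * T z)) * expectation (\<lambda>z. exp (- t * T z)) \<le> exp (t\<^sup>2 / l)"
  defines "Z \<equiv> expectation (\<lambda>z. exp (A z))"
  defines "m1 \<equiv> expectation (\<lambda>z. T z * exp (A z)) / Z"
  defines "m2 \<equiv> expectation (\<lambda>z. (T z)\<^sup>2 * exp (A z)) / Z"
  shows "l * variance T \<le> 1"
    and "\<bar>l * (m2 - m1\<^sup>2) - l * variance T\<bar> \<le> 10 ^ 9 * k * exp (25 * k\<^sup>2)"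
proof -
  define r where "r = sqrt l"
  have r: "0 < r" "r\<^sup>2 = l" using l by (auto simp: r_def)
  define m where "m = expectation T"
  \<comment> \<open>Standardization: \<open>S\<close> has mean 0, and \<open>l * variance T\<close>
    becomes its plain second moment.\<close>
  define S where "S z = r * (T z - m)" for z
  define c where "c = expectation A"
  define A0 where "A0 z = A z - c" for z
  have [measurable]: "random_variable borel S" "random_variable borel A0"
    unfolding S_def A0_def by measurable
  have eA1: "integrable M (\<lambda>z. exp (A z))" "integrable M (\<lambda>z. exp (- A z))"
    using eA[of 1] eA[of "-1"] by simp_all
  have eT1: "integrable M (\<lambda>z. exp (T z))" "integrable M (\<lambda>z. exp (- T z))"
    using eT[of 1] eT[of "-1"] by simp_all
  have iA: "integrable M A" using integrable_power_of_exp(1)[OF assms(1) eA1, of 1] by simp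
  have iT: "integrable M T" using integrable_power_of_exp(1)[OF assms(2) eT1, of 1] by simp
  have A0_exp: "exp (t * A0 z) = exp (t * A z) * exp (- t * c)" for t z
    by (simp add: A0_def exp_add[symmetric] algebra_simps)
  have S_exp: "exp (t * S z) = exp ((t * r) * T z) * exp (- t * r * m)" for t z
    by (simp add: S_def exp_add[symmetric] algebra_simps)
  have eA0: "integrable M (\<lambda>z. exp (t * A0 z))" for t
    unfolding A0_exp using eA[of t] by simp
  have eS: "integrable M (\<lambda>z. exp (t * S z))" for t
    unfolding S_exp using eT[of "t * r"] by simp
  have mA0: "expectation A0 = 0" unfolding A0_def using iA by (simp add: c_def prob_space)
  have mS: "expectation S = 0" unfolding S_def using iT by (simp add: m_def prob_space)
  have iA0: "integrable M A0" unfolding A0_def using iA by simp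
  have iS: "integrable M S" unfolding S_def using iT by simp
  have geA: "1 \<le> expectation (\<lambda>z. exp (t * A0 z))" for t
    using iA0 eA0 mA0 by (intro expectation_exp_ge_1) auto
  have geS: "1 \<le> expectation (\<lambda>z. exp (t * S z))" for t
    using iS eS mS by (intro expectation_exp_ge_1) auto
  have prodA: "expectation (\<lambda>z. exp (t * A0 z)) * expectation (\<lambda>z. exp (- t * A0 z)) \<le> exp (\<bar>t\<bar> * k + t\<^sup>2 * k\<^sup>2)" for t
  proof -
    have "expectation (\<lambda>z. exp (t * A0 z)) * expectation (\<lambda>z. exp (- t * A0 z)) =
      expectation (\<lambda>z. exp (t * A z)) * expectation (\<lambda>z. exp (- t * A z)) * (exp (- t * c) * exp (t * c))"
      unfolding A0_exp by simp
    also have "exp (- t * c) * exp (t * c) = 1" by (simp add: exp_add[symmetric])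
    finally show ?thesis using bA[of t] by simp
  qed
  have prodS: "expectation (\<lambda>z. exp (t * S z)) * expectation (\<lambda>z. exp (- t * S z)) \<le> exp (1 * t\<^sup>2)" for t
  proof -
    have "expectation (\<lambda>z. exp (t * S z)) * expectation (\<lambda>z. exp (- t * S z)) =
      expectation (\<lambda>z. exp ((t * r) * T z)) * expectation (\<lambda>z. exp (- (t * r) * T z)) * (exp (- t * r * m) * exp (t * r * m))"
      unfolding S_exp by simp
    also have "exp (- t * r * m) * exp (t * r * m) = 1" by (simp add: exp_add[symmetric])
    also have "expectation (\<lambda>z. exp ((t * r) * T z)) * expectation (\<lambda>z. exp (- (t * r) * T z)) * 1 \<le> exp ((t * r)\<^sup>2 / l)"
      using bT[of "t * r"] by simp
    also have "(t * r)\<^sup>2 / l = 1 * t\<^sup>2" using r l by (simp add: power_mult_distrib)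
    finally show ?thesis .
  qed
  have bA0: "expectation (\<lambda>z. exp (t * A0 z)) \<le> exp (\<bar>t\<bar> * k + t\<^sup>2 * k\<^sup>2)" for t
  proof -
    have "expectation (\<lambda>z. exp (t * A0 z)) * 1 \<le> expectation (\<lambda>z. exp (t * A0 z)) * expectation (\<lambda>z. exp (- t * A0 z))"
      using geA[of t] geA[of "-t"] by (intro mult_left_mono) auto
    then show ?thesis using prodA[of t] by simp
  qed
  have bS: "expectation (\<lambda>z. exp (t * S z)) \<le> exp (t\<^sup>2)" for t
  proof -
    have "expectation (\<lambda>z. exp (t * S z)) * 1 \<le> expectation (\<lambda>z. exp (t * S z)) * expectation (\<lambda>z. exp (- t * S z))"
      using geS[of t] geS[of "-t"] by (intro mult_left_mono) auto
    then show ?thesis using prodS[of t] by simp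
  qed
  define v where "v = expectation (\<lambda>z. (S z)\<^sup>2)"
  have v1: "v \<le> 1" unfolding v_def
    by (rule second_moment_le_of_subgaussian[OF _ eS mS _ prodS]) simp_all
  have v0: "0 \<le> v" unfolding v_def by (intro integral_nonneg_AE) simp
  have lv: "l * variance T = v"
  proof -
    have "v = expectation (\<lambda>z. l * (T z - m)\<^sup>2)" unfolding v_def S_def by (simp add: power_mult_distrib r)
    then show ?thesis by (simp add: m_def)
  qed
  show "l * variance T \<le> 1" using lv v1 by simp
  have eS1: "integrable M (\<lambda>z. exp (S z))" "integrable M (\<lambda>z. exp (- S z))"
    using eS[of 1] eS[of "-1"] by simp_all
  have bS1: "expectation (\<lambda>z. exp (S z)) \<le> exp 1" "expectation (\<lambda>z. exp (- S z)) \<le> exp 1"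
    using bS[of 1] bS[of "-1"] by simp_all
  note Spow = integrable_power_of_exp[OF \<open>random_variable borel S\<close> eS1]
  have e3: "exp (1::real) \<le> 3" by (rule exp_le)
  define W where "W = 12 * exp 2 + 8 * exp (3 + 12 * k\<^sup>2)"
  have e2: "exp (2::real) \<le> 9"
  proof -
    have "exp (2::real) = (exp 1)\<^sup>2" by (simp add: exp_double[symmetric])
    also have "\<dots> \<le> 3\<^sup>2" by (intro power_mono e3) simp
    finally show ?thesis by simp
  qed
  have e33: "exp (3::real) \<le> 27"
  proof -
    have "exp (3::real) = exp 2 * exp 1" by (simp add: exp_add[symmetric])
    also have "\<dots> \<le> 9 * 3" by (intro mult_mono e2 e3) auto
    finally show ?thesis by simp
  qed
  \<comment> \<open>Third absolute moments are at most \<open>6 * (3 + 3) = 36\<close> for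
    \<open>S\<close> and \<open>4 * (720 * 6 + 1) \<le> 18000\<close> for the centred square. With
    \<open>exp 2 \<le> 9\<close> and \<open>exp 3 \<le> 27\<close> the larger total is below
    20000.\<close>
  define B where "B = k * (20000 * exp (12 * k\<^sup>2))"
  have big: "k * (b + 12 * exp 2 + 8 * exp (3 + 12 * k\<^sup>2)) \<le> B" if "b \<le> 18000" for b
    unfolding B_def
  proof (intro mult_left_mono)
    have "exp (3 + 12 * k\<^sup>2) \<le> 27 * exp (12 * k\<^sup>2)"
      unfolding exp_add by (intro mult_right_mono e33) simp
    moreover have "1 \<le> exp (12 * k\<^sup>2)" by simp
    ultimately show "b + 12 * exp 2 + 8 * exp (3 + 12 * k\<^sup>2) \<le> 20000 * exp (12 * k\<^sup>2)"
      using that e2 by linarith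
  qed (use k in simp)
  have "expectation (\<lambda>z. \<bar>S z - 0\<bar> ^ 3) \<le> 36"
    using Spow(3)[of 3] bS1 e3 by (simp add: fact_numeral)
  note S1 = tilt_expectation_close[OF \<open>random_variable borel A0\<close> \<open>random_variable borel S\<close> _ this iS mS eA0 mA0 k bA0]
  have q1: "integrable M (\<lambda>z. S z * exp (A0 z))"
    and q1b: "\<bar>expectation (\<lambda>z. S z * exp (A0 z)) / expectation (\<lambda>z. exp (A0 z))\<bar> \<le> B"
    using S1 Spow(2)[of 3] big[of 36] by simp_all
  have i6: "integrable M (\<lambda>z. 4 * ((S z) ^ 6 + 1))" using Spow(1)[of 6] by simp
  have le6: "\<bar>(S z)\<^sup>2 - v\<bar> ^ 3 \<le> 4 * ((S z) ^ 6 + 1)" for z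
  proof -
    have "\<bar>(S z)\<^sup>2 - v\<bar> ^ 3 \<le> ((S z)\<^sup>2 + 1) ^ 3"
    proof (intro power_mono)
      show "\<bar>(S z)\<^sup>2 - v\<bar> \<le> (S z)\<^sup>2 + 1"
        using v0 v1 zero_le_power2[of "S z"] unfolding abs_le_iff by linarith
    qed simp
    also have "\<dots> \<le> 4 * (((S z)\<^sup>2) ^ 3 + 1 ^ 3)" by (rule cube_sum_le) auto
    also have "((S z)\<^sup>2) ^ 3 = (S z) ^ 6" by (simp flip: power_mult)
    finally show ?thesis by simp
  qed
  have i3: "integrable M (\<lambda>z. \<bar>(S z)\<^sup>2 - v\<bar> ^ 3)"
    by (rule Bochner_Integration.integrable_bound[OF i6]) (auto intro!: AE_I2 order.trans[OF le6])
  have "expectation (\<lambda>z. \<bar>(S z)\<^sup>2 - v\<bar> ^ 3) \<le> expectation (\<lambda>z. 4 * ((S z) ^ 6 + 1))"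
    by (intro integral_mono i3 i6 le6)
  also have "\<dots> = 4 * (expectation (\<lambda>z. \<bar>S z\<bar> ^ 6) + 1)"
    using Spow(1)[of 6] by (simp add: prob_space power_even_abs)
  also have "\<dots> \<le> 18000"
    using Spow(3)[of 6] bS1 e3 by (simp add: fact_numeral)
  finally have "expectation (\<lambda>z. \<bar>(S z)\<^sup>2 - v\<bar> ^ 3) \<le> 18000" .
  note S2 = tilt_expectation_close[OF \<open>random_variable borel A0\<close> _ i3 this _ v_def[symmetric] eA0 mA0 k bA0]
  have q2: "integrable M (\<lambda>z. (S z)\<^sup>2 * exp (A0 z))"
    and q2b: "\<bar>expectation (\<lambda>z. (S z)\<^sup>2 * exp (A0 z)) / expectation (\<lambda>z. exp (A0 z)) - v\<bar> \<le> B"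
    using S2 Spow(1)[of 2] big[of 18000] by simp_all
  define E0 where "E0 F = expectation (\<lambda>z. F z * exp (A z)) / Z" for F
  have Z: "0 < Z" 
  proof -
    have "Z = expectation (\<lambda>z. exp (A0 z)) * exp c"
      unfolding Z_def A0_def by (simp add: exp_diff)
    then show ?thesis using geA[of 1] by simp
  qed
  have conv: "expectation (\<lambda>z. F z * exp (A0 z)) / expectation (\<lambda>z. exp (A0 z)) = E0 F" for F
    unfolding E0_def Z_def A0_def by (simp add: exp_diff)
  have untilt: "integrable M (\<lambda>z. F z * exp (A z))" if "integrable M (\<lambda>z. F z * exp (A0 z))" for F
  proof -
    have "F z * exp (A z) = F z * exp (A0 z) * exp c" for z by (simp add: A0_def exp_diff)
    with integrable_mult_left[OF that, of "exp c"] show ?thesis by (simp only:)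
  qed
  note I1 = untilt[OF q1] and I2 = untilt[OF q2]
  have T1: "T z * exp (A z) = (S z * exp (A z)) / r + m * exp (A z)" for z
    using r by (simp add: S_def field_simps)
  have T2: "(T z)\<^sup>2 * exp (A z) = ((S z)\<^sup>2 * exp (A z)) / l + (2 * m / r) * (S z * exp (A z)) + m\<^sup>2 * exp (A z)" for z
  proof -
    have "T z = S z / r + m" using r by (simp add: S_def)
    then have "(T z)\<^sup>2 = (S z)\<^sup>2 / l + (2 * m / r) * S z + m\<^sup>2"
      using r by (simp add: power2_sum power_divide)
    then show ?thesis by (simp add: distrib_right)
  qed
  have m1: "m1 = E0 S / r + m"
    unfolding m1_def T1 E0_def using I1 eA1 Z by (simp add: Z_def[symmetric] add_divide_distrib)
  have m2: "m2 = E0 (\<lambda>z. (S z)\<^sup>2) / l + (2 * m / r) * E0 S + m\<^sup>2"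
    unfolding m2_def T2 E0_def using I1 I2 eA1 Z by (simp add: Z_def[symmetric] add_divide_distrib)
  have "m2 - m1\<^sup>2 = E0 (\<lambda>z. (S z)\<^sup>2) / l - (E0 S)\<^sup>2 / l"
    unfolding m1 m2 using r by (simp add: power2_sum power_divide)
  then have "l * (m2 - m1\<^sup>2) = E0 (\<lambda>z. (S z)\<^sup>2) - (E0 S)\<^sup>2"
    using l by (simp add: right_diff_distrib)
  moreover have "\<bar>E0 (\<lambda>z. (S z)\<^sup>2) - v\<bar> \<le> B" "(E0 S)\<^sup>2 \<le> B\<^sup>2"
    using q1b q2b unfolding conv by (auto intro: power2_le_iff_abs_le[THEN iffD2] simp: B_def k less_imp_le abs_le_square_iff)
  ultimately have "\<bar>l * (m2 - m1\<^sup>2) - v\<bar> \<le> B + B\<^sup>2"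
    using zero_le_power2[of "E0 S"] by linarith
  \<comment> \<open>\<open>B\<close> comes from the second moment and its square from the squared
    mean. One of the two factors \<open>k\<close> in the square is absorbed by
    \<open>k \<le> exp (k^2)\<close>, which turns the exponent 24 into 25 and keeps the bound linear
    in \<open>k\<close>.\<close>
  also have "B + B\<^sup>2 \<le> 10 ^ 9 * k * exp (25 * k\<^sup>2)"
  proof -
    have 1: "exp (12 * k\<^sup>2) \<le> exp (25 * k\<^sup>2)" by simp
    have "2 * k \<le> k\<^sup>2 + 1" using zero_le_power2[of "k - 1"] unfolding power2_diff by simp
    then have "k \<le> exp (k\<^sup>2)"
      using exp_ge_add_one_self[of "k\<^sup>2"] zero_le_power2[of k] by linarith
    then have 2: "k * exp (24 * k\<^sup>2) \<le> exp (25 * k\<^sup>2)"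
      using mult_right_mono[of k "exp (k\<^sup>2)" "exp (24 * k\<^sup>2)"] by (simp add: exp_add[symmetric])
    have "(exp (12 * k\<^sup>2))\<^sup>2 = exp (24 * k\<^sup>2)" by (simp flip: exp_double)
    then have "B + B\<^sup>2 = k * (20000 * exp (12 * k\<^sup>2) + 400000000 * (k * exp (24 * k\<^sup>2)))"
      unfolding B_def by (simp add: power_mult_distrib power2_eq_square algebra_simps)
    also have "\<dots> \<le> k * (10 ^ 9 * exp (25 * k\<^sup>2))"
    proof (intro mult_left_mono)
      have "0 \<le> exp (25 * k\<^sup>2)" by simp
      then have "20000 * exp (12 * k\<^sup>2) + 400000000 * (k * exp (24 * k\<^sup>2)) \<le> 1000000000 * exp (25 * k\<^sup>2)"
        using 1 2 by linarith
      then show "20000 * exp (12 * k\<^sup>2) + 400000000 * (k * exp (24 * k\<^sup>2)) \<le> 10 ^ 9 * exp (25 * k\<^sup>2)"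
        by simp
    qed (use k in simp)
    finally show ?thesis by (simp add: mult_ac)
  qed
  finally show "\<bar>l * (m2 - m1\<^sup>2) - l * variance T\<bar> \<le> 10 ^ 9 * k * exp (25 * k\<^sup>2)"
    unfolding lv .
qed

end


subsection \<open>The largest eigenvalue and the quadratic form\<close>

text \<open>The characteristic polynomial has a complex root; the Hermitian form at an eigenvector
  equals its own conjugate, so the root is real. Without an eigenvalue, the maximum in
  \<open>lambda_max\<close> would be taken over the empty set.\<close>

lemma symmetric_real_eigenvalue_exists:
  fixes S :: "real mat"
  assumes S: "S \<in> carrier_mat n n" and n: "0 < n"
    and sym: "\<And>i j. i < n \<Longrightarrow> j < n \<Longrightarrow> S $$ (i, j) = S $$ (j, i)"
  shows "\<exists>k. eigenvalue S k"
proof -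
  define C where "C = map_mat complex_of_real S"
  have C: "C \<in> carrier_mat n n" using S by (simp add: C_def)
  have "degree (char_poly C) = n" using degree_monic_char_poly[OF C] by simp
  then have "\<not> constant (poly (char_poly C))" using n by (simp add: constant_degree)
  then obtain z where z: "poly (char_poly C) z = 0" using fundamental_theorem_of_algebra by blast
  then have "eigenvalue C z" using eigenvalue_root_char_poly[OF C] by simp
  then obtain v where v: "v \<in> carrier_vec n" "v \<noteq> 0\<^sub>v n" "C *\<^sub>v v = z \<cdot>\<^sub>v v"
    using C by (auto simp: eigenvalue_def eigenvector_def)
  have row: "(\<Sum>j<n. complex_of_real (S $$ (i, j)) * v $ j) = z * v $ i" if "i < n" for i
  proof -
    have "(C *\<^sub>v v) $ i = (\<Sum>j<n. complex_of_real (S $$ (i, j)) * v $ j)"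
      using that S v(1) by (simp add: C_def scalar_prod_def lessThan_atLeast0)
    then show ?thesis using v that by simp
  qed
  define q where "q = (\<Sum>i<n. \<Sum>j<n. cnj (v $ i) * complex_of_real (S $$ (i, j)) * v $ j)"
  define N where "N = (\<Sum>i<n. (cmod (v $ i))\<^sup>2)"
  have "q = (\<Sum>i<n. cnj (v $ i) * (z * v $ i))"
    unfolding q_def by (intro sum.cong refl) (simp add: row[symmetric] sum_distrib_left mult.assoc)
  also have "\<dots> = z * complex_of_real N"
    unfolding N_def of_real_sum sum_distrib_left
    by (intro sum.cong refl) (simp add: complex_norm_square mult_ac del: of_real_power)
  finally have qz: "q = z * complex_of_real N" .
  have "cnj q = (\<Sum>i<n. \<Sum>j<n. v $ i * complex_of_real (S $$ (i, j)) * cnj (v $ j))"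
    by (simp add: q_def)
  also have "\<dots> = (\<Sum>j<n. \<Sum>i<n. v $ i * complex_of_real (S $$ (i, j)) * cnj (v $ j))"
    by (rule sum.swap)
  also have "\<dots> = q" unfolding q_def
    by (intro sum.cong refl) (simp add: sym mult_ac)
  finally have "cnj z * complex_of_real N = z * complex_of_real N"
    using qz by (metis complex_cnj_complex_of_real complex_cnj_mult)
  moreover have "N \<noteq> 0"
  proof
    assume "N = 0"
    then have "\<forall>i<n. v $ i = 0" by (simp add: N_def sum_nonneg_eq_0_iff)
    then have "v = 0\<^sub>v n" using v(1) by (intro eq_vecI) auto
    then show False using v(2) by simp
  qed
  ultimately have "cnj z = z" by simp
  then obtain r where r: "z = complex_of_real r" by (metis Reals_cnj_iff Reals_cases)
  have "char_poly C = map_poly complex_of_real (char_poly S)"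
    unfolding C_def by (rule of_real_hom.char_poly_hom[OF S])
  then have "complex_of_real (poly (char_poly S) r) = 0"
    using z unfolding r by simp
  then have "poly (char_poly S) r = 0" by simp
  then show ?thesis using eigenvalue_root_char_poly[OF S] by auto
qed

text \<open>Each eigenvalue of the symmetrized matrix is the value of the quadratic form of
  \<open>A\<close> at a normalized eigenvector, the antisymmetric part contributing nothing.\<close>

lemma lambda_max_le:
  assumes d: "1 \<le> d"
    and B: "\<And>h. h \<in> Rsp d \<Longrightarrow> enorm d h = 1 \<Longrightarrow> (\<Sum>i<d. \<Sum>j<d. h i * A i j * h j) \<le> B"
  shows "lambda_max d A \<le> B"
proof -
  define S where "S = Matrix.mat d d (\<lambda>(i, j). (A i j + A j i) / 2)"
  have S: "S \<in> carrier_mat d d" by (simp add: S_def)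
  have "finite {k. eigenvalue S k}"
  proof -
    have "char_poly S \<noteq> 0" using degree_monic_char_poly[OF S] d by auto
    then show ?thesis unfolding eigenvalue_root_char_poly[OF S] by (rule poly_roots_finite)
  qed
  moreover have "\<exists>k. eigenvalue S k"
    using d by (intro symmetric_real_eigenvalue_exists[OF S]) (auto simp: S_def add.commute)
  moreover have "k \<le> B" if ev: "eigenvalue S k" for k
  proof -
    obtain v where v: "v \<in> carrier_vec d" "v \<noteq> 0\<^sub>v d" "S *\<^sub>v v = k \<cdot>\<^sub>v v"
      using ev S by (auto simp: eigenvalue_def eigenvector_def)
    define w where "w i = (if i < d then v $ i else 0)" for i
    have w: "w \<in> Rsp d" by (simp add: w_def in_Rsp)
    have row: "(\<Sum>j<d. (A i j + A j i) / 2 * w j) = k * w i" if "i < d" for i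
    proof -
      have "(S *\<^sub>v v) $ i = (\<Sum>j<d. (A i j + A j i) / 2 * w j)"
        using that S v(1) by (simp add: S_def scalar_prod_def lessThan_atLeast0 w_def)
      then show ?thesis using v that by (simp add: w_def)
    qed
    have nz: "enorm d w \<noteq> 0"
    proof
      assume "enorm d w = 0"
      then have "v = 0\<^sub>v d" using v(1) by (intro eq_vecI) (auto simp: enorm_eq_0 w_def)
      then show False using v(2) by simp
    qed
    have "(\<Sum>i<d. \<Sum>j<d. w i * A j i * w j) = (\<Sum>j<d. \<Sum>i<d. w i * A j i * w j)"
      by (rule sum.swap)
    also have "\<dots> = (\<Sum>i<d. \<Sum>j<d. w i * A i j * w j)" by (simp add: mult_ac)
    finally have swap: "(\<Sum>i<d. \<Sum>j<d. w i * A j i * w j) = (\<Sum>i<d. \<Sum>j<d. w i * A i j * w j)" .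
    have "k * (enorm d w)\<^sup>2 = (\<Sum>i<d. w i * (k * w i))"
      unfolding enorm_power2 by (simp add: sum_distrib_left power2_eq_square mult_ac)
    also have "\<dots> = (\<Sum>i<d. \<Sum>j<d. (w i * A i j * w j + w i * A j i * w j) / 2)"
      by (intro sum.cong refl) (simp add: row[symmetric] sum_distrib_left algebra_simps add_divide_distrib)
    also have "\<dots> = (\<Sum>i<d. \<Sum>j<d. w i * A i j * w j)"
      by (simp add: sum.distrib swap flip: sum_divide_distrib)
    finally have q: "k * (enorm d w)\<^sup>2 = (\<Sum>i<d. \<Sum>j<d. w i * A i j * w j)" .
    define c where "c = 1 / enorm d w"
    have "(\<lambda>i. c * w i) \<in> Rsp d" "enorm d (\<lambda>i. c * w i) = 1"
      using w nz unfolding enorm_scale by (simp_all add: in_Rsp c_def)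
    from B[OF this] have "c\<^sup>2 * (\<Sum>i<d. \<Sum>j<d. w i * A i j * w j) \<le> B"
      by (simp add: sum_distrib_left power2_eq_square mult_ac)
    then show ?thesis
      using nz by (simp add: q[symmetric] c_def power_divide)
  qed
  ultimately show ?thesis
    unfolding lambda_max_def S_def[symmetric] by (subst Max_le_iff) auto
qed


subsection \<open>Differentiating posterior expectations\<close>

lemma abs_exp_minus_linear_le:
  fixes q :: real
  shows "\<bar>exp q - 1 - q\<bar> \<le> q\<^sup>2 * exp \<bar>q\<bar>"
proof -
  have *: "exp q - 1 \<le> q * exp q" for q :: real
  proof -
    have "1 - q \<le> exp (- q)" using exp_ge_add_one_self[of "-q"] by simp
    then have "exp q * (1 - q) \<le> exp q * exp (- q)" by (intro mult_left_mono) auto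
    then show ?thesis by (simp add: exp_minus right_diff_distrib mult.commute)
  qed
  have "0 \<le> exp q - 1 - q" using exp_ge_add_one_self[of q] by linarith
  moreover have "exp q - 1 - q \<le> q\<^sup>2 * exp \<bar>q\<bar>"
  proof (cases "0 \<le> q")
    case True
    have "exp q - 1 - q \<le> q * (exp q - 1)" using *[of q] by (simp add: algebra_simps)
    also have "\<dots> \<le> q * (q * exp q)" using *[of q] True by (rule mult_left_mono)
    finally show ?thesis using True by (simp add: power2_eq_square mult.assoc)
  next
    case False
    have "exp q - 1 - q \<le> - q * (1 - exp q)" using *[of q] by (simp add: algebra_simps)
    also have "\<dots> \<le> - q * (- q)" proof (intro mult_left_mono)
      show "1 - exp q \<le> - q" using exp_ge_add_one_self[of q] by linarith
    qed (use False in simp)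
    also have "\<dots> \<le> q\<^sup>2 * exp \<bar>q\<bar>" using mult_left_mono[of 1 "exp \<bar>q\<bar>" "q\<^sup>2"] by (simp add: power2_eq_square)
    finally show ?thesis .
  qed
  ultimately show ?thesis by simp
qed

context prob_space
begin

text \<open>Moving the conditioning point by \<open>v\<close> multiplies the Gaussian weight by
  \<open>exp (q v z)\<close>. A first-order expansion with an explicit remainder,
  \<open>|v|^2\<close> times an integrable function, yields the derivative together with its
  uniformity in the direction.\<close>

lemma tilted_linear_expansion:
  fixes f :: "'a \<Rightarrow> real" and X :: "'a \<Rightarrow> rvec" and s :: real
  assumes [measurable]: "random_variable borel f" and X: "\<forall>i<d. random_variable borel (\<lambda>z. X z i)"
    and f2: "integrable M (\<lambda>z. (f z)\<^sup>2)" and e: "\<And>c. integrable M (\<lambda>z. exp (c * enorm d (X z)))"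
    and s: "0 < s" and q_def: "q = (\<lambda>v z. (\<Sum>j<d. X z j * v j) / s\<^sup>2 - (enorm d v)\<^sup>2 / (2 * s\<^sup>2))"
  shows "integrable M f" "\<And>j. j < d \<Longrightarrow> integrable M (\<lambda>z. f z * X z j)"
    "\<And>v. enorm d v \<le> 1 \<Longrightarrow> integrable M (\<lambda>z. f z * exp (q v z))"
    "\<exists>C\<ge>0. \<forall>v. enorm d v \<le> 1 \<longrightarrow>
       \<bar>expectation (\<lambda>z. f z * exp (q v z)) - expectation f - (\<Sum>j<d. expectation (\<lambda>z. f z * X z j) * v j) / s\<^sup>2\<bar> \<le> C * (enorm d v)\<^sup>2"
proof -
  have [measurable]: "random_variable borel (\<lambda>z. X z i)" if "i < d" for i
    using X that by simp
  define R where "R z = enorm d (X z)" for z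
  have [measurable]: "random_variable borel R"
    unfolding R_def enorm_def L2_set_def by measurable
  have R0: "0 \<le> R z" for z by (simp add: R_def)
  \<comment> \<open>\<open>f\<close> is only square integrable; the exponential is paired with it by
    \<open>2 * x * y \<le> x^2 + y^2\<close>, at the price of doubling \<open>c\<close>.\<close>
  have fe: "integrable M (\<lambda>z. \<bar>f z\<bar> * exp (c * R z))" for c
  proof (rule Bochner_Integration.integrable_bound)
    show "integrable M (\<lambda>z. (f z)\<^sup>2 + exp ((2 * c) * R z))"
      using f2 e[of "2 * c"] by (simp add: R_def)
    have "\<bar>f z\<bar> * exp (c * R z) \<le> (f z)\<^sup>2 + exp ((2 * c) * R z)" for z
    proof -
      have "2 * (\<bar>f z\<bar> * exp (c * R z)) \<le> \<bar>f z\<bar>\<^sup>2 + (exp (c * R z))\<^sup>2"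
        using sum_squares_bound[of "\<bar>f z\<bar>" "exp (c * R z)"] by (simp add: mult.assoc)
      also have "(exp (c * R z))\<^sup>2 = exp ((2 * c) * R z)" by (simp flip: exp_double)
      finally have "2 * (\<bar>f z\<bar> * exp (c * R z)) \<le> (f z)\<^sup>2 + exp ((2 * c) * R z)" by simp
      moreover have "0 \<le> \<bar>f z\<bar> * exp (c * R z)" by simp
      ultimately show ?thesis by linarith
    qed
    then show "AE z in M. norm (\<bar>f z\<bar> * exp (c * R z)) \<le> norm ((f z)\<^sup>2 + exp ((2 * c) * R z))"
      by (auto simp: abs_mult intro!: AE_I2 order.trans[OF _ abs_ge_self])
  qed measurable
  show i1: "integrable M f"
    by (rule Bochner_Integration.integrable_bound[OF fe[of 0]]) auto
  have Xj: "\<bar>X z j\<bar> \<le> R z" if "j < d" for j z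
    unfolding R_def enorm_def using member_le_L2_set[of "{..<d}" j "\<lambda>i. \<bar>X z i\<bar>"] that
    by (simp add: L2_set_def)
  show i2: "integrable M (\<lambda>z. f z * X z j)" if j: "j < d" for j
  proof (rule Bochner_Integration.integrable_bound[OF fe[of 1]])
    have "\<bar>X z j\<bar> \<le> exp (R z)" for z
      using Xj[OF j, of z] exp_ge_add_one_self[of "R z"] by linarith
    then show "AE z in M. norm (f z * X z j) \<le> norm (\<bar>f z\<bar> * exp (1 * R z))"
      by (auto simp: abs_mult intro!: AE_I2 mult_left_mono)
  qed (use j in measurable)
  define b where "b = 1 / s\<^sup>2"
  have b: "0 < b" using s by (simp add: b_def)
  \<comment> \<open>Dominates the remainder: with \<open>\<tau> = b * (R z + 1)\<close> one has
    \<open>|q v z| \<le> |v| * \<tau>\<close>. The summand 2 comes from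
    \<open>\<tau>^2 \<le> 2 * exp \<tau>\<close>, and \<open>b\<close> from the quadratic part of
    \<open>q\<close>.\<close>
  define H where "H z = (2 + b) * (exp (2 * b) * exp ((2 * b) * R z))" for z
  have q_eq: "q v z = (\<Sum>j<d. X z j * v j) * b - (enorm d v)\<^sup>2 * b / 2" for v z
    by (simp add: q_def b_def)
  have in_le: "\<bar>(\<Sum>j<d. X z j * v j) * b\<bar> \<le> enorm d v * (b * R z)" for v z
    using inner_le_enorm[of "X z" v d] b by (simp add: abs_mult R_def mult_ac mult_left_mono)
  have qb: "\<bar>q v z\<bar> \<le> enorm d v * (b * (R z + 1))" if v: "enorm d v \<le> 1" for v z
  proof -
    have "(enorm d v)\<^sup>2 * b / 2 \<le> enorm d v * b"
      using v b mult_left_mono[of "enorm d v" 1 "enorm d v"]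
      by (simp add: power2_eq_square mult_right_mono) (smt (verit) enorm_nonneg mult_nonneg_nonneg mult_right_mono)
    moreover have "0 \<le> (enorm d v)\<^sup>2 * b / 2" using b by simp
    ultimately have "\<bar>q v z\<bar> \<le> enorm d v * (b * R z) + enorm d v * b"
      using in_le[of z v] unfolding q_eq by linarith
    then show ?thesis by (simp add: algebra_simps)
  qed
  have qb1: "\<bar>q v z\<bar> \<le> b * (R z + 1)" if v: "enorm d v \<le> 1" for v z
  proof -
    have "enorm d v * (b * (R z + 1)) \<le> 1 * (b * (R z + 1))"
      using v b R0[of z] by (intro mult_right_mono) auto
    then show ?thesis using qb[OF v, of z] by simp
  qed
  have rem: "\<bar>exp (q v z) - 1 - (\<Sum>j<d. X z j * v j) * b\<bar> \<le> (enorm d v)\<^sup>2 * H z" if v: "enorm d v \<le> 1" for v z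
  proof -
    let ?t = "b * (R z + 1)"
    have t: "0 \<le> ?t" using b R0[of z] by simp
    have "\<bar>exp (q v z) - 1 - q v z\<bar> \<le> (q v z)\<^sup>2 * exp \<bar>q v z\<bar>" by (rule abs_exp_minus_linear_le)
    also have "\<dots> \<le> (enorm d v * ?t)\<^sup>2 * exp ?t"
      using qb[OF v, of z] qb1[OF v, of z] by (intro mult_mono) (auto simp: abs_le_square_iff[symmetric])
    also have "\<dots> \<le> (enorm d v)\<^sup>2 * (2 * exp ?t * exp ?t)"
      using power_le_fact_exp[OF t, of 2] by (simp add: power_mult_distrib mult.assoc mult_left_mono mult_right_mono)
    finally have 1: "\<bar>exp (q v z) - 1 - q v z\<bar> \<le> (enorm d v)\<^sup>2 * (2 * exp (2 * ?t))"
      using exp_double[of ?t] by (simp add: power2_eq_square mult.assoc)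
    have "exp (q v z) - 1 - (\<Sum>j<d. X z j * v j) * b = (exp (q v z) - 1 - q v z) - (enorm d v)\<^sup>2 * b / 2"
      by (simp add: q_eq)
    then have "\<bar>exp (q v z) - 1 - (\<Sum>j<d. X z j * v j) * b\<bar> \<le> (enorm d v)\<^sup>2 * (2 * exp (2 * ?t)) + (enorm d v)\<^sup>2 * b / 2"
    proof -
      have "0 \<le> (enorm d v)\<^sup>2 * b / 2" using b by simp
      with 1 show ?thesis
        using \<open>exp (q v z) - 1 - (\<Sum>j<d. X z j * v j) * b = (exp (q v z) - 1 - q v z) - (enorm d v)\<^sup>2 * b / 2\<close>
        by linarith
    qed
    also have "\<dots> \<le> (enorm d v)\<^sup>2 * (2 * exp (2 * ?t)) + (enorm d v)\<^sup>2 * (b * exp (2 * ?t))"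
    proof -
      have "b * 1 \<le> b * exp (2 * ?t)" using b t by (intro mult_left_mono) auto
      then have "b / 2 \<le> b * exp (2 * ?t)" using b by linarith
      from mult_left_mono[OF this, of "(enorm d v)\<^sup>2"] show ?thesis by simp
    qed
    also have "\<dots> = (enorm d v)\<^sup>2 * H z"
      by (simp add: H_def exp_add[symmetric] algebra_simps)
    finally show ?thesis .
  qed
  have iH: "integrable M (\<lambda>z. \<bar>f z\<bar> * H z)"
  proof -
    have "\<bar>f z\<bar> * H z = ((2 + b) * exp (2 * b)) * (\<bar>f z\<bar> * exp ((2 * b) * R z))" for z
      by (simp add: H_def mult_ac)
    with integrable_mult_right[OF fe[of "2 * b"], of "(2 + b) * exp (2 * b)"] show ?thesis by (simp only:)
  qed
  show i3: "integrable M (\<lambda>z. f z * exp (q v z))" if v: "enorm d v \<le> 1" for v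
  proof (rule Bochner_Integration.integrable_bound)
    show "integrable M (\<lambda>z. exp b * (\<bar>f z\<bar> * exp (b * R z)))" using fe[of b] by simp
    have "exp (q v z) \<le> exp b * exp (b * R z)" for z
      using qb1[OF v, of z] by (simp add: exp_add[symmetric] algebra_simps)
    from mult_left_mono[OF this, of "\<bar>f z\<bar>" for z]
    show "AE z in M. norm (f z * exp (q v z)) \<le> norm (exp b * (\<bar>f z\<bar> * exp (b * R z)))"
      by (auto simp: abs_mult mult.left_commute intro!: AE_I2)
  qed (unfold q_def, measurable)
  show "\<exists>C\<ge>0. \<forall>v. enorm d v \<le> 1 \<longrightarrow>
       \<bar>expectation (\<lambda>z. f z * exp (q v z)) - expectation f - (\<Sum>j<d. expectation (\<lambda>z. f z * X z j) * v j) / s\<^sup>2\<bar> \<le> C * (enorm d v)\<^sup>2"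
  proof (intro exI conjI allI impI)
    show "0 \<le> expectation (\<lambda>z. \<bar>f z\<bar> * H z)"
      using b by (intro integral_nonneg_AE) (auto simp: H_def)
    fix v assume v: "enorm d v \<le> 1"
    have iL: "integrable M (\<lambda>z. f z * ((\<Sum>j<d. X z j * v j) * b))" and
      eL: "expectation (\<lambda>z. f z * ((\<Sum>j<d. X z j * v j) * b)) = (\<Sum>j<d. expectation (\<lambda>z. f z * X z j) * v j) / s\<^sup>2"
    proof -
      have eq: "f z * ((\<Sum>j<d. X z j * v j) * b) = (\<Sum>j<d. f z * X z j * v j) * b" for z
        by (simp add: sum_distrib_left mult.assoc)
      show "integrable M (\<lambda>z. f z * ((\<Sum>j<d. X z j * v j) * b))"
        unfolding eq using i2 by (intro integrable_mult_left Bochner_Integration.integrable_sum) auto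
      show "expectation (\<lambda>z. f z * ((\<Sum>j<d. X z j * v j) * b)) = (\<Sum>j<d. expectation (\<lambda>z. f z * X z j) * v j) / s\<^sup>2"
        unfolding eq using i2 by (simp add: Bochner_Integration.integral_sum b_def)
    qed
    have "expectation (\<lambda>z. f z * exp (q v z)) - expectation f - (\<Sum>j<d. expectation (\<lambda>z. f z * X z j) * v j) / s\<^sup>2
      = expectation (\<lambda>z. f z * exp (q v z) - f z - f z * ((\<Sum>j<d. X z j * v j) * b))"
      using i1 i3[OF v] iL by (simp add: eL)
    also have "\<bar>\<dots>\<bar> \<le> expectation (\<lambda>z. \<bar>f z * exp (q v z) - f z - f z * ((\<Sum>j<d. X z j * v j) * b)\<bar>)"
      by (rule integral_abs_bound)
    also have "\<dots> \<le> expectation (\<lambda>z. (enorm d v)\<^sup>2 * (\<bar>f z\<bar> * H z))"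
    proof (intro integral_mono)
      fix z
      have "f z * exp (q v z) - f z - f z * ((\<Sum>j<d. X z j * v j) * b) = f z * (exp (q v z) - 1 - (\<Sum>j<d. X z j * v j) * b)"
        by (simp add: algebra_simps)
      then show "\<bar>f z * exp (q v z) - f z - f z * ((\<Sum>j<d. X z j * v j) * b)\<bar> \<le> (enorm d v)\<^sup>2 * (\<bar>f z\<bar> * H z)"
        using mult_left_mono[OF rem[OF v, of z], of "\<bar>f z\<bar>"] by (simp add: abs_mult mult_ac)
    qed (use i1 i3[OF v] iL iH in auto)
    finally show "\<bar>expectation (\<lambda>z. f z * exp (q v z)) - expectation f - (\<Sum>j<d. expectation (\<lambda>z. f z * X z j) * v j) / s\<^sup>2\<bar>
        \<le> expectation (\<lambda>z. \<bar>f z\<bar> * H z) * (enorm d v)\<^sup>2"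
      by (simp add: mult.commute)
  qed
qed

text \<open>Centring \<open>f\<close> first makes the numerator itself of order \<open>|v|\<close>,
  so replacing the denominator by 1 costs only order \<open>|v|^2\<close>.\<close>

lemma tilted_mean_expansion:
  fixes f :: "'a \<Rightarrow> real" and X :: "'a \<Rightarrow> rvec" and s :: real
  assumes [measurable]: "random_variable borel f" and X: "\<forall>i<d. random_variable borel (\<lambda>z. X z i)"
    and f2: "integrable M (\<lambda>z. (f z)\<^sup>2)" and e: "\<And>c. integrable M (\<lambda>z. exp (c * enorm d (X z)))"
    and s: "0 < s" and q_def: "q = (\<lambda>v z. (\<Sum>j<d. X z j * v j) / s\<^sup>2 - (enorm d v)\<^sup>2 / (2 * s\<^sup>2))"
  shows "\<exists>C\<ge>0. \<exists>\<delta>>0. \<forall>v. enorm d v \<le> \<delta> \<longrightarrow>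
       \<bar>expectation (\<lambda>z. f z * exp (q v z)) / expectation (\<lambda>z. exp (q v z)) - expectation f
         - (\<Sum>j<d. expectation (\<lambda>z. (f z - expectation f) * X z j) * v j) / s\<^sup>2\<bar> \<le> C * (enorm d v)\<^sup>2"
proof -
  define f0 where "f0 z = f z - expectation f" for z
  note F = tilted_linear_expansion[OF assms(1) X f2 e s q_def]
  have [measurable]: "random_variable borel f0" unfolding f0_def by measurable
  have f02: "integrable M (\<lambda>z. (f0 z)\<^sup>2)"
    unfolding f0_def power2_diff using f2 F(1) by simp
  note F0 = tilted_linear_expansion[OF \<open>random_variable borel f0\<close> X f02 e s q_def]
  note F1 = tilted_linear_expansion[OF borel_measurable_const X _ e s q_def, of 1, simplified]
  have m0: "expectation f0 = 0" unfolding f0_def using F(1) by (simp add: prob_space)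
  obtain C0 where C0: "0 \<le> C0" "\<And>v. enorm d v \<le> 1 \<Longrightarrow>
      \<bar>expectation (\<lambda>z. f0 z * exp (q v z)) - (\<Sum>j<d. expectation (\<lambda>z. f0 z * X z j) * v j) / s\<^sup>2\<bar> \<le> C0 * (enorm d v)\<^sup>2"
    using F0(4) unfolding m0 by auto
  obtain C1 where C1: "0 \<le> C1" "\<And>v. enorm d v \<le> 1 \<Longrightarrow>
      \<bar>expectation (\<lambda>z. exp (q v z)) - 1 - (\<Sum>j<d. expectation (\<lambda>z. X z j) * v j) / s\<^sup>2\<bar> \<le> C1 * (enorm d v)\<^sup>2"
    using F1(4) by (auto simp: prob_space)
  define k0 where "k0 = enorm d (\<lambda>j. expectation (\<lambda>z. f0 z * X z j)) / s\<^sup>2"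
  define k1 where "k1 = enorm d (\<lambda>j. expectation (\<lambda>z. X z j)) / s\<^sup>2 + C1"
  have kn: "0 \<le> k0" "0 \<le> k1" using C1 by (simp_all add: k0_def k1_def)
  have L0: "\<bar>(\<Sum>j<d. expectation (\<lambda>z. f0 z * X z j) * v j) / s\<^sup>2\<bar> \<le> k0 * enorm d v" for v
    using divide_right_mono[OF inner_le_enorm[of "\<lambda>j. expectation (\<lambda>z. f0 z * X z j)" v d], of "s\<^sup>2"]
    by (simp add: k0_def abs_divide)
  have L1: "\<bar>expectation (\<lambda>z. exp (q v z)) - 1\<bar> \<le> k1 * enorm d v" if v: "enorm d v \<le> 1" for v
  proof -
    have "\<bar>(\<Sum>j<d. expectation (\<lambda>z. X z j) * v j) / s\<^sup>2\<bar> \<le> enorm d (\<lambda>j. expectation (\<lambda>z. X z j)) / s\<^sup>2 * enorm d v"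
      using divide_right_mono[OF inner_le_enorm[of "\<lambda>j. expectation (\<lambda>z. X z j)" v d], of "s\<^sup>2"]
      by (simp add: abs_divide)
    moreover have "C1 * (enorm d v)\<^sup>2 \<le> C1 * enorm d v"
      using C1(1) v by (intro mult_left_mono) (auto simp: power2_eq_square mult_left_le)
    ultimately show ?thesis using C1(2)[OF v] unfolding k1_def distrib_right by linarith
  qed
  \<comment> \<open>Small enough that the denominator stays above 1/2.\<close>
  define \<delta> where "\<delta> = 1 / (2 * (k1 + 1))"
  have d0: "0 < \<delta>" "\<delta> \<le> 1" using kn by (simp_all add: \<delta>_def divide_le_eq)
  show ?thesis
  proof (intro exI conjI allI impI)
    show "0 \<le> 2 * (C0 + k0 * k1)" using C0 kn by simp
    show "0 < \<delta>" by fact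
    fix v assume v: "enorm d v \<le> \<delta>"
    then have v1: "enorm d v \<le> 1" using d0 by simp
    define Z where "Z = expectation (\<lambda>z. exp (q v z))"
    define P where "P = expectation (\<lambda>z. f0 z * exp (q v z))"
    define L where "L = (\<Sum>j<d. expectation (\<lambda>z. f0 z * X z j) * v j) / s\<^sup>2"
    have "k1 * enorm d v \<le> k1 * \<delta>" using v kn by (intro mult_left_mono) auto
    also have "\<dots> \<le> 1 / 2" using kn by (simp add: \<delta>_def field_simps)
    finally have Z: "1 / 2 \<le> Z" using L1[OF v1] by (simp add: Z_def abs_le_iff)
    have "expectation (\<lambda>z. f z * exp (q v z)) = P + expectation f * Z"
    proof -
      have "f z * exp (q v z) = f0 z * exp (q v z) + expectation f * exp (q v z)" for z
        by (simp add: f0_def algebra_simps)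
      then show ?thesis
        using F0(3)[OF v1] F1(3)[OF v1] by (simp add: P_def Z_def)
    qed
    then have "expectation (\<lambda>z. f z * exp (q v z)) / Z - expectation f - L = ((P - L) - L * (Z - 1)) / Z"
      using Z by (simp add: field_simps)
    also have "\<bar>\<dots>\<bar> \<le> (C0 * (enorm d v)\<^sup>2 + k0 * enorm d v * (k1 * enorm d v)) / (1 / 2)"
      unfolding abs_divide
    proof (intro frac_le)
      have "\<bar>L * (Z - 1)\<bar> \<le> k0 * enorm d v * (k1 * enorm d v)"
        unfolding abs_mult using L0[of v] L1[OF v1] kn by (intro mult_mono) (auto simp: L_def Z_def)
      then show "\<bar>P - L - L * (Z - 1)\<bar> \<le> C0 * (enorm d v)\<^sup>2 + k0 * enorm d v * (k1 * enorm d v)"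
        using C0(2)[OF v1] unfolding P_def[symmetric] L_def[symmetric] by linarith
      show "0 \<le> C0 * (enorm d v)\<^sup>2 + k0 * enorm d v * (k1 * enorm d v)" using C0 kn by simp
    qed (use Z in auto)
    also have "\<dots> = 2 * (C0 + k0 * k1) * (enorm d v)\<^sup>2" by (simp add: power2_eq_square algebra_simps)
    finally show "\<bar>expectation (\<lambda>z. f z * exp (q v z)) / expectation (\<lambda>z. exp (q v z)) - expectation f
         - (\<Sum>j<d. expectation (\<lambda>z. (f z - expectation f) * X z j) * v j) / s\<^sup>2\<bar> \<le> 2 * (C0 + k0 * k1) * (enorm d v)\<^sup>2"
      unfolding Z_def L_def f0_def .
  qed
qed

end

text \<open>The factor \<open>real d\<close> affects only how fast the remainder vanishes, not the
  Jacobian, so the final bound stays free of the dimension.\<close>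

lemma has_jacobian_of_quadratic:
  assumes x: "x \<in> Rsp d" and \<delta>: "0 < \<delta>"
    and b: "\<And>i y. i < d \<Longrightarrow> y \<in> Rsp d \<Longrightarrow> edist d y x \<le> \<delta> \<Longrightarrow>
      \<bar>v y i - v x i - (\<Sum>j<d. J i j * (y j - x j))\<bar> \<le> C * (edist d y x)\<^sup>2"
  shows "has_jacobian d v x J"
  unfolding has_jacobian_def
proof (rule Lim_null_comparison)
  have lim: "((\<lambda>y. edist d y x) \<longlongrightarrow> 0) (at x within Rsp d)"
  proof -
    have "((\<lambda>y. edist d x y) \<longlongrightarrow> edist d x x) (at x within Rsp d)"
      using continuous_on_edist x unfolding continuous_on_def by blast
    then show ?thesis using enorm_eq_0[of d "\<lambda>i. 0"] by (simp add: edist_commute edist_def)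
  qed
  then show "((\<lambda>y. (real d * C) * edist d y x) \<longlongrightarrow> 0) (at x within Rsp d)"
    using tendsto_mult_left[OF lim, of "real d * C"] by simp
  have "\<forall>\<^sub>F y in at x within Rsp d. edist d y x < \<delta>"
    using order_tendstoD(2)[OF lim \<delta>] .
  moreover have "\<forall>\<^sub>F y in at x within Rsp d. y \<in> Rsp d"
    by (simp add: eventually_at_filter)
  ultimately show "\<forall>\<^sub>F y in at x within Rsp d.
      norm (enorm d (\<lambda>i. v y i - v x i - (\<Sum>j<d. J i j * (y j - x j))) / edist d y x) \<le> (real d * C) * edist d y x"
  proof eventually_elim
    case (elim y)
    have "enorm d (\<lambda>i. v y i - v x i - (\<Sum>j<d. J i j * (y j - x j))) \<le> (\<Sum>i<d. \<bar>v y i - v x i - (\<Sum>j<d. J i j * (y j - x j))\<bar>)"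
      unfolding enorm_def by (rule L2_set_le_sum_abs)
    also have "\<dots> \<le> (\<Sum>i<d. C * (edist d y x)\<^sup>2)"
      using b elim by (intro sum_mono) auto
    finally have "enorm d (\<lambda>i. v y i - v x i - (\<Sum>j<d. J i j * (y j - x j))) \<le> ((real d * C) * edist d y x) * edist d y x"
      by (simp add: power2_eq_square mult_ac)
    then show ?case
      by (cases "edist d y x = 0") (auto simp: pos_divide_le_eq order.strict_iff_order)
  qed
qed


subsection \<open>Normalized weights\<close>

text \<open>Reweighting followed by normalization. Both the posterior law and its counterpart
  without the factor \<open>exp a\<close> have this form over the same base measure.\<close>

definition tilt :: "'a measure \<Rightarrow> ('a \<Rightarrow> real) \<Rightarrow> 'a measure" where
  "tilt M w = density M (\<lambda>z. ennreal (w z / (\<integral>z. w z \<partial>M)))"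

locale weighted_prob_space = prob_space M for M :: "'a measure" +
  fixes w :: "'a \<Rightarrow> real"
  assumes w_pos: "\<And>z. 0 < w z" and w_int: "integrable M w"
begin

lemma w_meas [measurable]: "w \<in> borel_measurable M"
  using w_int by simp

lemma mass_pos: "0 < expectation w"
proof (rule ccontr)
  assume "\<not> 0 < expectation w"
  moreover have "0 \<le> expectation w" using w_pos by (intro integral_nonneg_AE) (auto intro: less_imp_le)
  ultimately have "expectation w = 0" by simp
  then have "AE z in M. w z = 0"
    using integral_nonneg_eq_0_iff_AE[OF w_int] w_pos by (auto intro: less_imp_le)
  then have "AE z in M. False" by eventually_elim (use w_pos in \<open>auto simp: less_le\<close>)
  then show False by simp
qed

lemma tilt_integrable:
  fixes F :: "'a \<Rightarrow> real"
  assumes [measurable]: "F \<in> borel_measurable M"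
  shows "integrable (tilt M w) F \<longleftrightarrow> integrable M (\<lambda>z. F z * w z)"
proof -
  have "integrable (tilt M w) F \<longleftrightarrow> integrable M (\<lambda>z. (w z / expectation w) *\<^sub>R F z)"
    unfolding tilt_def using w_pos mass_pos
    by (intro integrable_density) (auto intro!: AE_I2 divide_nonneg_pos less_imp_le)
  also have "(\<lambda>z. (w z / expectation w) *\<^sub>R F z) = (\<lambda>z. (F z * w z) / expectation w)" by (simp add: mult.commute)
  also have "integrable M \<dots> \<longleftrightarrow> integrable M (\<lambda>z. F z * w z)"
  proof
    assume "integrable M (\<lambda>z. (F z * w z) / expectation w)"
    from integrable_mult_left[OF this, of "expectation w"] show "integrable M (\<lambda>z. F z * w z)"
      using mass_pos by simp
  qed simp
  finally show ?thesis .
qed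

lemma tilt_integral:
  fixes F :: "'a \<Rightarrow> real"
  assumes [measurable]: "F \<in> borel_measurable M"
  shows "(\<integral>z. F z \<partial>tilt M w) = expectation (\<lambda>z. F z * w z) / expectation w"
proof -
  have "(\<integral>z. F z \<partial>tilt M w) = expectation (\<lambda>z. (w z / expectation w) *\<^sub>R F z)"
    unfolding tilt_def using w_pos mass_pos
    by (intro integral_density) (auto intro!: AE_I2 divide_nonneg_pos less_imp_le)
  also have "(\<lambda>z. (w z / expectation w) *\<^sub>R F z) = (\<lambda>z. (F z * w z) / expectation w)" by (simp add: mult.commute)
  finally show ?thesis by simp
qed

lemma sets_tilt [simp, measurable_cong]: "sets (tilt M w) = sets M"
  by (simp add: tilt_def)

lemma space_tilt [simp]: "space (tilt M w) = space M"
  by (simp add: tilt_def)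

lemma prob_space_tilt: "prob_space (tilt M w)"
proof
  have "emeasure (tilt M w) (space M) = (\<integral>\<^sup>+z. ennreal (w z / expectation w) \<partial>M)"
    unfolding tilt_def by (subst emeasure_density) (auto intro!: nn_integral_cong)
  also have "\<dots> = ennreal (expectation (\<lambda>z. w z / expectation w))"
    using w_int w_pos mass_pos by (intro nn_integral_eq_integral) (auto intro!: AE_I2 divide_nonneg_pos less_imp_le)
  also have "\<dots> = 1" using mass_pos by simp
  finally show "emeasure (tilt M w) (space (tilt M w)) = 1" by simp
qed

end

text \<open>Completing the square. The bound is uniform in \<open>r\<close>, so the Gaussian weight
  makes every exponential of the distance integrable whatever the law of the centres.\<close>

lemma gaussian_domination:
  fixes r s c :: real
  assumes "0 < s"
  shows "exp (c * r) * exp (- (r\<^sup>2) / (2 * s\<^sup>2)) \<le> exp (c\<^sup>2 * s\<^sup>2 / 2)"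
proof -
  have "0 \<le> (r / s - c * s)\<^sup>2 / 2" by simp
  also have "\<dots> = r\<^sup>2 / (2 * s\<^sup>2) - c * r + c\<^sup>2 * s\<^sup>2 / 2"
    using assms by (simp add: power2_diff power_divide power_mult_distrib field_simps) (simp add: power2_eq_square)
  finally have "c * r - r\<^sup>2 / (2 * s\<^sup>2) \<le> c\<^sup>2 * s\<^sup>2 / 2" by simp
  then show ?thesis by (simp add: exp_add[symmetric])
qed

subsection \<open>The velocity field at a fixed time\<close>

text \<open>A frozen time: \<open>M\<close> stands for the law of Z restricted to its support,
  \<open>Y\<close> for \<open>m t\<close> and \<open>s\<close> for
  \<open>\<sigma> t\<close>.\<close>

locale posterior_setup = prob_space M for M :: "'a measure" +
  fixes d :: nat and Y :: "'a \<Rightarrow> rvec" and s :: real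
  assumes Y [measurable]: "Y \<in> M \<rightarrow>\<^sub>M Rborel d" and s: "0 < s"
begin

definition g :: "rvec \<Rightarrow> 'a \<Rightarrow> real" where
  "g x z = exp (- ((edist d x (Y z))\<^sup>2) / (2 * s\<^sup>2))"

lemma Y_Rsp: "z \<in> space M \<Longrightarrow> Y z \<in> Rsp d"
  using measurable_space[OF Y] by simp

lemma Y_comp [measurable]: "f \<in> borel_measurable (Rborel d) \<Longrightarrow> (\<lambda>z. f (Y z)) \<in> borel_measurable M"
  by (rule measurable_compose[OF Y])

lemma dominated_integrable:
  fixes F :: "'a \<Rightarrow> real"
  assumes [measurable]: "F \<in> borel_measurable M"
    and le: "\<And>z. z \<in> space M \<Longrightarrow> F z \<le> exp (b + c * edist d x (Y z))" and pos: "\<And>z. 0 \<le> F z"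
  shows "integrable M (\<lambda>z. F z * g x z)"
proof (rule integrable_const_bound)
  show "(\<lambda>z. F z * g x z) \<in> borel_measurable M" unfolding g_def by measurable
  show "AE z in M. norm (F z * g x z) \<le> exp b * exp (c\<^sup>2 * s\<^sup>2 / 2)"
  proof (intro AE_I2)
    fix z assume z: "z \<in> space M"
    have "F z * g x z \<le> exp (b + c * edist d x (Y z)) * g x z"
      using le[OF z] by (intro mult_right_mono) (auto simp: g_def)
    also have "\<dots> = exp b * (exp (c * edist d x (Y z)) * exp (- ((edist d x (Y z))\<^sup>2) / (2 * s\<^sup>2)))"
      by (simp add: g_def exp_add mult.assoc)
    also have "\<dots> \<le> exp b * exp (c\<^sup>2 * s\<^sup>2 / 2)"
      by (intro mult_left_mono gaussian_domination s) simp
    finally show "norm (F z * g x z) \<le> exp b * exp (c\<^sup>2 * s\<^sup>2 / 2)"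
      using pos[of z] by (simp add: g_def)
  qed
qed

lemma weighted_g: "weighted_prob_space M (g x)"
proof
  show "0 < g x z" for z by (simp add: g_def)
  show "integrable M (g x)" using dominated_integrable[of "\<lambda>_. 1" 0 0 x] by simp
qed

text \<open>The logarithm of the ratio of two weights is affine in \<open>Y\<close>: the posterior
  at \<open>y\<close> is an exponential tilt of the posterior at \<open>x\<close>.\<close>

lemma g_shift:
  "g y z = g x z * exp ((\<Sum>j<d. (Y z j - x j) * (y j - x j)) / s\<^sup>2 - (enorm d (\<lambda>j. y j - x j))\<^sup>2 / (2 * s\<^sup>2))"
proof -
  have "(y j - Y z j)\<^sup>2 = (x j - Y z j)\<^sup>2 - 2 * ((Y z j - x j) * (y j - x j)) + (y j - x j)\<^sup>2" for j
    by (simp add: power2_eq_square algebra_simps)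
  then have "(edist d y (Y z))\<^sup>2 = (edist d x (Y z))\<^sup>2 - 2 * (\<Sum>j<d. (Y z j - x j) * (y j - x j)) + (enorm d (\<lambda>j. y j - x j))\<^sup>2"
    by (simp add: edist_power2 enorm_power2 sum.distrib sum_subtractf sum_distrib_left)
  moreover have "- (a - 2 * b + e) / (2 * s\<^sup>2) = - a / (2 * s\<^sup>2) + (b / s\<^sup>2 - e / (2 * s\<^sup>2))" for a b e
    using s by (simp add: field_simps)
  ultimately show ?thesis
    unfolding g_def exp_add[symmetric] by simp
qed

lemma posterior_exp_moments:
  "integrable (tilt M (g x)) (\<lambda>z. exp (c * enorm d (\<lambda>j. Y z j - x j)))"
proof -
  have "enorm d (\<lambda>j. Y z j - x j) = edist d x (Y z)" for z
    using edist_commute[of d x "Y z"] by (simp add: edist_def)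
  then show ?thesis
    using dominated_integrable[of "\<lambda>z. exp (c * edist d x (Y z))" 0 c x]
    by (subst weighted_prob_space.tilt_integrable[OF weighted_g]) auto
qed

lemma posterior_shift:
  fixes F :: "'a \<Rightarrow> real" and x y :: rvec
  assumes [measurable]: "F \<in> borel_measurable M"
  defines "q \<equiv> (\<lambda>v z. (\<Sum>j<d. (Y z j - x j) * v j) / s\<^sup>2 - (enorm d v)\<^sup>2 / (2 * s\<^sup>2))"
  shows "(\<integral>z. F z \<partial>tilt M (g y)) =
    (\<integral>z. F z * exp (q (\<lambda>j. y j - x j) z) \<partial>tilt M (g x)) / (\<integral>z. exp (q (\<lambda>j. y j - x j) z) \<partial>tilt M (g x))"
proof -
  interpret X: weighted_prob_space M "g x" by (rule weighted_g)
  interpret Yy: weighted_prob_space M "g y" by (rule weighted_g)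
  have [measurable]: "(\<lambda>z. q (\<lambda>j. y j - x j) z) \<in> borel_measurable M"
    unfolding q_def by measurable
  have gy: "g y = (\<lambda>z. exp (q (\<lambda>j. y j - x j) z) * g x z)"
    unfolding g_shift[of y _ x, abs_def] q_def by (simp add: mult.commute)
  show ?thesis
    unfolding Yy.tilt_integral[OF assms(1)] unfolding gy
    using X.mass_pos by (simp add: X.tilt_integral mult.assoc)
qed

text \<open>The derivative of a posterior mean is a posterior covariance with \<open>Y\<close>
  divided by \<open>s^2\<close>; it suffices that \<phi> is square integrable at the one point
  \<open>x\<close>.\<close>

lemma posterior_mean_jacobian:
  fixes \<phi> :: "nat \<Rightarrow> 'a \<Rightarrow> real" and c :: real
  assumes x: "x \<in> Rsp d"
    and [measurable]: "\<And>i. i < d \<Longrightarrow> \<phi> i \<in> borel_measurable M"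
    and phi2: "\<And>i. i < d \<Longrightarrow> integrable (tilt M (g x)) (\<lambda>z. (\<phi> i z)\<^sup>2)"
    and v: "\<And>i y. i < d \<Longrightarrow> y \<in> Rsp d \<Longrightarrow> v y i = c * y i + (\<integral>z. \<phi> i z \<partial>tilt M (g y))"
  shows "has_jacobian d v x (\<lambda>i j. (if j = i then c else 0) +
     (\<integral>z. (\<phi> i z - (\<integral>z. \<phi> i z \<partial>tilt M (g x))) * (Y z j - x j) \<partial>tilt M (g x)) / s\<^sup>2)"
    (is "has_jacobian d v x ?J")
proof -
  interpret X: weighted_prob_space M "g x" by (rule weighted_g)
  interpret P: prob_space "tilt M (g x)" by (rule X.prob_space_tilt)
  define q where "q = (\<lambda>v z. (\<Sum>j<d. (Y z j - x j) * v j) / s\<^sup>2 - (enorm d v)\<^sup>2 / (2 * s\<^sup>2))"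
  let ?E = "\<lambda>F. \<integral>z. F z \<partial>tilt M (g x)"
  define Ex where "Ex i C \<delta> \<longleftrightarrow> (\<forall>w. enorm d w \<le> \<delta> \<longrightarrow>
       \<bar>?E (\<lambda>z. \<phi> i z * exp (q w z)) / ?E (\<lambda>z. exp (q w z)) - ?E (\<phi> i)
         - (\<Sum>j<d. ?E (\<lambda>z. (\<phi> i z - ?E (\<phi> i)) * (Y z j - x j)) * w j) / s\<^sup>2\<bar> \<le> C * (enorm d w)\<^sup>2)" for i C \<delta>
  have "\<exists>C\<ge>0. \<exists>\<delta>>0. Ex i C \<delta>" if "i < d" for i
    unfolding Ex_def
    by (rule P.tilted_mean_expansion[OF _ _ phi2[OF that] posterior_exp_moments s q_def]) (use that in auto)
  then obtain C \<delta> where C: "\<And>i. i < d \<Longrightarrow> 0 \<le> C i" "\<And>i. i < d \<Longrightarrow> 0 < \<delta> i"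
    "\<And>i. i < d \<Longrightarrow> Ex i (C i) (\<delta> i)"
    by metis
  define D where "D = (\<Sum>i<d. C i)"
  define \<epsilon> where "\<epsilon> = Min (insert 1 (\<delta> ` {..<d}))"
  have \<epsilon>: "0 < \<epsilon>" "\<And>i. i < d \<Longrightarrow> \<epsilon> \<le> \<delta> i" using C(2) by (auto simp: \<epsilon>_def)
  have D: "C i \<le> D" if "i < d" for i
    unfolding D_def using that C(1) by (intro member_le_sum) auto
  show ?thesis
  proof (rule has_jacobian_of_quadratic[OF x \<epsilon>(1)])
    fix i y assume i: "i < d" and y: "y \<in> Rsp d" and near: "edist d y x \<le> \<epsilon>"
    define w where "w j = y j - x j" for j
    have ew: "enorm d w = edist d y x" by (simp add: edist_def w_def[abs_def])
    have J: "(\<Sum>j<d. ?J i j * (y j - x j)) = c * w i + (\<Sum>j<d. ?E (\<lambda>z. (\<phi> i z - ?E (\<phi> i)) * (Y z j - x j)) * w j) / s\<^sup>2"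
    proof -
      have "(\<Sum>j<d. ?J i j * (y j - x j)) = (\<Sum>j<d. (if j = i then c * w j else 0) + ?E (\<lambda>z. (\<phi> i z - ?E (\<phi> i)) * (Y z j - x j)) * w j / s\<^sup>2)"
        by (intro sum.cong) (auto simp: w_def distrib_right)
      then show ?thesis using i by (simp add: sum.distrib flip: sum_divide_distrib)
    qed
    have vy: "v y i = c * y i + ?E (\<lambda>z. \<phi> i z * exp (q w z)) / ?E (\<lambda>z. exp (q w z))"
      using v[OF i y] posterior_shift[of "\<phi> i" y x] i by (simp add: q_def w_def[abs_def])
    have "\<bar>v y i - v x i - (\<Sum>j<d. ?J i j * (y j - x j))\<bar> =
       \<bar>?E (\<lambda>z. \<phi> i z * exp (q w z)) / ?E (\<lambda>z. exp (q w z)) - ?E (\<phi> i)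
         - (\<Sum>j<d. ?E (\<lambda>z. (\<phi> i z - ?E (\<phi> i)) * (Y z j - x j)) * w j) / s\<^sup>2\<bar>"
      unfolding J vy v[OF i x] by (simp add: w_def algebra_simps)
    also have "\<dots> \<le> C i * (enorm d w)\<^sup>2"
      using near \<epsilon>(2)[OF i] C(3)[OF i, unfolded Ex_def, rule_format, of w] by (simp add: ew)
    also have "\<dots> \<le> D * (edist d y x)\<^sup>2"
      unfolding ew by (intro mult_right_mono D i) simp
    finally show "\<bar>v y i - v x i - (\<Sum>j<d. ?J i j * (y j - x j))\<bar> \<le> D * (edist d y x)\<^sup>2" .
  qed
qed

lemma posterior_coord_integrable:
  assumes j: "j < d"
  shows "integrable (tilt M (g x)) (\<lambda>z. Y z j - y j)" "integrable (tilt M (g x)) (\<lambda>z. (Y z j - y j)\<^sup>2)"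
proof -
  interpret X: weighted_prob_space M "g x" by (rule weighted_g)
  interpret P: prob_space "tilt M (g x)" by (rule X.prob_space_tilt)
  define R where "R z = enorm d (\<lambda>j. Y z j - x j)" for z
  have Xb: "\<bar>Y z j - x j\<bar> \<le> R z" for z
    unfolding R_def enorm_def using member_le_L2_set[of "{..<d}" j "\<lambda>i. \<bar>Y z i - x i\<bar>"] j
    by (simp add: L2_set_def)
  have X2: "integrable (tilt M (g x)) (\<lambda>z. (Y z j - x j)\<^sup>2)"
  proof (rule Bochner_Integration.integrable_bound)
    show "integrable (tilt M (g x)) (\<lambda>z. exp (2 * R z))"
      unfolding R_def by (rule posterior_exp_moments)
    have "(Y z j - x j)\<^sup>2 \<le> exp (2 * R z)" for z
    proof -
      have "\<bar>Y z j - x j\<bar> \<le> exp (R z)" using Xb[of z] exp_ge_add_one_self[of "R z"] by linarith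
      then have "\<bar>Y z j - x j\<bar>\<^sup>2 \<le> (exp (R z))\<^sup>2" by (intro power_mono) auto
      then show ?thesis by (simp add: exp_double)
    qed
    then show "AE z in tilt M (g x). norm ((Y z j - x j)\<^sup>2) \<le> norm (exp (2 * R z))" by auto
    show "(\<lambda>z. (Y z j - x j)\<^sup>2) \<in> borel_measurable (tilt M (g x))" by measurable
  qed
  have X1: "integrable (tilt M (g x)) (\<lambda>z. Y z j - x j)"
    by (rule P.square_integrable_imp_integrable[OF _ X2]) measurable
  have "Y z j - y j = (Y z j - x j) + (x j - y j)" for z by simp
  then show "integrable (tilt M (g x)) (\<lambda>z. Y z j - y j)"
    using X1 by (simp only: P.integrable_const Bochner_Integration.integrable_add)
  have "(Y z j - y j)\<^sup>2 = (Y z j - x j)\<^sup>2 + 2 * (x j - y j) * (Y z j - x j) + (x j - y j)\<^sup>2" for z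
    by (simp add: power2_eq_square algebra_simps)
  then show "integrable (tilt M (g x)) (\<lambda>z. (Y z j - y j)\<^sup>2)" using X1 X2 by simp
qed

text \<open>The covariance is split by the weighted arithmetic-geometric inequality. The weight
  \<open>k\<close> will be \<open>L\<close>, which balances a variance of order \<open>1 / l\<close>
  against one of order \<open>L^2 / l\<close>.\<close>

lemma velocity_quadratic_form:
  fixes b :: "nat \<Rightarrow> 'a \<Rightarrow> real" and c :: real
  assumes x: "x \<in> Rsp d" and h: "h \<in> Rsp d" "enorm d h = 1"
    and bm [measurable]: "\<And>i. i < d \<Longrightarrow> b i \<in> borel_measurable M"
    and b2: "\<And>i. i < d \<Longrightarrow> integrable (tilt M (g x)) (\<lambda>z. (b i z)\<^sup>2)"
    and k: "0 < k"
  defines "\<phi> \<equiv> (\<lambda>i z. b i z - c * Y z i)"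
    and "B \<equiv> (\<lambda>z. \<Sum>i<d. h i * b i z)" and "T \<equiv> (\<lambda>z. \<Sum>i<d. h i * Y z i)"
  shows "(\<Sum>i<d. \<Sum>j<d. h i * ((if j = i then c else 0) +
     (\<integral>z. (\<phi> i z - (\<integral>z. \<phi> i z \<partial>tilt M (g x))) * (Y z j - x j) \<partial>tilt M (g x)) / s\<^sup>2) * h j)
     \<le> c * (1 - prob_space.variance (tilt M (g x)) T / s\<^sup>2) +
       (k / 2 * prob_space.variance (tilt M (g x)) T + prob_space.variance (tilt M (g x)) B / (2 * k)) / s\<^sup>2"
proof -
  interpret X: weighted_prob_space M "g x" by (rule weighted_g)
  interpret P: prob_space "tilt M (g x)" by (rule X.prob_space_tilt)
  let ?E = "\<lambda>F. \<integral>z. F z \<partial>tilt M (g x)"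
  have ps: "P.prob (space M) = 1" using P.prob_space by simp
  note X1 = posterior_coord_integrable(1)[of _ x x] and X2 = posterior_coord_integrable(2)[of _ x x]
  have Y1: "integrable (tilt M (g x)) (\<lambda>z. Y z j)" and Y2: "integrable (tilt M (g x)) (\<lambda>z. (Y z j)\<^sup>2)" if "j < d" for j
    using posterior_coord_integrable[of j x "\<lambda>_. 0"] that by simp_all
  have prodi: "integrable (tilt M (g x)) (\<lambda>z. F z * G z)"
    if [measurable]: "F \<in> borel_measurable M" "G \<in> borel_measurable M"
      and FG: "integrable (tilt M (g x)) (\<lambda>z. (F z)\<^sup>2)" "integrable (tilt M (g x)) (\<lambda>z. (G z)\<^sup>2)"
    for F G :: "'a \<Rightarrow> real"
  proof (rule Bochner_Integration.integrable_bound)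
    show "integrable (tilt M (g x)) (\<lambda>z. (F z)\<^sup>2 + (G z)\<^sup>2)" using FG by simp
    have "\<bar>F z * G z\<bar> \<le> (F z)\<^sup>2 + (G z)\<^sup>2" for z
    proof -
      have "2 * (\<bar>F z\<bar> * \<bar>G z\<bar>) \<le> (F z)\<^sup>2 + (G z)\<^sup>2"
        using sum_squares_bound[of "\<bar>F z\<bar>" "\<bar>G z\<bar>"] by (simp add: mult.assoc)
      moreover have "0 \<le> \<bar>F z\<bar> * \<bar>G z\<bar>" by simp
      ultimately show ?thesis unfolding abs_mult by linarith
    qed
    then show "AE z in tilt M (g x). norm (F z * G z) \<le> norm ((F z)\<^sup>2 + (G z)\<^sup>2)"
      by (auto intro!: AE_I2 order.trans[OF _ abs_ge_self])
    show "(\<lambda>z. F z * G z) \<in> borel_measurable (tilt M (g x))" by measurable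
  qed
  have b1: "integrable (tilt M (g x)) (b i)" if "i < d" for i
    by (rule P.square_integrable_imp_integrable[OF _ b2[OF that]]) (use that in measurable)
  have sum2: "integrable (tilt M (g x)) (\<lambda>z. (\<Sum>i<d. h i * F i z)\<^sup>2)"
    if F: "\<And>i. i < d \<Longrightarrow> F i \<in> borel_measurable M" "\<And>i. i < d \<Longrightarrow> integrable (tilt M (g x)) (\<lambda>z. (F i z)\<^sup>2)"
    for F :: "nat \<Rightarrow> 'a \<Rightarrow> real"
  proof -
    have "(\<Sum>i<d. h i * F i z)\<^sup>2 = (\<Sum>i<d. \<Sum>j<d. (h i * h j) * (F i z * F j z))" for z
      by (simp add: power2_eq_square sum_product mult_ac)
    moreover have "integrable (tilt M (g x)) (\<lambda>z. \<Sum>i<d. \<Sum>j<d. (h i * h j) * (F i z * F j z))"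
      by (intro Bochner_Integration.integrable_sum integrable_mult_right prodi F) auto
    ultimately show ?thesis by simp
  qed
  have Bm [measurable]: "B \<in> borel_measurable M" and Tm [measurable]: "T \<in> borel_measurable M"
    unfolding B_def T_def by (auto intro!: borel_measurable_sum borel_measurable_times)
  have B2: "integrable (tilt M (g x)) (\<lambda>z. (B z)\<^sup>2)" unfolding B_def by (rule sum2[OF bm b2])
  have T2: "integrable (tilt M (g x)) (\<lambda>z. (T z)\<^sup>2)" unfolding T_def by (rule sum2) (use Y2 in auto)
  have B1: "integrable (tilt M (g x)) B" unfolding B_def using b1 by auto
  have T1: "integrable (tilt M (g x)) T" unfolding T_def using Y1 by auto
  define Bc where "Bc z = B z - ?E B" for z
  define Tc where "Tc z = T z - ?E T" for z
  have [measurable]: "Bc \<in> borel_measurable M" "Tc \<in> borel_measurable M"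
    unfolding Bc_def Tc_def by measurable
  have Bc2: "integrable (tilt M (g x)) (\<lambda>z. (Bc z)\<^sup>2)" unfolding Bc_def power2_diff using B1 B2 by simp
  have Tc2: "integrable (tilt M (g x)) (\<lambda>z. (Tc z)\<^sup>2)" unfolding Tc_def power2_diff using T1 T2 by simp
  have BT: "integrable (tilt M (g x)) (\<lambda>z. Bc z * Tc z)" by (rule prodi) (use Bc2 Tc2 in auto)
  have Bc1: "integrable (tilt M (g x)) Bc" "?E Bc = 0" unfolding Bc_def using B1 by (auto simp: ps)
  have Tc1: "integrable (tilt M (g x)) Tc" "?E Tc = 0" unfolding Tc_def using T1 by (auto simp: ps)
  have phim: "\<phi> i \<in> borel_measurable M" if "i < d" for i
    using that unfolding \<phi>_def by measurable
  have phi1: "integrable (tilt M (g x)) (\<phi> i)" if "i < d" for i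
    unfolding \<phi>_def using b1 Y1 that by simp
  have phi2: "integrable (tilt M (g x)) (\<lambda>z. (\<phi> i z)\<^sup>2)" if "i < d" for i
    unfolding \<phi>_def power2_diff using b2[OF that] Y2[OF that] prodi[OF bm[OF that] _ b2[OF that] Y2[OF that]]
    by (simp add: power_mult_distrib mult.assoc mult.left_commute)
  have phiX: "integrable (tilt M (g x)) (\<lambda>z. (\<phi> i z - ?E (\<phi> i)) * (Y z j - x j))" if ij: "i < d" "j < d" for i j
  proof (rule prodi)
    show "(\<lambda>z. \<phi> i z - ?E (\<phi> i)) \<in> borel_measurable M" using phim[OF ij(1)] by measurable
    show "integrable (tilt M (g x)) (\<lambda>z. (\<phi> i z - ?E (\<phi> i))\<^sup>2)"
      unfolding power2_diff using phi1[OF ij(1)] phi2[OF ij(1)] by simp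
  qed (use X2[OF ij(2)] in auto)
  have hh: "(\<Sum>i<d. h i * h i) = 1"
    using enorm_power2[of d h] h(2) by (simp add: power2_eq_square)
  have diag: "(\<Sum>i<d. \<Sum>j<d. h i * (if j = i then c else 0) * h j) = c"
  proof -
    have "(\<Sum>j<d. h i * (if j = i then c else 0) * h j) = c * (h i * h i)" if "i < d" for i
    proof -
      have "(\<Sum>j<d. h i * (if j = i then c else 0) * h j) = (\<Sum>j<d. if j = i then c * (h i * h i) else 0)"
        by (intro sum.cong) auto
      then show ?thesis using that by simp
    qed
    then show ?thesis using hh by (simp flip: sum_distrib_left)
  qed
  have Ephi: "(\<Sum>i<d. h i * (\<phi> i z - ?E (\<phi> i))) = Bc z - c * Tc z" for z
  proof -
    have e: "?E (\<phi> i) = ?E (b i) - c * ?E (\<lambda>z. Y z i)" if "i < d" for i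
      unfolding \<phi>_def using b1[OF that] Y1[OF that] by simp
    have "(\<Sum>i<d. h i * (\<phi> i z - ?E (\<phi> i))) =
        (\<Sum>i<d. h i * b i z - h i * ?E (b i) - c * (h i * Y z i - h i * ?E (\<lambda>z. Y z i)))"
    proof (rule sum.cong[OF refl])
      fix i assume "i \<in> {..<d}"
      then have i: "i < d" by simp
      show "h i * (\<phi> i z - ?E (\<phi> i)) = h i * b i z - h i * ?E (b i) - c * (h i * Y z i - h i * ?E (\<lambda>z. Y z i))"
        unfolding e[OF i] by (simp add: \<phi>_def algebra_simps)
    qed
    also have "\<dots> = (B z - (\<Sum>i<d. h i * ?E (b i))) - c * (T z - (\<Sum>i<d. h i * ?E (\<lambda>z. Y z i)))"
      by (simp add: B_def T_def sum_subtractf sum_distrib_left right_diff_distrib)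
    also have "(\<Sum>i<d. h i * ?E (b i)) = ?E B"
      unfolding B_def using b1 by (simp add: Bochner_Integration.integral_sum)
    also have "(\<Sum>i<d. h i * ?E (\<lambda>z. Y z i)) = ?E T"
      unfolding T_def using Y1 by (simp add: Bochner_Integration.integral_sum)
    finally show ?thesis by (simp add: Bc_def Tc_def)
  qed
  have EX: "(\<Sum>j<d. h j * (Y z j - x j)) = Tc z + (?E T - (\<Sum>j<d. h j * x j))" for z
    by (simp add: Tc_def T_def right_diff_distrib sum_subtractf)
  \<comment> \<open>Recentring \<open>Y\<close> at its mean instead of \<open>x\<close> leaves this
    constant; it multiplies only centred variables and integrates to 0.\<close>
  define r where "r = ?E T - (\<Sum>j<d. h j * x j)"
  have "(\<Sum>i<d. \<Sum>j<d. h i * ?E (\<lambda>z. (\<phi> i z - ?E (\<phi> i)) * (Y z j - x j)) * h j)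
      = ?E (\<lambda>z. \<Sum>i<d. \<Sum>j<d. h i * ((\<phi> i z - ?E (\<phi> i)) * (Y z j - x j)) * h j)"
  proof -
    have i: "integrable (tilt M (g x)) (\<lambda>z. h i * ((\<phi> i z - ?E (\<phi> i)) * (Y z j - x j)) * h j)" if "i < d" "j < d" for i j
      by (intro integrable_mult_left integrable_mult_right phiX that)
    have "?E (\<lambda>z. \<Sum>i<d. \<Sum>j<d. h i * ((\<phi> i z - ?E (\<phi> i)) * (Y z j - x j)) * h j)
       = (\<Sum>i<d. ?E (\<lambda>z. \<Sum>j<d. h i * ((\<phi> i z - ?E (\<phi> i)) * (Y z j - x j)) * h j))"
      by (intro Bochner_Integration.integral_sum Bochner_Integration.integrable_sum i) (simp_all only: lessThan_iff)
    also have "\<dots> = (\<Sum>i<d. \<Sum>j<d. ?E (\<lambda>z. h i * ((\<phi> i z - ?E (\<phi> i)) * (Y z j - x j)) * h j))"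
      by (intro sum.cong refl Bochner_Integration.integral_sum i) (simp_all only: lessThan_iff)
    finally show ?thesis by simp
  qed
  also have "(\<lambda>z. \<Sum>i<d. \<Sum>j<d. h i * ((\<phi> i z - ?E (\<phi> i)) * (Y z j - x j)) * h j) = (\<lambda>z. (Bc z - c * Tc z) * (Tc z + r))"
    unfolding Ephi[symmetric] r_def EX[symmetric] sum_product by (simp add: mult_ac)
  also have "\<dots> = (\<lambda>z. Bc z * Tc z - c * (Tc z)\<^sup>2 + r * Bc z - (r * c) * Tc z)"
    by (simp add: power2_eq_square algebra_simps)
  also have "?E \<dots> = ?E (\<lambda>z. Bc z * Tc z) - c * ?E (\<lambda>z. (Tc z)\<^sup>2)"
    using BT Tc2 Bc1 Tc1 by simp
  finally have off: "(\<Sum>i<d. \<Sum>j<d. h i * ?E (\<lambda>z. (\<phi> i z - ?E (\<phi> i)) * (Y z j - x j)) * h j)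
      = ?E (\<lambda>z. Bc z * Tc z) - c * ?E (\<lambda>z. (Tc z)\<^sup>2)" .
  have "?E (\<lambda>z. Bc z * Tc z) \<le> ?E (\<lambda>z. k / 2 * (Tc z)\<^sup>2 + (Bc z)\<^sup>2 / (2 * k))"
  proof (intro integral_mono)
    fix z
    have "0 \<le> (k * Tc z - Bc z)\<^sup>2 / (2 * k)" using k by simp
    also have "\<dots> = k / 2 * (Tc z)\<^sup>2 + (Bc z)\<^sup>2 / (2 * k) - Bc z * Tc z"
      using k by (simp add: power2_diff power_mult_distrib field_simps power2_eq_square)
    finally show "Bc z * Tc z \<le> k / 2 * (Tc z)\<^sup>2 + (Bc z)\<^sup>2 / (2 * k)" by simp
  qed (use BT Bc2 Tc2 in auto)
  also have "\<dots> = k / 2 * ?E (\<lambda>z. (Tc z)\<^sup>2) + ?E (\<lambda>z. (Bc z)\<^sup>2) / (2 * k)"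
    using Bc2 Tc2 by simp
  finally have cov: "?E (\<lambda>z. Bc z * Tc z) \<le> k / 2 * ?E (\<lambda>z. (Tc z)\<^sup>2) + ?E (\<lambda>z. (Bc z)\<^sup>2) / (2 * k)" .
  have "(\<Sum>i<d. \<Sum>j<d. h i * ((if j = i then c else 0) + ?E (\<lambda>z. (\<phi> i z - ?E (\<phi> i)) * (Y z j - x j)) / s\<^sup>2) * h j)
     = (\<Sum>i<d. \<Sum>j<d. h i * (if j = i then c else 0) * h j) +
       (\<Sum>i<d. \<Sum>j<d. h i * ?E (\<lambda>z. (\<phi> i z - ?E (\<phi> i)) * (Y z j - x j)) * h j) / s\<^sup>2"
    unfolding sum_divide_distrib sum.distrib[symmetric]
    by (intro sum.cong refl) (simp add: distrib_left distrib_right)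
  also have "\<dots> = c * (1 - ?E (\<lambda>z. (Tc z)\<^sup>2) / s\<^sup>2) + ?E (\<lambda>z. Bc z * Tc z) / s\<^sup>2"
    unfolding diag off by (simp add: diff_divide_distrib right_diff_distrib)
  also have "\<dots> \<le> c * (1 - ?E (\<lambda>z. (Tc z)\<^sup>2) / s\<^sup>2) + (k / 2 * ?E (\<lambda>z. (Tc z)\<^sup>2) + ?E (\<lambda>z. (Bc z)\<^sup>2) / (2 * k)) / s\<^sup>2"
    by (intro add_left_mono divide_right_mono cov) simp
  finally show ?thesis unfolding Bc_def Tc_def .
qed

end


section \<open>Two-sided variance bounds for the posterior law\<close>

text \<open>Replaces Hoelder growth by affine growth with constants independent of \<beta>, after
  which completing the square works for all exponents alike.\<close>

lemma powr_le_1_plus: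
  fixes r \<beta> :: real
  assumes "0 \<le> r" "0 < \<beta>" "\<beta> \<le> 1"
  shows "r powr \<beta> \<le> 1 + r"
proof (cases "r \<le> 1")
  case True
  then have "r powr \<beta> \<le> 1 powr \<beta>" using assms by (intro powr_mono2) auto
  then show ?thesis using assms by simp
next
  case False
  then have "r powr \<beta> \<le> r powr 1" using assms by (intro powr_mono) auto
  then show ?thesis using assms by simp
qed

context posterior_setup
begin

text \<open>Two reweightings of \<open>M\<close> are compared: \<open>tilt M w\<close>, whose law of
  \<open>Y\<close> is log-concave, and the posterior \<open>tilt M (g x)\<close>, obtained from it
  by the factor \<open>exp a\<close>. Sharp bounds hold for the former and are transferred at the
  cost of the error term.\<close>

lemma posterior_variance_bounds:
  fixes x h :: rvec and p a :: "rvec \<Rightarrow> real" and u :: "rvec \<Rightarrow> ereal" and \<alpha> \<beta> K :: real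
  assumes x: "x \<in> Rsp d" and dens: "prob_density_on d p"
    and law: "distr M (Rborel d) Y = density (Rlebesgue d) (\<lambda>y. ennreal (p y))"
    and decomp: "weak_log_concave_decomp d \<alpha> \<beta> K p u a"
    and h: "h \<in> Rsp d" "enorm d h = 1"
  defines "l \<equiv> \<alpha> + 1 / s\<^sup>2"
  defines "k \<equiv> K * l powr (- \<beta> / 2)"
  defines "Va \<equiv> prob_space.variance (tilt M (g x)) (\<lambda>z. \<Sum>i<d. h i * Y z i)"
  shows "l * Va \<le> 1 + 10 ^ 9 * k * exp (25 * k\<^sup>2)"
    and "\<And>A. hessian_le_everywhere d u A \<Longrightarrow> l * s\<^sup>2 - l * Va \<le> s\<^sup>2 * A + 10 ^ 9 * k * exp (25 * k\<^sup>2)"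
proof -
  interpret L: tilted_wlc d p u a \<alpha> \<beta> K s x
    by unfold_locales (fact dens decomp x s)+
  note lp = L.params
  have l: "0 < l" using L.lam_pos by (simp add: l_def L.lam_def)
  have k: "0 < k" using lp l by (simp add: k_def)
  define T where "T y = (\<Sum>i<d. h i * y i)" for y :: rvec
  have [measurable]: "T \<in> borel_measurable (Rborel d)" unfolding T_def by measurable
  define w where "w z = L.W (Y z)" for z
  have wg: "w z = exp (- a (Y z)) * g x z" for z
    by (simp add: w_def L.W_def g_def exp_add[symmetric])
  have hoel: "\<bar>a y - a x\<bar> \<le> K * (1 + edist d x y)" if "y \<in> Rsp d" for y
  proof -
    have "\<bar>a y - a x\<bar> \<le> K * edist d y x powr \<beta>" by (rule L.hoelder[OF that x])
    also have "\<dots> \<le> K * (1 + edist d y x)"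
      using lp by (intro mult_left_mono powr_le_1_plus) auto
    finally show ?thesis by (simp add: edist_commute)
  qed
  have Tlip: "\<bar>T y - T z\<bar> \<le> edist d y z" for y z
  proof -
    have "T y - T z = (\<Sum>i<d. h i * (y i - z i))" by (simp add: T_def right_diff_distrib sum_subtractf)
    then show ?thesis using inner_le_enorm[of h "\<lambda>i. y i - z i" d] h(2) by (simp add: edist_def)
  qed
  have mult_abs_le: "t * r \<le> \<bar>t\<bar> * b" if "\<bar>r\<bar> \<le> b" for t r b :: real
  proof -
    have "t * r \<le> \<bar>t\<bar> * \<bar>r\<bar>" by (metis abs_ge_self abs_mult)
    also have "\<dots> \<le> \<bar>t\<bar> * b" using that by (intro mult_left_mono) auto
    finally show ?thesis .
  qed
  have intA: "integrable M (\<lambda>z. exp (t * a (Y z)) * g x z)" for t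
  proof (rule dominated_integrable[where b="t * a x + \<bar>t\<bar> * K" and c="\<bar>t\<bar> * K"])
    fix z assume "z \<in> space M"
    then have "t * (a (Y z) - a x) \<le> \<bar>t\<bar> * (K * (1 + edist d x (Y z)))"
      by (intro mult_abs_le hoel Y_Rsp)
    then show "exp (t * a (Y z)) \<le> exp (t * a x + \<bar>t\<bar> * K + \<bar>t\<bar> * K * edist d x (Y z))"
      by (simp add: algebra_simps)
  qed auto
  have intT0: "integrable M (\<lambda>z. exp (t * T (Y z) + r * a (Y z)) * g x z)" for t r
  proof (rule dominated_integrable[where b="r * a x + \<bar>r\<bar> * K + t * T x" and c="\<bar>r\<bar> * K + \<bar>t\<bar>"])
    fix z assume z: "z \<in> space M"
    have "r * (a (Y z) - a x) \<le> \<bar>r\<bar> * (K * (1 + edist d x (Y z)))"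
      using z by (intro mult_abs_le hoel Y_Rsp)
    moreover have "t * (T (Y z) - T x) \<le> \<bar>t\<bar> * edist d x (Y z)"
      using Tlip[of "Y z" x] by (intro mult_abs_le) (simp add: edist_commute)
    ultimately show "exp (t * T (Y z) + r * a (Y z)) \<le> exp (r * a x + \<bar>r\<bar> * K + t * T x + (\<bar>r\<bar> * K + \<bar>t\<bar>) * edist d x (Y z))"
      by (simp add: algebra_simps)
  qed auto
  interpret W: weighted_prob_space M w
  proof
    show "0 < w z" for z by (simp add: w_def L.W_def)
    show "integrable M w" using intA[of "-1"] by (simp add: wg[abs_def])
  qed
  interpret N: prob_space "tilt M w" by (rule W.prob_space_tilt)
  interpret X: weighted_prob_space M "g x" by (rule weighted_g)
  interpret Q: prob_space "tilt M (g x)" by (rule X.prob_space_tilt)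
  have expw: "exp r * w z = exp (r - a (Y z)) * g x z" for r z
    unfolding wg by (simp add: exp_diff exp_minus divide_inverse mult.assoc)
  \<comment> \<open>Transports the Lebesgue inequality to \<open>M\<close> through the law of
    \<open>Y\<close>; dividing by the squared total mass turns integrals into expectations.\<close>
  have moment: "N.expectation (\<lambda>z. exp (\<phi> (Y z))) * N.expectation (\<lambda>z. exp (- \<phi> (Y z))) \<le> exp (2 * c)"
    if [measurable]: "\<phi> \<in> borel_measurable (Rborel d)"
      and i1: "integrable M (\<lambda>z. exp (\<phi> (Y z)) * w z)" and i2: "integrable M (\<lambda>z. exp (- \<phi> (Y z)) * w z)"
      and c: "\<And>y z. y \<in> L.S \<Longrightarrow> z \<in> L.S \<Longrightarrow> (\<phi> y - \<phi> z) / 2 - L.lam / 8 * (edist d y z)\<^sup>2 \<le> c"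
    for \<phi> c
  proof -
    have conv: "(\<integral>\<^sup>+y. ennreal (p y) * ennreal (exp (\<psi> y) * L.W y) \<partial>Rlebesgue d) = ennreal (expectation (\<lambda>z. exp (\<psi> (Y z)) * w z))"
      if [measurable]: "\<psi> \<in> borel_measurable (Rborel d)" and i: "integrable M (\<lambda>z. exp (\<psi> (Y z)) * w z)" for \<psi>
    proof -
      have "(\<integral>\<^sup>+y. ennreal (p y) * ennreal (exp (\<psi> y) * L.W y) \<partial>Rlebesgue d) =
          (\<integral>\<^sup>+y. ennreal (exp (\<psi> y) * L.W y) \<partial>density (Rlebesgue d) (\<lambda>y. ennreal (p y)))"
        by (subst nn_integral_density) auto
      also have "\<dots> = (\<integral>\<^sup>+z. ennreal (exp (\<psi> (Y z)) * w z) \<partial>M)"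
        unfolding law[symmetric] by (subst nn_integral_distr) (auto simp: w_def)
      also have "\<dots> = ennreal (expectation (\<lambda>z. exp (\<psi> (Y z)) * w z))"
        using i W.w_pos by (intro nn_integral_eq_integral) (auto intro!: AE_I2 mult_nonneg_nonneg less_imp_le)
      finally show ?thesis .
    qed
    have pos: "0 \<le> expectation (\<lambda>z. exp (\<psi> (Y z)) * w z)" for \<psi>
      using W.w_pos by (intro integral_nonneg_AE) (auto intro!: AE_I2 mult_nonneg_nonneg less_imp_le)
    have "ennreal (expectation (\<lambda>z. exp (\<phi> (Y z)) * w z)) * ennreal (expectation (\<lambda>z. exp (- \<phi> (Y z)) * w z))
        \<le> (ennreal (exp c) * ennreal (expectation w))\<^sup>2"
      using L.exp_moment[OF that(1) c] conv[of \<phi>] conv[of "\<lambda>y. - \<phi> y"] conv[of "\<lambda>_. 0"] i1 i2 W.w_int by simp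
    then have "expectation (\<lambda>z. exp (\<phi> (Y z)) * w z) * expectation (\<lambda>z. exp (- \<phi> (Y z)) * w z) \<le> (exp c * expectation w)\<^sup>2"
      using pos[of \<phi>] pos[of "\<lambda>y. - \<phi> y"] W.mass_pos
      by (simp add: ennreal_mult[symmetric] ennreal_power)
    then have "expectation (\<lambda>z. exp (\<phi> (Y z)) * w z) * expectation (\<lambda>z. exp (- \<phi> (Y z)) * w z) / (expectation w)\<^sup>2 \<le> (exp c)\<^sup>2"
      using W.mass_pos by (simp add: pos_divide_le_eq power_mult_distrib)
    also have "(exp c)\<^sup>2 = exp (2 * c)" by (simp only: exp_double)
    finally show ?thesis
      using that(1) by (simp add: W.tilt_integral power2_eq_square)
  qed
  have lam: "L.lam = l" by (simp add: L.lam_def l_def)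
  \<comment> \<open>Measured in units of \<open>1 / sqrt l\<close>, the Hoelder constant
    \<open>K\<close> becomes \<open>k\<close>.\<close>
  have rk: "K * r powr \<beta> \<le> k * (1 + sqrt l * r)" if r: "0 \<le> r" for r
  proof -
    have "l powr (- 1 / 2) = 1 / sqrt l"
      using l powr_minus_divide[of l "1 / 2"] powr_half_sqrt[of l] by simp
    then have "r = (sqrt l * r) * l powr (- 1 / 2)"
      using l by simp
    then have "r powr \<beta> = (sqrt l * r) powr \<beta> * l powr (- \<beta> / 2)"
    proof -
      have "(sqrt l * r * l powr (- 1 / 2)) powr \<beta> = (sqrt l * r) powr \<beta> * (l powr (- 1 / 2)) powr \<beta>"
        by (rule powr_mult)
      then show ?thesis
        unfolding \<open>r = (sqrt l * r) * l powr (- 1 / 2)\<close>[symmetric] by (simp add: powr_powr)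
    qed
    moreover have "(sqrt l * r) powr \<beta> \<le> 1 + sqrt l * r"
      using r l lp by (intro powr_le_1_plus) auto
    ultimately have "r powr \<beta> \<le> (1 + sqrt l * r) * l powr (- \<beta> / 2)"
      by (simp add: mult_right_mono)
    from mult_left_mono[OF this, of K] lp show ?thesis by (simp add: k_def mult_ac)
  qed
  have Ael: "N.expectation (\<lambda>z. exp (t * a (Y z))) * N.expectation (\<lambda>z. exp (- t * a (Y z))) \<le> exp (\<bar>t\<bar> * k + t\<^sup>2 * k\<^sup>2)" for t
  proof -
    have "N.expectation (\<lambda>z. exp ((\<lambda>y. t * a y) (Y z))) * N.expectation (\<lambda>z. exp (- (\<lambda>y. t * a y) (Y z))) \<le> exp (2 * (\<bar>t\<bar> * k / 2 + t\<^sup>2 * k\<^sup>2 / 2))"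
    proof (rule moment)
      show "integrable M (\<lambda>z. exp (t * a (Y z)) * w z)" "integrable M (\<lambda>z. exp (- (t * a (Y z))) * w z)"
        unfolding expw using intA[of "t - 1"] intA[of "- t - 1"] by (simp_all add: left_diff_distrib)
      fix y z assume "y \<in> L.S" "z \<in> L.S"
      then have yz: "y \<in> Rsp d" "z \<in> Rsp d" using L.core(1) by auto
      define r where "r = sqrt l * edist d y z"
      have "\<bar>a y - a z\<bar> \<le> k * (1 + r)"
        using L.hoelder[OF yz] rk[of "edist d y z"] by (simp add: r_def)
      then have 1: "t * (a y - a z) \<le> \<bar>t\<bar> * (k * (1 + r))" by (rule mult_abs_le)
      \<comment> \<open>The square absorbs the linear growth of \<open>a\<close> into the convexity
        gain \<open>r^2 / 8\<close>; the part \<open>|t| * k / 2\<close> is the constant term of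
        \<open>1 + r\<close>.\<close>
      have "0 \<le> (r / 2 - \<bar>t\<bar> * k)\<^sup>2" by simp
      then have 2: "\<bar>t\<bar> * k * r \<le> r\<^sup>2 / 4 + t\<^sup>2 * k\<^sup>2"
        by (simp add: power2_diff power_divide power_mult_distrib mult_ac)
      have r2: "r\<^sup>2 = l * (edist d y z)\<^sup>2" using l by (simp add: r_def power_mult_distrib)
      show "(t * a y - t * a z) / 2 - L.lam / 8 * (edist d y z)\<^sup>2 \<le> \<bar>t\<bar> * k / 2 + t\<^sup>2 * k\<^sup>2 / 2"
        using 1 2 unfolding lam r2 by (simp add: algebra_simps)
    qed measurable
    then show ?thesis by (simp add: distrib_left)
  qed
  have Tel: "N.expectation (\<lambda>z. exp (t * T (Y z))) * N.expectation (\<lambda>z. exp (- t * T (Y z))) \<le> exp (t\<^sup>2 / l)" for t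
  proof -
    have "N.expectation (\<lambda>z. exp ((\<lambda>y. t * T y) (Y z))) * N.expectation (\<lambda>z. exp (- (\<lambda>y. t * T y) (Y z))) \<le> exp (2 * (t\<^sup>2 / l / 2))"
    proof (rule moment)
      show "integrable M (\<lambda>z. exp (t * T (Y z)) * w z)" "integrable M (\<lambda>z. exp (- (t * T (Y z))) * w z)"
        unfolding expw using intT0[of t "-1"] intT0[of "- t" "-1"] by simp_all
      fix y z
      have 1: "t * (T y - T z) \<le> \<bar>t\<bar> * edist d y z" by (rule mult_abs_le[OF Tlip])
      have "0 \<le> (l * edist d y z / 2 - \<bar>t\<bar>)\<^sup>2 / l" using l by simp
      also have "\<dots> = l * (edist d y z)\<^sup>2 / 4 - \<bar>t\<bar> * edist d y z + t\<^sup>2 / l"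
        using l by (simp add: power2_diff power_divide power_mult_distrib field_simps) (simp add: power2_eq_square)
      finally show "(t * T y - t * T z) / 2 - L.lam / 8 * (edist d y z)\<^sup>2 \<le> t\<^sup>2 / l / 2"
        using 1 unfolding lam by (simp add: algebra_simps)
    qed measurable
    then show ?thesis by simp
  qed
  have eA: "integrable (tilt M w) (\<lambda>z. exp (t * a (Y z)))" for t
    by (subst W.tilt_integrable, simp, unfold expw) (use intA[of "t - 1"] in \<open>simp add: left_diff_distrib\<close>)
  have eT: "integrable (tilt M w) (\<lambda>z. exp (t * T (Y z)))" for t
    by (subst W.tilt_integrable, simp, unfold expw) (use intT0[of t "-1"] in simp)
  have rvs: "random_variable borel (\<lambda>z. a (Y z))" "random_variable borel (\<lambda>z. T (Y z))"
    by measurable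
  then have rvN: "N.random_variable borel (\<lambda>z. a (Y z))" "N.random_variable borel (\<lambda>z. T (Y z))"
    by (simp_all cong: measurable_cong_sets)
  define VN where "VN = N.variance (\<lambda>z. T (Y z))"
  note close = N.tilt_variance_close[OF rvN eA eT k l Ael Tel]
  \<comment> \<open>Multiplying \<open>w\<close> by \<open>exp a\<close> restores the Gaussian
    weight \<open>g x\<close>, hence tilted expectations are posterior expectations.\<close>
  have tiltQ: "N.expectation (\<lambda>z. F z * exp (a (Y z))) / N.expectation (\<lambda>z. exp (a (Y z))) = Q.expectation F"
    if [measurable]: "random_variable borel F" for F
  proof -
    have e: "exp (a (Y z)) * w z = g x z" for z unfolding expw by simp
    show ?thesis
      using W.mass_pos by (simp add: W.tilt_integral X.tilt_integral mult.assoc e)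
  qed
  have eQ: "integrable (tilt M (g x)) (\<lambda>z. exp (t * T (Y z)))" for t
    by (subst X.tilt_integrable, simp) (use intT0[of t 0] in simp)
  have rvQ: "Q.random_variable borel (\<lambda>z. T (Y z))"
    using rvs by (simp cong: measurable_cong_sets)
  have Tpow: "integrable (tilt M (g x)) (\<lambda>z. T (Y z) ^ n)" for n
    using eQ[of 1] eQ[of "-1"] by (intro Q.integrable_power_of_exp(1)[OF rvQ]) simp_all
  have Va: "Va = Q.expectation (\<lambda>z. (T (Y z))\<^sup>2) - (Q.expectation (\<lambda>z. T (Y z)))\<^sup>2"
    unfolding Va_def T_def[symmetric] using Tpow[of 1] Tpow[of 2] by (intro Q.variance_eq) simp_all
  have VN1: "l * VN \<le> 1" using close(1) by (simp add: VN_def)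
  have diff: "\<bar>l * Va - l * VN\<bar> \<le> 10 ^ 9 * k * exp (25 * k\<^sup>2)"
    using close(2) rvs by (simp add: tiltQ Va VN_def)
  show "l * Va \<le> 1 + 10 ^ 9 * k * exp (25 * k\<^sup>2)" using VN1 diff by linarith
  fix A assume A: "hessian_le_everywhere d u A"
  have conv: "integrable (Rlebesgue d) (\<lambda>y. G y * (p y * L.W y)) \<longleftrightarrow> integrable M (\<lambda>z. G (Y z) * w z)"
      "(\<integral>y. G y * (p y * L.W y) \<partial>Rlebesgue d) = expectation (\<lambda>z. G (Y z) * w z)"
    if [measurable]: "G \<in> borel_measurable (Rborel d)" for G
  proof -
    have e: "G y * (p y * L.W y) = p y *\<^sub>R (G y * L.W y)" for y by (simp add: mult_ac)
    have p0: "AE y in Rlebesgue d. 0 \<le> p y" using L.p_nonneg by (intro AE_I2) simp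
    have m: "(\<lambda>y. G y * L.W y) \<in> borel_measurable (Rlebesgue d)" "p \<in> borel_measurable (Rlebesgue d)" by measurable
    show "integrable (Rlebesgue d) (\<lambda>y. G y * (p y * L.W y)) \<longleftrightarrow> integrable M (\<lambda>z. G (Y z) * w z)"
      unfolding e integrable_density[OF m p0, symmetric] law[symmetric]
      by (subst integrable_distr_eq) (auto simp: w_def)
    show "(\<integral>y. G y * (p y * L.W y) \<partial>Rlebesgue d) = expectation (\<lambda>z. G (Y z) * w z)"
      unfolding e integral_density[OF m p0, symmetric] law[symmetric]
      by (subst integral_distr) (auto simp: w_def)
  qed
  define m where "m = N.expectation (\<lambda>z. T (Y z))"
  have Np: "integrable (tilt M w) (\<lambda>z. T (Y z) ^ n)" for n
    using eT[of 1] eT[of "-1"] by (intro N.integrable_power_of_exp(1)[OF rvN(2)]) simp_all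
  have psN: "N.prob (space M) = 1" using N.prob_space by simp
  have n1: "integrable (tilt M w) (\<lambda>z. T (Y z) - m)" using Np[of 1] by simp
  have n2: "integrable (tilt M w) (\<lambda>z. (T (Y z) - m)\<^sup>2)"
    unfolding power2_diff using Np[of 1] Np[of 2] by simp
  have low: "0 < A + 1 / s\<^sup>2" "expectation w \<le> (A + 1 / s\<^sup>2) * expectation (\<lambda>z. (T (Y z) - m)\<^sup>2 * w z)"
  proof -
    have i0: "integrable (Rlebesgue d) (\<lambda>y. p y * L.W y)" "(\<integral>y. p y * L.W y \<partial>Rlebesgue d) = expectation w"
      using conv[of "\<lambda>_. 1"] W.w_int by simp_all
    have i1: "integrable (Rlebesgue d) (\<lambda>y. (T y - m) * (p y * L.W y))"
      using conv(1)[of "\<lambda>y. T y - m"] n1 by (simp add: W.tilt_integrable)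
    have i2: "integrable (Rlebesgue d) (\<lambda>y. (T y - m)\<^sup>2 * (p y * L.W y))"
      using conv(1)[of "\<lambda>y. (T y - m)\<^sup>2"] n2 by (simp add: W.tilt_integrable)
    have "expectation (\<lambda>z. (T (Y z) - m) * w z) / expectation w = N.expectation (\<lambda>z. T (Y z) - m)"
      by (simp add: W.tilt_integral)
    also have "\<dots> = 0" using Np[of 1] by (simp add: m_def psN)
    finally have "expectation (\<lambda>z. (T (Y z) - m) * w z) = 0" using W.mass_pos by simp
    then have mean: "(\<integral>y. (T y - m) * (p y * L.W y) \<partial>Rlebesgue d) = 0"
      using conv(2)[of "\<lambda>y. T y - m"] by simp
    note VL = L.variance_lower[OF A h i0(1) i1[unfolded T_def] i2[unfolded T_def] mean[unfolded T_def]]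
    show "0 < A + 1 / s\<^sup>2" using VL(1) i0(2) W.mass_pos by simp
    show "expectation w \<le> (A + 1 / s\<^sup>2) * expectation (\<lambda>z. (T (Y z) - m)\<^sup>2 * w z)"
      using VL(2) i0(2) W.mass_pos conv(2)[of "\<lambda>y. (T y - m)\<^sup>2"] by (simp add: T_def)
  qed
  define La where "La = A + 1 / s\<^sup>2"
  have "VN = expectation (\<lambda>z. (T (Y z) - m)\<^sup>2 * w z) / expectation w"
    unfolding VN_def m_def[symmetric] by (simp add: W.tilt_integral)
  then have LV: "1 \<le> La * VN"
    using low W.mass_pos by (simp add: La_def pos_le_divide_eq)
  have La: "0 < La" using low by (simp add: La_def)
  \<comment> \<open>Playing the upper and lower variance bounds against each other gives
    \<open>l \<le> La\<close>, that is \<open>\<alpha> \<le> A\<close>, and in particular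
    \<open>A > 0\<close>; the final monotonicity step uses both.\<close>
  have "l * 1 \<le> l * (La * VN)" using LV l by (intro mult_left_mono) auto
  also have "\<dots> = La * (l * VN)" by simp
  also have "\<dots> \<le> La * 1" using VN1 La by (intro mult_left_mono) auto
  finally have lLa: "l \<le> La" by simp
  then have A0: "0 < A" using lp by (simp add: La_def l_def)
  have "l * s\<^sup>2 - l * VN \<le> l * s\<^sup>2 - l / La"
  proof -
    have "l / La \<le> l * VN" using LV La l by (simp add: pos_divide_le_eq mult_ac)
    then show ?thesis by simp
  qed
  \<comment> \<open>The identity \<open>s^2 * La = s^2 * A + 1\<close> makes the 1 cancel, so the
    main term is \<open>A\<close> with constant exactly 1.\<close>
  also have "\<dots> = (l / La) * (s\<^sup>2 * A)"
  proof -
    have "s\<^sup>2 * La = s\<^sup>2 * A + 1" using s by (simp add: La_def distrib_left)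
    then have "l * s\<^sup>2 = (l / La) * (s\<^sup>2 * A + 1)" using La by (metis less_irrefl nonzero_mult_div_cancel_right times_divide_eq_left times_divide_eq_right)
    then show ?thesis by (simp add: distrib_left)
  qed
  also have "\<dots> \<le> 1 * (s\<^sup>2 * A)" using lLa La A0 by (intro mult_right_mono) auto
  finally show "l * s\<^sup>2 - l * Va \<le> s\<^sup>2 * A + 10 ^ 9 * k * exp (25 * k\<^sup>2)" using diff by linarith
qed

end


subsection \<open>Assembling the bound\<close>

text \<open>Multiplying by \<open>\<alpha> * s^2 + 1 = (\<alpha> + 1 / s^2) * s^2\<close> makes all
  variances scale-free. \<open>X\<close> stands for the factor raised to \<xi>, and \<open>B\<close>
  for \<alpha> or \<open>A\<close> according to the sign of \<open>c\<close>, so both cases of the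
  theorem share this computation.\<close>

lemma lambda_bound:
  fixes \<alpha> s c V VB L \<delta> E X B :: real
  assumes s: "0 < s" and \<alpha>: "0 < \<alpha>" and L: "0 < L" and \<delta>: "0 \<le> \<delta>"
    and V: "(\<alpha> + 1 / s\<^sup>2) * V \<le> 1 + \<delta>" and VB: "VB \<le> L\<^sup>2 * (s\<^sup>2 / (\<alpha> * s\<^sup>2 + 1))"
    and cV: "c * ((\<alpha> + 1 / s\<^sup>2) * s\<^sup>2 - (\<alpha> + 1 / s\<^sup>2) * V) \<le> s\<^sup>2 * c * B + \<bar>c\<bar> * \<delta>"
    and E: "1 + \<delta> \<le> E" "\<delta> \<le> E * X"
  shows "c * (1 - V / s\<^sup>2) + (L / 2 * V + VB / (2 * L)) / s\<^sup>2
    \<le> 1 / (\<alpha> * s\<^sup>2 + 1) * (E * (L + \<bar>c\<bar> * X) + s\<^sup>2 * c * B)"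
proof -
  define P where "P = \<alpha> * s\<^sup>2 + 1"
  have P: "0 < P" using s \<alpha> by (simp add: P_def add_pos_pos)
  define l where "l = P / s\<^sup>2"
  have l: "\<alpha> + 1 / s\<^sup>2 = l" using s by (simp add: l_def P_def field_simps)
  have lP: "l * s\<^sup>2 = P" using s by (simp add: l_def)
  have ls: "0 < l" using P s by (simp add: l_def)
  have "P * (c * (1 - V / s\<^sup>2) + (L / 2 * V + VB / (2 * L)) / s\<^sup>2) = c * (P - l * V) + (L / 2 * (l * V) + l * VB / (2 * L))"
    by (simp add: l_def algebra_simps add_divide_distrib)
  also have "\<dots> \<le> (s\<^sup>2 * c * B + \<bar>c\<bar> * \<delta>) + (L / 2 * (1 + \<delta>) + L / 2)"
  proof -
    have 1: "c * (P - l * V) \<le> s\<^sup>2 * c * B + \<bar>c\<bar> * \<delta>" using cV unfolding l lP .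
    have 2: "L / 2 * (l * V) \<le> L / 2 * (1 + \<delta>)" using V L unfolding l by (intro mult_left_mono) auto
    have "l * VB \<le> l * (L\<^sup>2 * (s\<^sup>2 / P))" using VB ls unfolding P_def by (intro mult_left_mono) auto
    also have "\<dots> = L\<^sup>2" using P s by (simp add: l_def)
    finally have "l * VB / (2 * L) \<le> L\<^sup>2 / (2 * L)" using L by (intro divide_right_mono) auto
    then have 3: "l * VB / (2 * L) \<le> L / 2" using L by (simp add: power2_eq_square)
    show ?thesis using 1 2 3 by linarith
  qed
  also have "\<dots> \<le> E * (L + \<bar>c\<bar> * X) + s\<^sup>2 * c * B"
  proof -
    have "L * (1 + \<delta>) \<le> L * E" using E L by (intro mult_left_mono) auto
    moreover have "\<bar>c\<bar> * \<delta> \<le> \<bar>c\<bar> * (E * X)" using E by (intro mult_left_mono) auto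
    moreover have "L / 2 * (1 + \<delta>) + L / 2 \<le> L * (1 + \<delta>)"
    proof -
      have "0 \<le> L * \<delta>" using L \<delta> by simp
      moreover have "L / 2 * (1 + \<delta>) = L / 2 + L * \<delta> / 2" "L * (1 + \<delta>) = L + L * \<delta>"
        by (simp_all add: distrib_left)
      ultimately show ?thesis by linarith
    qed
    ultimately show ?thesis unfolding distrib_left by (simp add: mult_ac)
  qed
  finally have "P * (c * (1 - V / s\<^sup>2) + (L / 2 * V + VB / (2 * L)) / s\<^sup>2) \<le> E * (L + \<bar>c\<bar> * X) + s\<^sup>2 * c * B" .
  then show ?thesis using P unfolding P_def[symmetric] by (simp add: pos_le_divide_eq mult.commute)
qed

text \<open>\<open>\<delta>\<close> is the error term of the variance comparison. It is bounded using \<open>k \<le> exp (k\<^sup>2)\<close> when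
  \<open>n = 0\<close>, and \<open>k \<le> K s\<^sup>\<beta>\<close> when \<open>n = 1\<close>.\<close>

lemma perturbation_factor:
  fixes \<alpha> s K \<beta> :: real and n :: nat
  assumes "0 < s" "0 < \<alpha>" "0 < K" "0 < \<beta>" and n: "n \<in> {0, 1}"
  defines "k \<equiv> K * (\<alpha> + 1 / s\<^sup>2) powr (- \<beta> / 2)"
    and "E \<equiv> 2 * 10 ^ 9 * exp (2 * 10 ^ 9 * K\<^sup>2 / (\<alpha> + 1 / s\<^sup>2) powr \<beta>)"
    and "\<delta> \<equiv> 10 ^ 9 * (K * (\<alpha> + 1 / s\<^sup>2) powr (- \<beta> / 2)) * exp (25 * (K * (\<alpha> + 1 / s\<^sup>2) powr (- \<beta> / 2))\<^sup>2)"
  shows "0 \<le> \<delta>" "1 + \<delta> \<le> E" "\<delta> \<le> E * (K * s powr \<beta>) ^ n"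
proof -
  define l where "l = \<alpha> + 1 / s\<^sup>2"
  have l: "0 < l" using assms by (simp add: l_def add_pos_pos)
  have k: "0 < k" using assms l by (simp add: k_def l_def)
  have "(l powr (- \<beta> / 2))\<^sup>2 = l powr (- \<beta>)"
    using l by (simp add: power2_eq_square flip: powr_add)
  then have k2: "k\<^sup>2 = K\<^sup>2 / l powr \<beta>"
    unfolding k_def l_def[symmetric] power_mult_distrib by (simp only:) (simp add: powr_minus_divide)
  have \<delta>: "\<delta> = 10 ^ 9 * k * exp (25 * k\<^sup>2)" by (simp add: \<delta>_def k_def)
  have "2 * 10 ^ 9 * K\<^sup>2 / l powr \<beta> = 2 * 10 ^ 9 * k\<^sup>2" unfolding k2 by simp
  then have E: "E = 2 * 10 ^ 9 * exp (2 * 10 ^ 9 * k\<^sup>2)"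
    unfolding E_def l_def[symmetric] by (simp only:)
  show d0: "0 \<le> \<delta>" unfolding \<delta> using k by simp
  have "2 * k \<le> k\<^sup>2 + 1" using zero_le_power2[of "k - 1"] unfolding power2_diff by simp
  then have ke: "k \<le> exp (k\<^sup>2)"
    using exp_ge_add_one_self[of "k\<^sup>2"] zero_le_power2[of k] by linarith
  have "k * exp (25 * k\<^sup>2) \<le> exp (k\<^sup>2) * exp (25 * k\<^sup>2)" using ke by (intro mult_right_mono) auto
  also have "\<dots> = exp (26 * k\<^sup>2)" by (simp add: exp_add[symmetric])
  also have "\<dots> \<le> exp (2 * 10 ^ 9 * k\<^sup>2)" using mult_right_mono[of 26 "2 * 10 ^ 9" "k\<^sup>2"] by simp
  finally have 1: "k * exp (25 * k\<^sup>2) \<le> exp (2 * 10 ^ 9 * k\<^sup>2)" .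
  \<comment> \<open>The constant 1 and the error each take one half of \<open>E\<close>; this is the
    origin of the factor 2.\<close>
  have "1 * 1 \<le> 10 ^ 9 * exp (2 * 10 ^ 9 * k\<^sup>2)" by (intro mult_mono) auto
  moreover have "10 ^ 9 * (k * exp (25 * k\<^sup>2)) \<le> 10 ^ 9 * exp (2 * 10 ^ 9 * k\<^sup>2)"
    using 1 by (intro mult_left_mono) auto
  ultimately show dE: "1 + \<delta> \<le> E" unfolding \<delta> E mult.assoc by linarith
  have ks: "k \<le> K * s powr \<beta>"
  proof -
    \<comment> \<open>Dropping \<alpha> from \<open>l\<close> increases a negative power, and
      \<open>1 / s^2\<close> to the power \<open>- \<beta> / 2\<close> is
      \<open>s powr \<beta>\<close>.\<close>
    have "l powr (- \<beta> / 2) \<le> (1 / s\<^sup>2) powr (- \<beta> / 2)"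
      using assms by (intro powr_mono2') (auto simp: l_def)
    also have "1 / s\<^sup>2 = s powr (- 2)" using assms by (simp add: powr_minus_divide)
    also have "(s powr (- 2)) powr (- \<beta> / 2) = s powr \<beta>" by (simp add: powr_powr)
    finally show ?thesis using assms unfolding k_def l_def[symmetric] by (intro mult_left_mono) auto
  qed
  have "25 * k\<^sup>2 \<le> 2 * 10 ^ 9 * k\<^sup>2" by (rule mult_right_mono) auto
  then have "exp (25 * k\<^sup>2) \<le> exp (2 * 10 ^ 9 * k\<^sup>2)" by simp
  then have "10 ^ 9 * exp (25 * k\<^sup>2) \<le> 2 * 10 ^ 9 * exp (2 * 10 ^ 9 * k\<^sup>2)" by (intro mult_mono) auto
  then have "10 ^ 9 * exp (25 * k\<^sup>2) \<le> E" unfolding E .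
  then have "(10 ^ 9 * exp (25 * k\<^sup>2)) * k \<le> E * (K * s powr \<beta>)"
    using ks k by (intro mult_mono) (auto simp: E)
  then have "\<delta> \<le> E * (K * s powr \<beta>)" unfolding \<delta> by (simp add: mult_ac)
  then show "\<delta> \<le> E * (K * s powr \<beta>) ^ n" using n dE by auto
qed

section \<open>The bound at a fixed time\<close>

text \<open>A pointwise limit of difference quotients along one sequence of times, each of them
  measurable. This is the one place where times other than \<open>t\<close> matter for the spatial
  bound.\<close>

lemma measurable_m_deriv:
  assumes m: "\<And>t. t \<in> {0..1} \<Longrightarrow> m t \<in> on_supp \<pi> \<rightarrow>\<^sub>M Rborel d"
    and t: "t \<in> {0..1}" and diff: "m_differentiable_at d \<pi> m t" and i: "i < d"
  shows "(\<lambda>z. m_deriv m t z i) \<in> borel_measurable (on_supp \<pi>)"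
proof -
  \<comment> \<open>The derivative is one-sided at the endpoints, so the sequence stays in the unit
    interval: it approaches from the right, except at \<open>t = 1\<close>.\<close>
  define r where "r n = (if t < 1 then t + (1 - t) / (real n + 2) else 1 - 1 / (real n + 2))" for n
  have r01: "r n \<in> {0..1}" "r n \<noteq> t" for n
    using t mult_nonneg_nonneg[of "1 - t" "real n + 1"] by (auto simp: r_def field_simps)
  have rlim: "r \<longlonglongrightarrow> t"
  proof -
    have "(\<lambda>n. 1 / (real n + 2)) \<longlonglongrightarrow> 0"
      using LIMSEQ_ignore_initial_segment[OF lim_1_over_n, of 2] by (simp add: add.commute)
    then have "(\<lambda>n. t + (1 - t) * (1 / (real n + 2))) \<longlonglongrightarrow> t + (1 - t) * 0" "(\<lambda>n. 1 - 1 / (real n + 2)) \<longlonglongrightarrow> 1 - 0"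
      by (intro tendsto_intros; assumption)+
    then show ?thesis using t by (cases "t < 1") (auto simp: r_def[abs_def])
  qed
  show ?thesis
  proof (rule borel_measurable_LIMSEQ_real)
    fix z assume z: "z \<in> space (on_supp \<pi>)"
    then have "z \<in> Supp \<pi>" by (simp add: on_supp_def space_restrict_space)
    then have "(\<lambda>s. m s z i) differentiable (at t within {0..1})"
      using diff i by (auto simp: m_differentiable_at_def)
    then have "((\<lambda>s. m s z i) has_vector_derivative m_deriv m t z i) (at t within {0..1})"
      unfolding m_deriv_def time_deriv_def by (simp add: vector_derivative_works)
    then have "((\<lambda>s. m s z i) has_real_derivative m_deriv m t z i) (at t within {0..1})"
      by (simp add: has_real_derivative_iff_has_vector_derivative)
    then have "((\<lambda>s. (m s z i - m t z i) / (s - t)) \<longlongrightarrow> m_deriv m t z i) (at t within {0..1})"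
      by (simp add: has_field_derivative_iff)
    moreover have "filterlim r (at t within {0..1}) sequentially"
      unfolding filterlim_at using rlim r01 by auto
    ultimately show "(\<lambda>n. (m (r n) z i - m t z i) / (r n - t)) \<longlonglongrightarrow> m_deriv m t z i"
      by (rule filterlim_compose)
  next
    fix n
    have [measurable]: "(\<lambda>z. m s z i) \<in> borel_measurable (on_supp \<pi>)" if "s \<in> {0..1}" for s
      by (rule measurable_compose[OF m[OF that] measurable_coord])
    show "(\<lambda>z. (m (r n) z i - m t z i) / (r n - t)) \<in> borel_measurable (on_supp \<pi>)"
      using r01 t by measurable
  qed
qed


text \<open>The theorem at one time with its constant made explicit. Any decomposition of the
  density serves for the upper variance bound, whereas the lower one is taken for the very
  decomposition whose Hessian is bounded by \<open>A\<close>.\<close>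

lemma velocity_jacobian_bound:
  fixes \<beta> \<alpha> K L t :: real
  assumes d: "d \<ge> 1" and path: "gaussian_mixture_path d \<pi> m \<sigma>"
    and t: "t \<in> {0..1}" and s: "0 < \<sigma> t" and \<alpha>: "0 < \<alpha>" and K: "0 < K" and \<beta>: "0 < \<beta>"
    and dens: "\<exists>p. has_density d (pushforward d \<pi> m t) p \<and> weakly_log_concave d \<alpha> \<beta> K p"
    and diff: "m_differentiable_at d \<pi> m t" and L: "0 < L"
    and var: "variance_bound d \<pi> m \<sigma> t (L\<^sup>2 * ((\<sigma> t)\<^sup>2 / (\<alpha> * (\<sigma> t)\<^sup>2 + 1)))"
    and x: "x \<in> Rsp d"
  defines "E \<equiv> 2 * 10 ^ 9 * exp (2 * 10 ^ 9 * K\<^sup>2 / (\<alpha> + 1 / (\<sigma> t)\<^sup>2) powr \<beta>)"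
  shows "\<exists>J. has_jacobian d (velocity d \<pi> m \<sigma> t) x J \<and>
    (\<forall>\<xi>\<in>{0, 1::nat}.
       (time_deriv \<sigma> t \<le> 0 \<longrightarrow>
          lambda_max d J \<le> 1 / (\<alpha> * (\<sigma> t)\<^sup>2 + 1) *
            (E * (L - time_deriv \<sigma> t / \<sigma> t * (K * \<sigma> t powr \<beta>) ^ \<xi>) + \<sigma> t * time_deriv \<sigma> t * \<alpha>)) \<and>
       (time_deriv \<sigma> t \<ge> 0 \<longrightarrow>
          (\<forall>p u a A. has_density d (pushforward d \<pi> m t) p \<longrightarrow>
             weak_log_concave_decomp d \<alpha> \<beta> K p u a \<longrightarrow>
             hessian_le_everywhere d u A \<longrightarrow>
             lambda_max d J \<le> 1 / (\<alpha> * (\<sigma> t)\<^sup>2 + 1) *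
               (E * (L + time_deriv \<sigma> t / \<sigma> t * (K * \<sigma> t powr \<beta>) ^ \<xi>) + \<sigma> t * time_deriv \<sigma> t * A))))"
proof -
  define M where "M = on_supp \<pi>"
  have mt: "m t \<in> M \<rightarrow>\<^sub>M Rborel d"
    using path t by (simp add: gaussian_mixture_path_def M_def)
  obtain p0 u0 a0 where p0: "has_density d (pushforward d \<pi> m t) p0" "weak_log_concave_decomp d \<alpha> \<beta> K p0 u0 a0"
    using dens by (auto simp: weakly_log_concave_def)
  have law: "distr M (Rborel d) (m t) = density (Rlebesgue d) (\<lambda>y. ennreal (p y))" "prob_density_on d p"
    if "has_density d (pushforward d \<pi> m t) p" for p
    using that by (simp_all add: has_density_def pushforward_def M_def)
  \<comment> \<open>The pushforward of \<^term>\<open>M\<close> has a probability density, so \<^term>\<open>M\<close> has mass \<open>1\<close>.\<close>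
  have "prob_space M"
  proof
    have "emeasure M (space M) = emeasure (distr M (Rborel d) (m t)) (Rsp d)"
      using mt measurable_space[OF mt] by (subst emeasure_distr) (auto intro!: arg_cong[where f="emeasure M"] simp flip: space_Rborel)
    also have "\<dots> = (\<integral>\<^sup>+y. ennreal (p0 y) \<partial>Rlebesgue d)"
    proof -
      have [measurable]: "p0 \<in> borel_measurable (Rborel d)" using law(2)[OF p0(1)] by (simp add: prob_density_on_def)
      have "Rsp d \<in> sets (Rlebesgue d)" using sets.top[of "Rlebesgue d"] by simp
      then show ?thesis
        unfolding law(1)[OF p0(1)] by (subst emeasure_density) (auto intro!: nn_integral_cong)
    qed
    also have "\<dots> = 1" using law(2)[OF p0(1)] by (simp add: prob_density_on_def)
    finally show "emeasure M (space M) = 1" .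
  qed
  then interpret posterior_setup M d "m t" "\<sigma> t"
    using mt s by (simp add: posterior_setup_def posterior_setup_axioms_def)
  define c where "c = time_deriv \<sigma> t / \<sigma> t"
  define b where "b i z = m_deriv m t z i" for i z
  have post: "posterior d \<pi> m \<sigma> t y = tilt M (g y)" for y
    by (simp add: posterior_def tilt_def g_def gauss_weight_def M_def)
  have bm [measurable]: "b i \<in> borel_measurable M" if "i < d" for i
    unfolding b_def M_def using path t diff that
    by (intro measurable_m_deriv) (auto simp: gaussian_mixture_path_def)
  \<comment> \<open>Testing the variance hypothesis with coordinate vectors gives square
    integrability of each component of the time derivative.\<close>
  have b2: "integrable (tilt M (g y)) (\<lambda>z. (b i z)\<^sup>2)" if y: "y \<in> Rsp d" and i: "i < d" for y i
  proof -
    define e where "e j = (if j = i then 1 else 0 :: real)" for j :: nat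
    have e: "e \<in> Rsp d" using i by (simp add: e_def in_Rsp)
    have "(enorm d e)\<^sup>2 = (\<Sum>j<d. if j = i then 1 else 0)"
      unfolding enorm_power2 by (intro sum.cong) (auto simp: e_def)
    then have "(enorm d e)\<^sup>2 = 1" using i by simp
    then have "enorm d e = 1" using enorm_nonneg[of d e] by (simp add: power2_eq_1_iff)
    then have "integrable (tilt M (g y)) (\<lambda>z. (\<Sum>j<d. e j * m_deriv m t z j)\<^sup>2)"
      using var y e by (simp add: variance_bound_def post)
    moreover have "(\<Sum>j<d. e j * m_deriv m t z j) = b i z" for z
    proof -
      have "(\<Sum>j<d. e j * m_deriv m t z j) = (\<Sum>j<d. if j = i then b i z else 0)"
        by (intro sum.cong) (auto simp: e_def b_def)
      then show ?thesis using i by simp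
    qed
    ultimately show ?thesis by simp
  qed
  define \<phi> where "\<phi> i z = b i z - c * m t z i" for i z
  have phim [measurable]: "\<phi> i \<in> borel_measurable M" if "i < d" for i
    unfolding \<phi>_def using that by measurable
  have phi2: "integrable (tilt M (g y)) (\<lambda>z. (\<phi> i z)\<^sup>2)" and phi1: "integrable (tilt M (g y)) (\<phi> i)"
    if y: "y \<in> Rsp d" and i: "i < d" for y i
  proof -
    interpret X: weighted_prob_space M "g y" by (rule weighted_g)
    interpret P: prob_space "tilt M (g y)" by (rule X.prob_space_tilt)
    show i2: "integrable (tilt M (g y)) (\<lambda>z. (\<phi> i z)\<^sup>2)"
    proof (rule Bochner_Integration.integrable_bound)
      show "integrable (tilt M (g y)) (\<lambda>z. 2 * (b i z)\<^sup>2 + 2 * c\<^sup>2 * (m t z i)\<^sup>2)"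
        using b2[OF y i] posterior_coord_integrable(2)[of i y "\<lambda>_. 0"] i by simp
      have "(\<phi> i z)\<^sup>2 \<le> 2 * (b i z)\<^sup>2 + 2 * c\<^sup>2 * (m t z i)\<^sup>2" for z
        using zero_le_power2[of "b i z + c * m t z i"]
        by (simp add: \<phi>_def power2_diff power2_sum power_mult_distrib)
      then show "AE z in tilt M (g y). norm ((\<phi> i z)\<^sup>2) \<le> norm (2 * (b i z)\<^sup>2 + 2 * c\<^sup>2 * (m t z i)\<^sup>2)"
        by (auto intro!: AE_I2 order.trans[OF _ abs_ge_self])
      show "(\<lambda>z. (\<phi> i z)\<^sup>2) \<in> borel_measurable (tilt M (g y))" using i by measurable
    qed
    show "integrable (tilt M (g y)) (\<phi> i)"
      by (rule P.square_integrable_imp_integrable[OF _ i2]) (use i in measurable)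
  qed
  have v: "velocity d \<pi> m \<sigma> t y i = c * y i + (\<integral>z. \<phi> i z \<partial>tilt M (g y))" if y: "y \<in> Rsp d" and i: "i < d" for y i
  proof -
    interpret X: weighted_prob_space M "g y" by (rule weighted_g)
    interpret P: prob_space "tilt M (g y)" by (rule X.prob_space_tilt)
    have ps: "P.prob (space M) = 1" using P.prob_space by simp
    have "velocity d \<pi> m \<sigma> t y i = (\<integral>z. c * y i + \<phi> i z \<partial>tilt M (g y))"
      unfolding velocity_def post by (intro Bochner_Integration.integral_cong) (auto simp: \<phi>_def b_def c_def algebra_simps)
    then show ?thesis using phi1[OF y i] by (simp add: ps)
  qed
  define J where "J i j = (if j = i then c else 0) +
     (\<integral>z. (\<phi> i z - (\<integral>z. \<phi> i z \<partial>tilt M (g x))) * (m t z j - x j) \<partial>tilt M (g x)) / (\<sigma> t)\<^sup>2" for i j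
  have jac: "has_jacobian d (velocity d \<pi> m \<sigma> t) x J"
    unfolding J_def[abs_def] by (rule posterior_mean_jacobian[OF x phim phi2[OF x] v])
  define V where "V h = prob_space.variance (tilt M (g x)) (\<lambda>z. \<Sum>i<d. h i * m t z i)" for h
  define VB where "VB h = prob_space.variance (tilt M (g x)) (\<lambda>z. \<Sum>i<d. h i * b i z)" for h
  have quad: "(\<Sum>i<d. \<Sum>j<d. h i * J i j * h j) \<le> c * (1 - V h / (\<sigma> t)\<^sup>2) + (L / 2 * V h + VB h / (2 * L)) / (\<sigma> t)\<^sup>2"
    if "h \<in> Rsp d" "enorm d h = 1" for h
    using velocity_quadratic_form[where c=c, OF x that bm b2[OF x] L]
    by (simp add: J_def \<phi>_def V_def VB_def)
  have VB: "VB h \<le> L\<^sup>2 * ((\<sigma> t)\<^sup>2 / (\<alpha> * (\<sigma> t)\<^sup>2 + 1))" if "h \<in> Rsp d" "enorm d h = 1" for h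
    using var x that by (simp add: variance_bound_def post VB_def b_def)
  define \<delta> where "\<delta> = 10 ^ 9 * (K * (\<alpha> + 1 / (\<sigma> t)\<^sup>2) powr (- \<beta> / 2)) * exp (25 * (K * (\<alpha> + 1 / (\<sigma> t)\<^sup>2) powr (- \<beta> / 2))\<^sup>2)"
  note fac = perturbation_factor[OF s \<alpha> K \<beta>, folded \<delta>_def E_def]
  have Vup: "(\<alpha> + 1 / (\<sigma> t)\<^sup>2) * V h \<le> 1 + \<delta>" if "h \<in> Rsp d" "enorm d h = 1" for h
    using posterior_variance_bounds(1)[OF x law(2)[OF p0(1)] law(1)[OF p0(1)] p0(2) that]
    by (simp add: V_def \<delta>_def)
  have ct: "(\<sigma> t)\<^sup>2 * c * r = \<sigma> t * time_deriv \<sigma> t * r" for r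
    using s by (simp add: c_def power2_eq_square)
  show ?thesis
  proof (intro exI[of _ J] conjI ballI impI allI jac)
    fix \<xi> :: nat assume \<xi>: "\<xi> \<in> {0, 1}" and neg: "time_deriv \<sigma> t \<le> 0"
    have c: "c \<le> 0" using neg s by (simp add: c_def divide_nonpos_pos)
    show "lambda_max d J \<le> 1 / (\<alpha> * (\<sigma> t)\<^sup>2 + 1) *
            (E * (L - time_deriv \<sigma> t / \<sigma> t * (K * \<sigma> t powr \<beta>) ^ \<xi>) + \<sigma> t * time_deriv \<sigma> t * \<alpha>)"
    proof (rule lambda_max_le[OF d])
      fix h assume h: "h \<in> Rsp d" "enorm d h = 1"
      \<comment> \<open>Multiplication by \<open>c \<le> 0\<close> reverses the upper variance
        bound, so \<alpha> alone controls this case.\<close>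
      have "c * (1 + \<delta>) \<le> c * ((\<alpha> + 1 / (\<sigma> t)\<^sup>2) * V h)"
        using Vup[OF h] c by (rule mult_left_mono_neg)
      moreover have "(\<alpha> + 1 / (\<sigma> t)\<^sup>2) * (\<sigma> t)\<^sup>2 = \<alpha> * (\<sigma> t)\<^sup>2 + 1"
        using s by (simp add: distrib_right)
      ultimately have cV: "c * ((\<alpha> + 1 / (\<sigma> t)\<^sup>2) * (\<sigma> t)\<^sup>2 - (\<alpha> + 1 / (\<sigma> t)\<^sup>2) * V h) \<le> (\<sigma> t)\<^sup>2 * c * \<alpha> + \<bar>c\<bar> * \<delta>"
        using c by (simp only: right_diff_distrib) (simp add: algebra_simps)
      show "(\<Sum>i<d. \<Sum>j<d. h i * J i j * h j) \<le> 1 / (\<alpha> * (\<sigma> t)\<^sup>2 + 1) *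
            (E * (L - time_deriv \<sigma> t / \<sigma> t * (K * \<sigma> t powr \<beta>) ^ \<xi>) + \<sigma> t * time_deriv \<sigma> t * \<alpha>)"
        using order.trans[OF quad[OF h] lambda_bound[OF s \<alpha> L fac(1)[OF \<xi>] Vup[OF h] VB[OF h] cV fac(2,3)[OF \<xi>]]]
        unfolding ct abs_of_nonpos[OF c] unfolding c_def by simp
    qed
  next
    fix \<xi> :: nat and p u a A
    assume \<xi>: "\<xi> \<in> {0, 1}" and nn: "0 \<le> time_deriv \<sigma> t" and p: "has_density d (pushforward d \<pi> m t) p"
      and dec: "weak_log_concave_decomp d \<alpha> \<beta> K p u a" and A: "hessian_le_everywhere d u A"
    have c: "0 \<le> c" using nn s by (simp add: c_def)
    show "lambda_max d J \<le> 1 / (\<alpha> * (\<sigma> t)\<^sup>2 + 1) *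
            (E * (L + time_deriv \<sigma> t / \<sigma> t * (K * \<sigma> t powr \<beta>) ^ \<xi>) + \<sigma> t * time_deriv \<sigma> t * A)"
    proof (rule lambda_max_le[OF d])
      fix h assume h: "h \<in> Rsp d" "enorm d h = 1"
      have "(\<alpha> + 1 / (\<sigma> t)\<^sup>2) * (\<sigma> t)\<^sup>2 - (\<alpha> + 1 / (\<sigma> t)\<^sup>2) * V h \<le> (\<sigma> t)\<^sup>2 * A + \<delta>"
        using posterior_variance_bounds(2)[OF x law(2)[OF p] law(1)[OF p] dec h A] by (simp add: V_def \<delta>_def)
      from mult_left_mono[OF this c]
      have cV: "c * ((\<alpha> + 1 / (\<sigma> t)\<^sup>2) * (\<sigma> t)\<^sup>2 - (\<alpha> + 1 / (\<sigma> t)\<^sup>2) * V h) \<le> (\<sigma> t)\<^sup>2 * c * A + \<bar>c\<bar> * \<delta>"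
        using c by (simp add: algebra_simps)
      show "(\<Sum>i<d. \<Sum>j<d. h i * J i j * h j) \<le> 1 / (\<alpha> * (\<sigma> t)\<^sup>2 + 1) *
            (E * (L + time_deriv \<sigma> t / \<sigma> t * (K * \<sigma> t powr \<beta>) ^ \<xi>) + \<sigma> t * time_deriv \<sigma> t * A)"
        using order.trans[OF quad[OF h] lambda_bound[OF s \<alpha> L fac(1)[OF \<xi>] Vup[OF h] VB[OF h] cV fac(2,3)[OF \<xi>]]]
        unfolding ct abs_of_nonneg[OF c] unfolding c_def by simp
    qed
  qed
qed

theorem theorem1:
  fixes \<beta> :: real
  assumes "0 < \<beta>" and "\<beta> \<le> 1"
  shows "\<exists>C>0. \<forall>(d::nat) \<pi> m \<sigma> (\<alpha> :: real \<Rightarrow> real) K L.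
    d \<ge> 1 \<longrightarrow>
    gaussian_mixture_path d \<pi> m \<sigma> \<longrightarrow>
    C1_ae_01 \<sigma> \<longrightarrow>
    (\<forall>t\<in>{0..1}. \<sigma> t > 0 \<longrightarrow>
       \<alpha> t > 0 \<and> K t > 0 \<and>
       (\<exists>p. has_density d (pushforward d \<pi> m t) p \<and> weakly_log_concave d (\<alpha> t) \<beta> (K t) p)) \<longrightarrow>
    (\<forall>t\<in>{0..1}. \<sigma> t > 0 \<longrightarrow> m_differentiable_at d \<pi> m t \<longrightarrow>
       L t > 0 \<and>
       variance_bound d \<pi> m \<sigma> t ((L t)\<^sup>2 * ((\<sigma> t)\<^sup>2 / (\<alpha> t * (\<sigma> t)\<^sup>2 + 1)))) \<longrightarrow>
    (\<forall>t\<in>{0..1}. \<sigma> t > 0 \<longrightarrow>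
       \<sigma> differentiable (at t within {0..1}) \<longrightarrow> m_differentiable_at d \<pi> m t \<longrightarrow>
       (\<forall>x\<in>Rsp d. \<exists>J. has_jacobian d (velocity d \<pi> m \<sigma> t) x J \<and>
          (\<forall>\<xi>\<in>{0, 1::nat}.
             (time_deriv \<sigma> t \<le> 0 \<longrightarrow>
                lambda_max d J \<le> 1 / (\<alpha> t * (\<sigma> t)\<^sup>2 + 1) *
                  (C * exp (C * (K t)\<^sup>2 / (\<alpha> t + 1 / (\<sigma> t)\<^sup>2) powr \<beta>)
                     * (L t - time_deriv \<sigma> t / \<sigma> t * (K t * \<sigma> t powr \<beta>) ^ \<xi>)
                   + \<sigma> t * time_deriv \<sigma> t * \<alpha> t)) \<and>
             (time_deriv \<sigma> t \<ge> 0 \<longrightarrow>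
                (\<forall>p u a A. has_density d (pushforward d \<pi> m t) p \<longrightarrow>
                   weak_log_concave_decomp d (\<alpha> t) \<beta> (K t) p u a \<longrightarrow>
                   hessian_le_everywhere d u A \<longrightarrow>
                   lambda_max d J \<le> 1 / (\<alpha> t * (\<sigma> t)\<^sup>2 + 1) *
                     (C * exp (C * (K t)\<^sup>2 / (\<alpha> t + 1 / (\<sigma> t)\<^sup>2) powr \<beta>)
                        * (L t + time_deriv \<sigma> t / \<sigma> t * (K t * \<sigma> t powr \<beta>) ^ \<xi>)
                      + \<sigma> t * time_deriv \<sigma> t * A))))))"
proof (intro exI[of _ "2 * 10 ^ 9"] conjI)
  \<comment> \<open>One number serves every \<beta>: the exponent enters only through
    \<open>k\<close> and through \<open>r powr \<beta> \<le> 1 + r\<close>.\<close>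
  show "(0::real) < 2 * 10 ^ 9" by simp
qed (intro allI impI ballI, rule velocity_jacobian_bound, use assms in \<open>blast+\<close>)

end
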